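(* Let $M\ge 0$ and let $\{P_\alpha,Q_\alpha\}_{\alpha=0}^M$ be pairs of functions of two variables with $\{P_\alpha(p,x),Q_\alpha(p,x)\}=1$ for all $\alpha$. Let $(z_\alpha(p,\boldsymbol{t}),m_\alpha(p,\boldsymbol{t}))$, $\alpha=0,\dots,M$, be a solution of the system of string equations $$P_i(z_i,m_i)=P_0(z_0,m_0),\qquad Q_i(z_i,m_i)=Q_0(z_0,m_0),\qquad i=1,\dots,M,$$ which admits expansions of the form $$z_0=p+\sum_{n\ge1}\frac{d_{0n}}{p^n}\ (p\to\infty),\qquad z_i=\frac{d_i}{p-q_i}+\sum_{n\ge0}d_{in}(p-q_i)^n\ (p\to q_i),\quad i=1,\dots,M,$$ $$m_\alpha=\sum_{n\ge1}n\,t_{\alpha n}z_\alpha^{n-1}+\frac{t_{\alpha0}}{z_\alpha}+\sum_{n\ge2}\frac{v_{\alpha n}}{z_\alpha^n},\qquad t_{00}:=-\sum_{i=1}^M t_{i0},\qquad \alpha=0,\dots,M,$$ where $q_i,d_i,d_{\alpha n},v_{\alpha n}$ are functions of $\boldsymbol{t}$. Put $\mathcal P_\alpha(p,\boldsymbol{t}):=P_\alpha(z_\alpha(p,\boldsymbol{t}),m_\alpha(p,\boldsymbol{t}))$ and $\mathcal Q_\alpha(p,\boldsymbol{t}):=Q_\alpha(z_\alpha(p,\boldsymbol{t}),m_\alpha(p,\boldsymbol{t}))$, so that $\mathrm{d}\mathcal P_\alpha\wedge \mathrm{d}\mathcal Q_\alpha=\mathrm{d}z_\beta\wedge \mathrm{d}m_\beta$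 for all $\alpha,\beta$. Suppose that the coefficients of these two-forms (with respect to the basis $\mathrm{d}p\wedge \mathrm{d}t_{\alpha n}$, $\mathrm{d}t_{\alpha n}\wedge \mathrm{d}t_{\beta m}$) are meromorphic functions of the complex variable $p$ with finite poles at $\{q_1,\dots,q_M\}$ only. Then $(z_\alpha(p,\boldsymbol{t}),m_\alpha(p,\boldsymbol{t}))_{\alpha=0}^M$ is a solution of the Whitham hierarchy, that is, $$\mathrm{d}z_\alpha\wedge \mathrm{d}m_\alpha=\mathrm{d}\omega,\qquad \omega:=\sum_{\mu,n}\Omega_{\mu n}\,\mathrm{d}t_{\mu n},\qquad \alpha=0,\dots,M.$$
   Context: Greek indices run over $\{0,\dots,M\}$ and Latin indices $i,j,\dots$ (labelling punctures) over $\{1,\dots,M\}$. The punctures are $q_0:=\infty$ and points $q_1,\dots,q_M$ of the complex $p$-plane (depending on $\boldsymbol{t}$). The independent times are $\boldsymbol{t}=\{t_{0n}\}_{n\ge1}\cup\{t_{in}\}_{n\ge0,\,1\le i\le M}$, with $x:=t_{01}$. The exterior derivative $\mathrm{d}$ is taken with respect to $(p,\boldsymbol{t})$. Poisson bracket: $\{F,G\}:=\frac{\partial F}{\partial p}\frac{\partial G}{\partial x}-\frac{\partial F}{\partial x}\frac{\partial G}{\partial p}$. Projectors: $(\cdot)_{(0,+)}$ is the projection of Laurent series at $p=\infty$ onto the span of $\{p^n\}_{n\ge0}$, and $(\cdot)_{(i,+)}$ is the projection of Laurent series at $p=q_i$ onto the span of $\{(p-q_i)^{-n}\}_{n\ge1}$.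 Hamiltonians: $\Omega_{\mu n}:=(z_\mu^n)_{(\mu,+)}$ for $n\ge1$, and $\Omega_{i0}:=-\log_i(p-q_i)$ for $i=1,\dots,M$, where $\log_i$ is a branch of the logarithm defined using a cut joining $\infty$ to $q_i$ (the cuts being non-intersecting). The sum defining $\omega$ runs over all $(\mu,n)$ with $n\ge1$ and all $(i,0)$. The Whitham hierarchy (genus zero) for functions $(z_\alpha,m_\alpha)$ with expansions of the stated form is the system $\mathrm{d}z_\alpha\wedge \mathrm{d}m_\alpha=\mathrm{d}\omega$ for all $\alpha$; it encodes $\{z_\alpha,m_\alpha\}=1$ together with the Lax equations $\partial z_\alpha/\partial t_{\mu n}=\{\Omega_{\mu n},z_\alpha\}$, $\partial m_\alpha/\partial t_{\mu n}=\{\Omega_{\mu n},m_\alpha\}$. Each $(z_\alpha,m_\alpha)$ is a priori defined near $q_\alpha$; the string equations, and the equalities among two-forms, are understood as equalities of functions of $(p,\boldsymbol{t})$ (after analytic continuation in $p$ where needed), so that the coefficients of the two-forms are single functions of $p$ whose Laurent expansion at $q_\beta$ is given by $\mathrm{d}z_\beta\wedge \mathrm{d}m_\beta$. *)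

theory Defs
  imports "HOL-Complex_Analysis.Complex_Analysis"
begin

text \<open>
  A point in the space of times is a family of complex numbers \<open>t (\<alpha>, n)\<close>. Only the entries with
  index in \<open>tidx M\<close> are independent variables; the others are never used (in particular
  \<open>t (0, 0)\<close> is not used, see \<open>tzero\<close>). Infinitely many times may be nonzero.
\<close>

type_synonym times = "nat \<times> nat \<Rightarrow> complex"
type_synonym pt_fun = "complex \<Rightarrow> times \<Rightarrow> complex"

definition tidx :: "nat \<Rightarrow> (nat \<times> nat) set" where
  "tidx M = {(\<alpha>, n). \<alpha> \<le> M \<and> (\<alpha> = 0 \<longrightarrow> n \<ge> 1)}"

definition tzero :: "nat \<Rightarrow> nat \<Rightarrow> times \<Rightarrow> complex" where
  "tzero M \<alpha> t = (if \<alpha> = 0 then - (\<Sum>i = 1..M. t (i, 0)) else t (\<alpha>, 0))"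

text \<open>
  Holomorphy in two complex variables is complex Frechet differentiability. Functions of
  \<open>(p, t)\<close> with infinitely many times are required to be holomorphic, jointly, in \<open>p\<close> and any one
  of the times; this is all that is needed to form exterior derivatives.
\<close>

definition hol2_on :: "(complex \<times> complex \<Rightarrow> complex) \<Rightarrow> (complex \<times> complex) set \<Rightarrow> bool" where
  "hol2_on f S \<longleftrightarrow>
     (\<forall>x\<in>S. \<exists>A B. (f has_derivative (\<lambda>h. A * fst h + B * snd h)) (at x within S))"

definition open_t :: "nat \<Rightarrow> times set \<Rightarrow> bool" where
  "open_t M T \<longleftrightarrow> (\<forall>t\<in>T. \<forall>a\<in>tidx M. open {s. t(a := s) \<in> T})"

definition hol_t :: "nat \<Rightarrow> times set \<Rightarrow> (times \<Rightarrow> complex) \<Rightarrow> bool" where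
  "hol_t M T f \<longleftrightarrow>
     (\<forall>t\<in>T. \<forall>a\<in>tidx M. (\<lambda>s. f (t(a := s))) holomorphic_on {s. t(a := s) \<in> T})"

definition slice :: "(complex \<times> times) set \<Rightarrow> times \<Rightarrow> nat \<times> nat \<Rightarrow> (complex \<times> complex) set" where
  "slice D t a = {(p, s). (p, t(a := s)) \<in> D}"

definition open_pt :: "nat \<Rightarrow> (complex \<times> times) set \<Rightarrow> bool" where
  "open_pt M D \<longleftrightarrow> (\<forall>(p, t)\<in>D. \<forall>a\<in>tidx M. open (slice D t a))"

definition hol_pt :: "nat \<Rightarrow> (complex \<times> times) set \<Rightarrow> pt_fun \<Rightarrow> bool" where
  "hol_pt M D f \<longleftrightarrow>
     (\<forall>(p, t)\<in>D. \<forall>a\<in>tidx M. hol2_on (\<lambda>(p', s). f p' (t(a := s))) (slice D t a))"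

definition over :: "times set \<Rightarrow> (times \<Rightarrow> complex set) \<Rightarrow> (complex \<times> times) set" where
  "over T U = {(p, t). t \<in> T \<and> p \<in> U t}"

text \<open>Punctured neighbourhoods of \<open>q\<^sub>\<alpha>\<close>, where \<open>q\<^sub>0 = \<infinity>\<close> (so \<open>q 0\<close> is never used).\<close>

definition pnbhd :: "(nat \<Rightarrow> times \<Rightarrow> complex) \<Rightarrow> (nat \<Rightarrow> times \<Rightarrow> real) \<Rightarrow> nat \<Rightarrow> times \<Rightarrow> complex set"
  where
  "pnbhd q \<rho> \<alpha> t =
     (if \<alpha> = 0 then {p. norm p > \<rho> 0 t} else ball (q \<alpha> t) (\<rho> \<alpha> t) - {q \<alpha> t})"

text \<open>
  Germs at \<open>(p, t)\<close>, along the plane spanned by the directions \<open>p\<close> and \<open>t\<^sub>a\<close>.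
\<close>

definition germ_eq :: "nat \<times> nat \<Rightarrow> complex \<Rightarrow> times \<Rightarrow> pt_fun \<Rightarrow> pt_fun \<Rightarrow> bool" where
  "germ_eq a p t f g \<longleftrightarrow>
     (\<forall>\<^sub>F (p', s) in nhds (p, t a). f p' (t(a := s)) = g p' (t(a := s)))"

definition germ_hol :: "nat \<times> nat \<Rightarrow> complex \<Rightarrow> times \<Rightarrow> pt_fun \<Rightarrow> bool" where
  "germ_hol a p t f \<longleftrightarrow>
     (\<exists>S. open S \<and> (p, t a) \<in> S \<and> hol2_on (\<lambda>(p', s). f p' (t(a := s))) S)"

text \<open>
  Continuing the germ of \<open>f\<close> at \<open>(pathstart \<gamma>, t)\<close> along the path \<open>\<gamma>\<close> in the \<open>p\<close>-plane yields the
  germ of \<open>g\<close> at \<open>(pathfinish \<gamma>, t)\<close>. The germ at time \<open>u\<close> of the continuation is that of \<open>\<Phi> u\<close>.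
\<close>

definition continues_to :: "nat \<Rightarrow> times \<Rightarrow> (real \<Rightarrow> complex) \<Rightarrow> pt_fun \<Rightarrow> pt_fun \<Rightarrow> bool" where
  "continues_to M t \<gamma> f g \<longleftrightarrow> path \<gamma> \<and>
     (\<exists>\<Phi> :: real \<Rightarrow> pt_fun. \<forall>a\<in>tidx M.
        germ_eq a (pathstart \<gamma>) t (\<Phi> 0) f \<and>
        germ_eq a (pathfinish \<gamma>) t (\<Phi> 1) g \<and>
        (\<forall>u\<in>{0..1}. germ_hol a (\<gamma> u) t (\<Phi> u) \<and>
           (\<forall>\<^sub>F u' in at u within {0..1}. germ_eq a (\<gamma> u') t (\<Phi> u') (\<Phi> u))))"

definition poisson ::
  "(complex \<Rightarrow> complex \<Rightarrow> complex) \<Rightarrow> (complex \<Rightarrow> complex \<Rightarrow> complex) \<Rightarrow> complex \<Rightarrow> complex \<Rightarrow> complex"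
  where
  "poisson F G p x =
     deriv (\<lambda>p. F p x) p * deriv (\<lambda>x. G p x) x - deriv (\<lambda>x. F p x) x * deriv (\<lambda>p. G p x) p"

datatype coord = Cp | Ct "nat \<times> nat"

definition coords :: "nat \<Rightarrow> coord set" where
  "coords M = insert Cp (Ct ` tidx M)"

fun pd :: "coord \<Rightarrow> pt_fun \<Rightarrow> pt_fun" where
  "pd Cp f p t = deriv (\<lambda>p. f p t) p"
| "pd (Ct a) f p t = deriv (\<lambda>s. f p (t(a := s))) (t a)"

text \<open>
  A one-form \<open>\<theta>\<close> is given by its coefficients \<open>\<theta> c\<close> with respect to \<open>dc\<close>, a two-form \<open>\<Theta>\<close> by its
  coefficients \<open>\<Theta> c c'\<close> with respect to \<open>dc \<and> dc'\<close>, antisymmetric in \<open>c\<close> and \<open>c'\<close>.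
\<close>

definition d_fun :: "pt_fun \<Rightarrow> coord \<Rightarrow> pt_fun" where
  "d_fun f c = pd c f"

definition wedge :: "(coord \<Rightarrow> pt_fun) \<Rightarrow> (coord \<Rightarrow> pt_fun) \<Rightarrow> coord \<Rightarrow> coord \<Rightarrow> pt_fun" where
  "wedge \<theta> \<eta> c c' p t = \<theta> c p t * \<eta> c' p t - \<theta> c' p t * \<eta> c p t"

definition d_form :: "(coord \<Rightarrow> pt_fun) \<Rightarrow> coord \<Rightarrow> coord \<Rightarrow> pt_fun" where
  "d_form \<theta> c c' p t = pd c (\<theta> c') p t - pd c' (\<theta> c) p t"

definition proj_inf :: "(complex \<Rightarrow> complex) \<Rightarrow> complex \<Rightarrow> complex" where
  "proj_inf f p = (let F = laurent_expansion (\<lambda>w. f (inverse w)) 0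
                   in poly (fls_prpart F) p + fls_nth F 0)"

text \<open>The polynomial \<open>fls_prpart\<close> collects the coefficients of strictly negative exponents.\<close>

definition proj_at :: "complex \<Rightarrow> (complex \<Rightarrow> complex) \<Rightarrow> complex \<Rightarrow> complex" where
  "proj_at q f p = poly (fls_prpart (laurent_expansion f q)) (inverse (p - q))"

text \<open>A cut joining \<open>q\<close> to \<open>\<infinity>\<close>: a simple arc starting at \<open>q\<close> and tending to \<open>\<infinity>\<close>.\<close>

definition is_cut :: "complex \<Rightarrow> complex set \<Rightarrow> bool" where
  "is_cut q K \<longleftrightarrow>
     (\<exists>g :: real \<Rightarrow> complex. continuous_on {0..} g \<and> inj_on g {0..} \<and> g 0 = q \<and>
        filterlim g at_infinity at_top \<and> K = g ` {0..})"

text \<open>\<open>L i p t\<close> stands for \<open>log\<^sub>i (p - q\<^sub>i(t))\<close>.\<close>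

definition Omega ::
  "(nat \<Rightarrow> times \<Rightarrow> complex) \<Rightarrow> (nat \<Rightarrow> pt_fun) \<Rightarrow> (nat \<Rightarrow> pt_fun) \<Rightarrow> nat \<times> nat \<Rightarrow> pt_fun" where
  "Omega q L z = (\<lambda>(\<mu>, n) p t.
     if n = 0 then - L \<mu> p t
     else if \<mu> = 0 then proj_inf (\<lambda>p'. z 0 p' t ^ n) p
     else proj_at (q \<mu> t) (\<lambda>p'. z \<mu> p' t ^ n) p)"

fun omega ::
  "(nat \<Rightarrow> times \<Rightarrow> complex) \<Rightarrow> (nat \<Rightarrow> pt_fun) \<Rightarrow> (nat \<Rightarrow> pt_fun) \<Rightarrow> coord \<Rightarrow> pt_fun" where
  "omega q L z Cp = (\<lambda>p t. 0)"
| "omega q L z (Ct a) = Omega q L z a"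

end

theory Submission
  imports Defs
begin

text \<open>
  At the puncture \<open>q\<^sub>\<alpha>\<close> use a local coordinate \<open>w\<close> (\<open>p = 1/w\<close> or \<open>p = q\<^sub>i + w\<close>) in which the puncture
  does not move with \<open>t\<close>. The expansion of \<open>m\<^sub>\<alpha>\<close> in powers of \<open>z\<^sub>\<alpha>\<close> turns \<open>dz\<^sub>\<alpha> \<and> dm\<^sub>\<alpha>\<close> into
  \<open>\<Sum>\<^sub>n d(z\<^sub>\<alpha>\<^sup>n) \<and> dt\<^sub>\<alpha>\<^sub>n + dz\<^sub>\<alpha>/z\<^sub>\<alpha> \<and> dt\<^sub>\<alpha>\<^sub>0\<close> plus terms with \<open>z\<^sub>\<alpha>\<^sup>-\<^sup>2\<close> or smaller, so near \<open>q\<^sub>\<alpha>\<close> its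
  coefficients agree with those of \<open>d\<omega>\<close> up to \<open>O(1)\<close>, respectively \<open>O(1/p)\<close> at infinity. Since the
  brackets \<open>{P\<^sub>\<alpha>, Q\<^sub>\<alpha>}\<close> are \<open>1\<close>, continuing the string equations along a path shows that the
  coefficients of all \<open>dz\<^sub>\<alpha> \<and> dm\<^sub>\<alpha>\<close> are the same functions of \<open>p\<close>, holomorphic off the \<open>q\<^sub>i\<close>. Their
  differences with the coefficients of \<open>d\<omega>\<close> therefore extend to entire functions vanishing at
  infinity, and Liouville's theorem applies. No expansion is differentiated term by term in \<open>t\<close>:
  an estimate \<open>O(g(w))\<close> valid for all times near \<open>t\<close> is inherited by the time derivative, by the
  maximum principle in \<open>w\<close> and Cauchy's inequality in \<open>t\<close>.
\<close>

section \<open>Functions of two complex variables\<close>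

text \<open>The obstacle is that the punctures move. At fixed \<open>p\<close> a time derivative of
  \<open>1/(p - q i t)^n\<close> raises the order of the pole, so orders at a puncture are not
  inherited by time derivatives; at fixed \<open>w\<close> they are. The price is paid on returning
  to \<open>p\<close>: a time derivative at fixed \<open>w\<close> contains the velocity of the
  puncture times the \<open>p\<close> derivative, so each \<open>dt \<and> dt\<close> coefficient
  comes mixed with two \<open>dp \<and> dt\<close> coefficients. The latter are therefore identified
  first, and their differences then vanish from the former. At infinity the orders are weighed
  differently, because \<open>dp = -dw/w^2\<close>: an error \<open>O(1/w)\<close> in a
  \<open>dw\<close> coefficient is an error \<open>O(1/p)\<close> in the \<open>dp\<close>
  coefficient, which is what vanishing at infinity demands. Infinitely many times cause no trouble
  because the leading part of \<open>m \<alpha>\<close>, at fixed \<open>z \<alpha>\<close>, is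
  affine in each single time: changing one time adds one monomial to the series, and no series of
  functions has to be differentiated in a parameter.\<close>

definition cdiff2 :: "(complex \<times> complex \<Rightarrow> complex) \<Rightarrow> complex \<times> complex \<Rightarrow> bool" where
  "cdiff2 f x \<longleftrightarrow> (\<exists>A B. (f has_derivative (\<lambda>h. A * fst h + B * snd h)) (at x))"

lemma hol2_on_open: "open S \<Longrightarrow> hol2_on f S \<longleftrightarrow> (\<forall>x\<in>S. cdiff2 f x)"
  unfolding hol2_on_def cdiff2_def by (intro ball_cong refl) (simp only: at_within_open)

lemma cdiff2_const [simp]: "cdiff2 (\<lambda>x. c) x"
  unfolding cdiff2_def by (intro exI[of _ 0]) simp

lemma cdiff2_fst [simp]: "cdiff2 fst x"
  unfolding cdiff2_def by (intro exI[of _ 1] exI[of _ 0]) (simp add: has_derivative_fst)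

lemma cdiff2_snd [simp]: "cdiff2 snd x"
  unfolding cdiff2_def by (intro exI[of _ 0] exI[of _ 1]) (simp add: has_derivative_snd)

lemma cdiff2_isCont: "cdiff2 f x \<Longrightarrow> isCont f x"
  unfolding cdiff2_def by (metis has_derivative_continuous)

text \<open>The one chain rule from which closure under sums and products and the passage to local
  coordinates follow, by choosing the outer function.\<close>

lemma cdiff2_compose2:
  assumes "cdiff2 g (f1 x, f2 x)" "cdiff2 f1 x" "cdiff2 f2 x"
  shows "cdiff2 (\<lambda>x. g (f1 x, f2 x)) x"
proof -
  from assms obtain A B A1 B1 A2 B2 where
    g: "(g has_derivative (\<lambda>h. A * fst h + B * snd h)) (at (f1 x, f2 x))" and
    f: "(f1 has_derivative (\<lambda>h. A1 * fst h + B1 * snd h)) (at x)"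
       "(f2 has_derivative (\<lambda>h. A2 * fst h + B2 * snd h)) (at x)"
    unfolding cdiff2_def by blast
  have "((\<lambda>x. (f1 x, f2 x)) has_derivative
      (\<lambda>h. (A1 * fst h + B1 * snd h, A2 * fst h + B2 * snd h))) (at x)"
    by (intro has_derivative_Pair f)
  from diff_chain_at[OF this g] show ?thesis
    unfolding cdiff2_def
    by (intro exI[of _ "A * A1 + B * A2"] exI[of _ "A * B1 + B * B2"])
      (simp add: o_def algebra_simps)
qed

lemma cdiff2_compose1:
  assumes "g field_differentiable at (f x)" "cdiff2 f x"
  shows "cdiff2 (\<lambda>x. g (f x)) x"
proof -
  from assms obtain D A B where
    g: "(g has_derivative (\<lambda>h. D * h)) (at (f x))" and
    f: "(f has_derivative (\<lambda>h. A * fst h + B * snd h)) (at x)"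
    unfolding cdiff2_def field_differentiable_def has_field_derivative_def by blast
  from diff_chain_at[OF f g] show ?thesis
    unfolding cdiff2_def
    by (intro exI[of _ "D * A"] exI[of _ "D * B"]) (simp add: o_def algebra_simps)
qed

lemma cdiff2_add:
  assumes "cdiff2 f x" "cdiff2 g x"
  shows "cdiff2 (\<lambda>x. f x + g x) x"
proof -
  have "((\<lambda>y. fst y + snd y) has_derivative (\<lambda>h. 1 * fst h + 1 * snd h)) (at (f x, g x))"
    by (auto intro!: derivative_eq_intros)
  hence "cdiff2 (\<lambda>y. fst y + snd y) (f x, g x)" unfolding cdiff2_def by blast
  from cdiff2_compose2[OF this assms] show ?thesis by simp
qed

lemma cdiff2_mult:
  assumes "cdiff2 f x" "cdiff2 g x"
  shows "cdiff2 (\<lambda>x. f x * g x) x"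
proof -
  have "((\<lambda>y. fst y * snd y) has_derivative (\<lambda>h. g x * fst h + f x * snd h)) (at (f x, g x))"
    by (auto intro!: derivative_eq_intros)
  hence "cdiff2 (\<lambda>y. fst y * snd y) (f x, g x)" unfolding cdiff2_def by blast
  from cdiff2_compose2[OF this assms] show ?thesis by simp
qed

lemma cdiff2_diff:
  assumes "cdiff2 f x" "cdiff2 g x"
  shows "cdiff2 (\<lambda>x. f x - g x) x"
  using cdiff2_add[OF assms(1) cdiff2_mult[OF cdiff2_const[of "-1"] assms(2)]] by simp

lemma cdiff2_inverse:
  assumes "cdiff2 f x" "f x \<noteq> 0"
  shows "cdiff2 (\<lambda>x. inverse (f x)) x"
  by (rule cdiff2_compose1[of inverse f x]) (use assms in \<open>auto intro: derivative_intros\<close>)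

lemma cdiff2_divide:
  assumes "cdiff2 f x" "cdiff2 g x" "g x \<noteq> 0"
  shows "cdiff2 (\<lambda>x. f x / g x) x"
  unfolding divide_inverse by (intro cdiff2_mult cdiff2_inverse assms)

lemma cdiff2_power: "cdiff2 f x \<Longrightarrow> cdiff2 (\<lambda>x. f x ^ n) x"
  by (induction n) (auto intro: cdiff2_mult)

lemma cdiff2_sum: "(\<And>k. k \<in> I \<Longrightarrow> cdiff2 (f k) x) \<Longrightarrow> cdiff2 (\<lambda>x. \<Sum>k\<in>I. f k x) x"
  by (induction I rule: infinite_finite_induct) (auto intro: cdiff2_add)

lemma cdiff2_fun_snd: "g field_differentiable at (snd x) \<Longrightarrow> cdiff2 (\<lambda>x. g (snd x)) x"
  by (rule cdiff2_compose1) auto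

lemmas cdiff2_intros = cdiff2_const cdiff2_fst cdiff2_snd cdiff2_add cdiff2_mult cdiff2_diff
  cdiff2_divide cdiff2_power cdiff2_sum

text \<open>Restricting to the two coordinate lines forces the coefficients of the total derivative
  to be the partial derivatives, so that the total function \<open>deriv\<close> carries its
  intended meaning.\<close>

lemma has_derivative_cdiff2:
  assumes "cdiff2 f (p, s)"
  shows "(f has_derivative
    (\<lambda>h. deriv (\<lambda>x. f (x, s)) p * fst h + deriv (\<lambda>y. f (p, y)) s * snd h)) (at (p, s))"
proof -
  from assms obtain A B where
    f: "(f has_derivative (\<lambda>h. A * fst h + B * snd h)) (at (p, s))"
    unfolding cdiff2_def by blast
  have "((\<lambda>x. (x, s)) has_derivative (\<lambda>h. (h, 0))) (at p)"
    by (auto intro!: derivative_eq_intros)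
  from diff_chain_at[OF this f] have "((\<lambda>x. f (x, s)) has_field_derivative A) (at p)"
    by (simp add: o_def has_field_derivative_def)
  moreover have "((\<lambda>y. (p, y)) has_derivative (\<lambda>h. (0, h))) (at s)"
    by (auto intro!: derivative_eq_intros)
  from diff_chain_at[OF this f] have "((\<lambda>y. f (p, y)) has_field_derivative B) (at s)"
    by (simp add: o_def has_field_derivative_def)
  ultimately show ?thesis using f by (simp add: DERIV_imp_deriv)
qed

lemma cdiff2_curve:
  assumes "cdiff2 f (u x, v x)" "(u has_field_derivative u') (at x)"
    "(v has_field_derivative v') (at x)"
  shows "((\<lambda>x. f (u x, v x)) has_field_derivative
    (deriv (\<lambda>y. f (y, v x)) (u x) * u' + deriv (\<lambda>y. f (u x, y)) (v x) * v')) (at x)"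
proof -
  have "((\<lambda>x. (u x, v x)) has_derivative (\<lambda>h. (u' * h, v' * h))) (at x)"
    using assms(2,3) by (auto intro!: derivative_eq_intros simp: has_field_derivative_def)
  from diff_chain_at[OF this has_derivative_cdiff2[OF assms(1)]] show ?thesis
    by (simp add: o_def has_field_derivative_def distrib_right[symmetric] mult.assoc[symmetric])
qed

lemma cdiff2_fst_deriv:
  "cdiff2 f (p, s) \<Longrightarrow> ((\<lambda>x. f (x, s)) has_field_derivative deriv (\<lambda>x. f (x, s)) p) (at p)"
  using cdiff2_curve[of f "\<lambda>x. x" p "\<lambda>_. s" 1 0] by simp

lemma cdiff2_snd_deriv:
  "cdiff2 f (p, s) \<Longrightarrow> ((\<lambda>y. f (p, y)) has_field_derivative deriv (\<lambda>y. f (p, y)) s) (at s)"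
  using cdiff2_curve[of f "\<lambda>_. p" s "\<lambda>x. x" 0 1] by simp

section \<open>Estimates with a holomorphic parameter\<close>

lemma eventually_nhds_prodE:
  assumes "\<forall>\<^sub>F x in nhds (a::complex, b::complex). P x"
  obtains r where "r > 0" "\<And>x y. x \<in> cball a r \<Longrightarrow> y \<in> cball b r \<Longrightarrow> P (x, y)"
proof -
  obtain Pf Pg where P: "\<forall>\<^sub>F x in nhds a. Pf x" "\<forall>\<^sub>F x in nhds b. Pg x"
    "\<And>x y. Pf x \<Longrightarrow> Pg y \<Longrightarrow> P (x, y)"
    using assms unfolding nhds_prod eventually_prod_filter by auto
  obtain d1 d2 where "d1 > 0" "d2 > 0" "\<And>x. dist x a < d1 \<Longrightarrow> Pf x"
    "\<And>x. dist x b < d2 \<Longrightarrow> Pg x"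
    using P(1,2) unfolding eventually_nhds_metric by blast
  then show ?thesis
    by (intro that[of "min d1 d2 / 2"]) (auto simp: dist_commute intro!: P(3))
qed

lemma eventually_nhds_slice:
  assumes "\<forall>\<^sub>F x in nhds (a, b). P x"
  shows "\<forall>\<^sub>F x in nhds a. P (x, b)"
proof -
  have "filterlim (\<lambda>x. (x, b)) (nhds (a, b)) (nhds a)"
    by (intro tendsto_intros) (simp add: filterlim_ident)
  with assms show ?thesis by (auto simp: filterlim_iff)
qed

text \<open>Difference quotients in \<open>s\<close> are holomorphic in \<open>p\<close> and
  converge locally uniformly: a bound for \<open>f\<close> on a compact polydisc bounds the second
  \<open>s\<close> derivative by Cauchy, and Taylor's formula then controls the error uniformly in
  \<open>p\<close>.\<close>

lemma holomorphic_partial_deriv: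
  assumes "open S" "\<And>x. x \<in> S \<Longrightarrow> cdiff2 f x"
  shows "(\<lambda>p. deriv (\<lambda>s. f (p, s)) s0) holomorphic_on {p. (p, s0) \<in> S}"
proof -
  have loc: "\<exists>r>0. (\<lambda>p. deriv (\<lambda>s. f (p, s)) s0) holomorphic_on ball p0 r" if "(p0, s0) \<in> S" for p0
  proof -
    have "\<forall>\<^sub>F x in nhds (p0, s0). x \<in> S" using assms(1) that by (rule eventually_nhds_in_open)
    then obtain r where r: "r > 0" "\<And>x y. x \<in> cball p0 r \<Longrightarrow> y \<in> cball s0 r \<Longrightarrow> (x, y) \<in> S"
      by (rule eventually_nhds_prodE) blast
    have sub: "cball p0 r \<times> cball s0 r \<subseteq> S" using r(2) by auto
    have cont: "continuous_on S f"
      using assms by (simp add: cdiff2_isCont continuous_at_imp_continuous_on)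
    have "compact (f ` (cball p0 r \<times> cball s0 r))"
      by (intro compact_continuous_image continuous_on_subset[OF cont] sub compact_Times compact_cball)
    then obtain B where B: "\<And>x y. x \<in> cball p0 r \<Longrightarrow> y \<in> cball s0 r \<Longrightarrow> norm (f (x, y)) \<le> B"
      unfolding compact_eq_bounded_closed bounded_iff by (auto simp del: mem_cball)
    define g where "g = (\<lambda>p. deriv (\<lambda>s. f (p, s)) s0)"
    \<comment> \<open>The offset 2 keeps the norm strictly below \<open>r / 2\<close> for
      \<open>n = 0\<close> as well, so that \<open>s0 + h n\<close> lies in the half disc where the
      second derivative is bounded.\<close>
    define h where "h n = complex_of_real (r / 2 / real (n + 2))" for n
    have h_pos: "h n \<noteq> 0" for n unfolding h_def of_real_eq_0_iff using r(1) by simp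
    have h_le: "norm (h n) < r / 2" for n
      using r(1) unfolding h_def norm_of_real by (simp add: divide_less_eq)
    have h_lim: "(\<lambda>n. norm (h n)) \<longlonglongrightarrow> 0"
    proof -
      have "(\<lambda>n. r / 2 / real (n + 2)) \<longlonglongrightarrow> 0"
        using LIMSEQ_ignore_initial_segment[OF lim_const_over_n[of "r/2"], of 2] by simp
      thus ?thesis using r(1) unfolding h_def norm_of_real by simp
    qed
    define Dq where "Dq n p = (f (p, s0 + h n) - f (p, s0)) / h n" for n p
    have mem: "s0 + h n \<in> cball s0 r" for n using h_le[of n] r(1) by (simp add: dist_norm)
    have holf: "(\<lambda>p. f (p, s)) holomorphic_on ball p0 r" if "s \<in> cball s0 r" for s
    proof -
      have "((\<lambda>p. f (p, s)) has_field_derivative deriv (\<lambda>p. f (p, s)) p) (at p)"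
        if "p \<in> ball p0 r" for p
        using that \<open>s \<in> _\<close> by (intro cdiff2_fst_deriv assms(2) r(2)) auto
      thus ?thesis unfolding holomorphic_on_open[OF open_ball] by blast
    qed
    have hol: "Dq n holomorphic_on ball p0 r" for n
      unfolding Dq_def[abs_def] using mem r(1) h_pos
      by (intro holomorphic_intros holf) auto
    \<comment> \<open>The constant is \<open>fact 2 * B / (r/2)^2\<close>, Cauchy's bound for the
      second derivative on discs of radius \<open>r/2\<close>; one factor \<open>norm (h n)\<close>
      of the Taylor remainder is divided away.\<close>
    have est: "norm (Dq n p - g p) \<le> 8 * B / r\<^sup>2 * norm (h n)" if p: "p \<in> cball p0 r" for n p
    proof -
      define k where "k = (\<lambda>s. f (p, s))"
      have kd: "(k has_field_derivative deriv k s) (at s)" if "s \<in> cball s0 r" for s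
        unfolding k_def using assms(2) r(2) p that by (intro cdiff2_snd_deriv) auto
      have khol: "k holomorphic_on ball s0 r"
          unfolding holomorphic_on_open[OF open_ball] using kd by (meson ball_subset_cball subsetD)
      have kcont: "continuous_on (cball s0 r) k"
        using kd by (intro continuous_at_imp_continuous_on ballI DERIV_isCont)
      have k2: "norm ((deriv ^^ 2) k s) \<le> 8 * B / r\<^sup>2" if s: "s \<in> ball s0 (r/2)" for s
      proof -
        have subs: "cball s (r/2) \<subseteq> cball s0 r" "ball s (r/2) \<subseteq> ball s0 r"
          using s r(1) by (auto simp: cball_subset_cball_iff ball_subset_ball_iff dist_commute)
        have "norm ((deriv ^^ 2) k s) \<le> fact 2 * B / (r/2)^2"
        proof (rule Cauchy_inequality)
          show "k holomorphic_on ball s (r/2)" by (rule holomorphic_on_subset[OF khol subs(2)])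
          show "continuous_on (cball s (r/2)) k" by (rule continuous_on_subset[OF kcont subs(1)])
          show "0 < r / 2" using r(1) by simp
          fix x assume "norm (s - x) = r/2"
          hence "x \<in> cball s0 r" using subs(1) by (auto simp: dist_norm)
          thus "norm (k x) \<le> B" unfolding k_def using B p by simp
        qed
        thus ?thesis by (simp add: power_divide fact_numeral)
      qed
      have "norm ((deriv ^^ 0) k (s0 + h n) - (\<Sum>i\<le>1. (deriv ^^ i) k s0 * (s0 + h n - s0) ^ i / fact i))
          \<le> 8 * B / r\<^sup>2 * norm (s0 + h n - s0) ^ Suc 1 / fact 1"
      proof (rule complex_Taylor[where S = "ball s0 (r/2)" and f = "\<lambda>i. (deriv ^^ i) k"])
        fix i x assume x: "x \<in> ball s0 (r/2)" and i: "i \<le> (1::nat)"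
        have "(deriv ^^ i) k holomorphic_on ball s0 (r/2)"
          by (intro holomorphic_higher_deriv holomorphic_on_subset[OF khol] subset_ball)
            (use r(1) in auto)
        hence "((deriv ^^ i) k has_field_derivative deriv ((deriv ^^ i) k) x) (at x)"
          using x by (meson holomorphic_derivI open_ball)
        thus "((deriv ^^ i) k has_field_derivative (deriv ^^ Suc i) k x) (at x within ball s0 (r/2))"
          by (simp add: has_field_derivative_at_within)
      qed (use k2 h_le r(1) in \<open>auto simp: dist_norm numeral_2_eq_2\<close>)
      hence "norm (k (s0 + h n) - k s0 - deriv k s0 * h n) \<le> 8 * B / r\<^sup>2 * norm (h n) ^ 2"
        by (simp add: numeral_2_eq_2 algebra_simps)
      moreover have "k (s0 + h n) - k s0 - deriv k s0 * h n = (Dq n p - g p) * h n"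
        using h_pos[of n] by (simp add: Dq_def g_def k_def field_simps)
      ultimately have "norm (Dq n p - g p) * norm (h n) \<le> (8 * B / r\<^sup>2 * norm (h n)) * norm (h n)"
        by (simp only: norm_mult power2_eq_square[of "norm (h n)"] mult.assoc)
      moreover have "norm (h n) > 0" using h_pos[of n] by simp
      ultimately show ?thesis by (rule mult_right_le_imp_le)
    qed
    have "g holomorphic_on ball p0 r"
    proof (rule holomorphic_uniform_sequence[OF open_ball hol])
      fix x assume "x \<in> ball p0 r"
      then obtain d where d: "d > 0" "cball x d \<subseteq> ball p0 r"
        using open_contains_cball open_ball by blast
      have "uniform_limit (cball x d) Dq g sequentially"
        unfolding uniform_limit_iff
      proof (intro allI impI)
        fix e :: real assume e: "e > 0"
        have "(\<lambda>n. 8 * B / r\<^sup>2 * norm (h n)) \<longlonglongrightarrow> 8 * B / r\<^sup>2 * 0"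
          by (intro tendsto_intros h_lim)
        hence "\<forall>\<^sub>F n in sequentially. 8 * B / r\<^sup>2 * norm (h n) < e"
          using e by (simp add: order_tendstoD(2))
        thus "\<forall>\<^sub>F n in sequentially. \<forall>y\<in>cball x d. dist (Dq n y) (g y) < e"
        proof eventually_elim
          case (elim n)
          show ?case
          proof
            fix y assume "y \<in> cball x d"
            hence "y \<in> cball p0 r" using d(2) ball_subset_cball by blast
            from est[OF this, of n] elim show "dist (Dq n y) (g y) < e" by (simp add: dist_norm)
          qed
        qed
      qed
      with d show "\<exists>d>0. cball x d \<subseteq> ball p0 r \<and> uniform_limit (cball x d) Dq g sequentially"
        by blast
    qed
    with r(1) show ?thesis unfolding g_def by blast
  qed
  show ?thesis
    unfolding holomorphic_on_def
  proof
    fix p0 assume "p0 \<in> {p. (p, s0) \<in> S}"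
    then obtain r where "r > 0" "(\<lambda>p. deriv (\<lambda>s. f (p, s)) s0) holomorphic_on ball p0 r"
      using loc by auto
    hence "(\<lambda>p. deriv (\<lambda>s. f (p, s)) s0) field_differentiable at p0"
      by (intro holomorphic_on_imp_differentiable_at[of _ "ball p0 r"]) auto
    thus "(\<lambda>p. deriv (\<lambda>s. f (p, s)) s0) field_differentiable at p0 within {p. (p, s0) \<in> S}"
      by (rule field_differentiable_at_within)
  qed
qed

lemma punctured_ball_of_eventually:
  assumes "\<forall>\<^sub>F w in at (0::complex). P w"
  obtains r where "r > 0" "\<And>w. w \<in> ball 0 r - {0} \<Longrightarrow> P w"
  using assms unfolding eventually_at by (auto simp: dist_commute)

text \<open>The constant hidden in \<open>O\<close> may depend on \<open>s\<close>. The hypothesis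
  is used to remove the singularity of \<open>f / g\<close> at \<open>w = 0\<close>; the maximum
  principle then replaces the constant by a bound \<open>B\<close> over the compact set where
  \<open>norm w = r\<close> and \<open>s\<close> runs through a closed disc. This bound is uniform
  in \<open>s\<close> and can be fed into Cauchy's inequality.\<close>

lemma bigo_param_deriv:
  assumes ev: "\<forall>\<^sub>F x in nhds (0, s0). fst x \<noteq> 0 \<longrightarrow> cdiff2 f x"
    and big: "\<forall>\<^sub>F s in nhds s0. (\<lambda>w. f (w, s)) \<in> O[at 0](g)"
    and g: "g holomorphic_on -{0}" "\<And>w. w \<noteq> 0 \<Longrightarrow> g w \<noteq> 0"
  shows "(\<lambda>w. deriv (\<lambda>s. f (w, s)) s0) \<in> O[at 0](g)"
proof -
  have "\<forall>\<^sub>F x in nhds (0::complex, s0). (\<lambda>w. f (w, snd x)) \<in> O[at 0](g)"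
    using big eventually_prod2[of "nhds 0" "\<lambda>s. (\<lambda>w. f (w, s)) \<in> O[at 0](g)" "nhds s0"]
    unfolding nhds_prod case_prod_beta by simp
  with ev have "\<forall>\<^sub>F x in nhds (0, s0). (fst x \<noteq> 0 \<longrightarrow> cdiff2 f x) \<and> (\<lambda>w. f (w, snd x)) \<in> O[at 0](g)"
    by (rule eventually_conj)
  then obtain r where r: "r > 0"
    and r2: "\<And>w s. w \<in> cball 0 r \<Longrightarrow> s \<in> cball s0 r \<Longrightarrow>
        (w \<noteq> 0 \<longrightarrow> cdiff2 f (w, s)) \<and> (\<lambda>w. f (w, s)) \<in> O[at 0](g)"
    by (rule eventually_nhds_prodE) auto
  define S where "S = sphere (0::complex) r \<times> cball s0 r"
  have cpt: "compact ((\<lambda>x. f x / g (fst x)) ` S)"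
  proof (rule compact_continuous_image)
    have "continuous_on S f"
      using r2 r by (intro continuous_at_imp_continuous_on ballI cdiff2_isCont) (auto simp: S_def)
    moreover have "continuous_on S (\<lambda>x. g (fst x))"
      by (rule continuous_on_compose2[OF holomorphic_on_imp_continuous_on[OF g(1)]])
        (use r in \<open>auto simp: S_def intro!: continuous_intros\<close>)
    moreover have "\<forall>x\<in>S. g (fst x) \<noteq> 0" using r by (auto simp: S_def intro!: g(2))
    ultimately show "continuous_on S (\<lambda>x. f x / g (fst x))" by (intro continuous_intros)
    show "compact S" unfolding S_def by (intro compact_Times) auto
  qed
  then obtain B where B: "\<And>w s. norm w = r \<Longrightarrow> s \<in> cball s0 r \<Longrightarrow> norm (f (w, s) / g w) \<le> B"
    unfolding compact_eq_bounded_closed bounded_iff S_def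
    by (auto simp del: mem_cball simp: sphere_def dist_norm)
  have est: "norm (f (w, s)) \<le> B * norm (g w)" if w: "w \<in> ball 0 r" "w \<noteq> 0" and s: "s \<in> cball s0 r" for w s
  proof -
    have fh: "(\<lambda>w. f (w, s)) field_differentiable at w" if "w \<in> cball 0 r - {0}" for w
      using r2[of w s] that s cdiff2_fst_deriv unfolding field_differentiable_def by blast
    have gd: "g field_differentiable at w" if "w \<noteq> 0" for w
      using that g(1) holomorphic_on_imp_differentiable_at[of g "-{0}" w] by auto
    have hd: "(\<lambda>w. f (w, s) / g w) field_differentiable at w" if "w \<in> cball 0 r - {0}" for w
      using fh gd that g(2) by (intro field_differentiable_divide) auto
    have "(\<lambda>w. f (w, s)) \<in> O[at 0](g)" using r2[of 0 s] r s by simp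
    hence "(\<lambda>w. f (w, s) / g w) \<in> O[at 0](\<lambda>w. 1)"
    proof (rule landau_o.bigE)
      fix c assume "c > 0" "\<forall>\<^sub>F x in at 0. norm (f (x, s)) \<le> c * norm (g x)"
      thus ?thesis
        by (intro landau_o.bigI[of c])
          (auto elim!: eventually_mono simp: norm_divide divide_simps mult_ac)
    qed
    moreover have "(\<lambda>w. f (w, s) / g w) holomorphic_on cball 0 r - {0}"
      using hd by (auto simp: holomorphic_on_def intro: field_differentiable_at_within)
    ultimately obtain h where h: "h holomorphic_on cball 0 r"
      "\<And>w. w \<in> cball 0 r - {0} \<Longrightarrow> h w = f (w, s) / g w"
      using holomorphic_on_extend[of "\<lambda>w. f (w, s) / g w" "cball 0 r" 0] r by auto
    have "norm (h w) \<le> B"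
    proof (rule maximum_modulus_frontier[of h "ball 0 r"])
      show "h holomorphic_on interior (ball 0 r)"
        using h(1) by (rule holomorphic_on_subset) (auto simp: interior_open)
      show "continuous_on (closure (ball 0 r)) h"
        using h(1) r by (simp add: holomorphic_on_imp_continuous_on)
      fix x assume "x \<in> frontier (ball (0::complex) r)"
      hence "norm x = r" using r by (simp add: frontier_ball)
      thus "norm (h x) \<le> B" using B[of x s] s h(2)[of x] r by fastforce
    qed (use w in auto)
    hence "norm (h w) * norm (g w) \<le> B * norm (g w)" by (intro mult_right_mono) auto
    moreover have "f (w, s) = h w * g w" using h(2)[of w] w g(2)[of w] by simp
    ultimately show ?thesis by (simp add: norm_mult)
  qed
  have "norm (deriv (\<lambda>s. f (w, s)) s0) \<le> B / r * norm (g w)" if w: "w \<in> ball 0 r" "w \<noteq> 0" for w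
  proof -
    have kd: "((\<lambda>s. f (w, s)) has_field_derivative deriv (\<lambda>s. f (w, s)) s) (at s)"
      if "s \<in> cball s0 r" for s
      using r2[of w s] w that by (intro cdiff2_snd_deriv) auto
    \<comment> \<open>On the whole disc of radius \<open>r\<close> about \<open>s0\<close> the bound
      \<open>B * norm (g w)\<close> is independent of \<open>s\<close>, so Cauchy's inequality
      divides it by \<open>r\<close> and keeps the same \<open>g\<close>.\<close>
    have "norm ((deriv ^^ 1) (\<lambda>s. f (w, s)) s0) \<le> fact 1 * (B * norm (g w)) / r ^ 1"
    proof (rule Cauchy_inequality)
      show "(\<lambda>s. f (w, s)) holomorphic_on ball s0 r"
          unfolding holomorphic_on_open[OF open_ball] using kd by (meson ball_subset_cball subsetD)
      show "continuous_on (cball s0 r) (\<lambda>s. f (w, s))"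
        using kd by (intro continuous_at_imp_continuous_on ballI DERIV_isCont)
      fix x assume "norm (s0 - x) = r"
      thus "norm (f (w, x)) \<le> B * norm (g w)" using w by (intro est) (auto simp: dist_norm)
    qed fact
    thus ?thesis by (simp add: field_simps)
  qed
  hence "\<forall>\<^sub>F w in at 0. norm (deriv (\<lambda>s. f (w, s)) s0) \<le> B / r * norm (g w)"
    using r unfolding eventually_at by (intro exI[of _ r]) auto
  thus ?thesis by (rule bigoI)
qed

text \<open>\<open>f\<close> is \<open>w^k\<close> times a function \<open>h\<close> that extends
  holomorphically over 0, so differentiation costs one power. For \<open>k = 0\<close> the truncated
  exponent gives \<open>O(1)\<close>, which is correct because the derivative of \<open>h\<close> is
  bounded.\<close>

lemma bigo_deriv_power:
  fixes f :: "complex \<Rightarrow> complex"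
  assumes ev: "\<forall>\<^sub>F w in at 0. f field_differentiable at w"
    and big: "f \<in> O[at 0](\<lambda>w. w ^ k)"
  shows "deriv f \<in> O[at 0](\<lambda>w. w ^ (k - 1))"
proof -
  obtain r where r: "r > 0" "\<And>w. w \<in> ball 0 r - {0} \<Longrightarrow> f field_differentiable at w"
    using ev by (rule punctured_ball_of_eventually) blast
  have "(\<lambda>w. f w / w ^ k) holomorphic_on ball 0 r - {0}"
    unfolding holomorphic_on_def
  proof
    fix w :: complex assume w: "w \<in> ball 0 r - {0}"
    have "(\<lambda>w::complex. w ^ k) field_differentiable at w"
      by (intro field_differentiable_power field_differentiable_ident)
    with w have "(\<lambda>w. f w / w ^ k) field_differentiable at w"
      by (intro field_differentiable_divide r(2)) auto
    thus "(\<lambda>w. f w / w ^ k) field_differentiable at w within ball 0 r - {0}"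
      by (rule field_differentiable_at_within)
  qed
  moreover have "(\<lambda>w. f w / w ^ k) \<in> O[at 0](\<lambda>w. 1)"
    using big
  proof (rule landau_o.bigE)
    fix c assume "c > 0" "\<forall>\<^sub>F x in at 0. norm (f x) \<le> c * norm (x ^ k)"
    thus ?thesis
      by (intro landau_o.bigI[of c])
        (auto elim!: eventually_mono simp: norm_divide divide_simps mult_ac)
  qed
  ultimately obtain h where h: "h holomorphic_on ball 0 r"
    "\<And>w. w \<in> ball 0 r - {0} \<Longrightarrow> h w = f w / w ^ k"
    using holomorphic_on_extend[of "\<lambda>w. f w / w ^ k" "ball 0 r" 0] r(1)
    by (auto simp: interior_open)
  have 1: "deriv f w = of_nat k * w ^ (k - 1) * h w + w ^ k * deriv h w"
    if w: "w \<in> ball 0 r - {0}" for w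
  proof -
    have "(h has_field_derivative deriv h w) (at w)"
      using h(1) w by (meson DiffD1 holomorphic_derivI open_ball)
    hence "((\<lambda>w. w ^ k * h w) has_field_derivative
        (of_nat k * w ^ (k - 1) * h w + w ^ k * deriv h w)) (at w)"
      by (auto intro!: derivative_eq_intros)
    hence "(f has_field_derivative (of_nat k * w ^ (k - 1) * h w + w ^ k * deriv h w)) (at w)"
      by (rule has_field_derivative_transform_within_open[of _ _ _ "ball 0 r - {0}"])
        (use w h(2) in \<open>auto simp: open_delete\<close>)
    thus ?thesis by (rule DERIV_imp_deriv)
  qed
  have h1: "h \<in> O[at 0](\<lambda>_. 1)"
    using h(1) r(1) by (intro continuous_imp_bigo_1 continuous_on_interior[of "ball 0 r"])
      (auto simp: interior_open holomorphic_on_imp_continuous_on)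
  have h2: "deriv h \<in> O[at 0](\<lambda>_. 1)"
    using holomorphic_deriv[OF h(1)] r(1)
    by (intro continuous_imp_bigo_1 continuous_on_interior[of "ball 0 r"])
      (auto simp: interior_open holomorphic_on_imp_continuous_on)
  have w1: "(\<lambda>w. w ^ k) \<in> O[at 0](\<lambda>w::complex. w ^ (k - 1))"
  proof (cases k)
    case (Suc j)
    have "(\<lambda>w. w * w ^ j) \<in> O[at 0](\<lambda>w::complex. 1 * w ^ j)"
      by (intro landau_o.big.mult continuous_imp_bigo_1) auto
    thus ?thesis by (simp add: Suc)
  qed simp
  have a: "(\<lambda>w. (of_nat k * w ^ (k - 1)) * h w) \<in> O[at 0](\<lambda>w. w ^ (k - 1) * 1)"
    by (intro landau_o.big.mult h1) simp
  have b: "(\<lambda>w. w ^ k * deriv h w) \<in> O[at 0](\<lambda>w. w ^ (k - 1) * 1)"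
    by (intro landau_o.big.mult h2 w1)
  have "(\<lambda>w. of_nat k * w ^ (k - 1) * h w + w ^ k * deriv h w) \<in> O[at 0](\<lambda>w. w ^ (k - 1))"
    using sum_in_bigo(1)[OF a b] by simp
  moreover have "\<forall>\<^sub>F w in at 0. deriv f w = of_nat k * w ^ (k - 1) * h w + w ^ k * deriv h w"
    unfolding eventually_at using 1 r(1) by (intro exI[of _ r]) auto
  ultimately show ?thesis
    by (subst landau_o.big.in_cong)
qed

section \<open>Removable singularities and analytic continuation\<close>

text \<open>Boundedness at the points of \<open>F\<close> makes the extension entire; the decay at
  infinity both bounds it and fixes its constant value as 0.\<close>

lemma Liouville_removable:
  assumes F: "finite F" and hol: "h holomorphic_on -F"
    and bdd: "\<And>a. a \<in> F \<Longrightarrow> (\<lambda>w. h (a + w)) \<in> O[at 0](\<lambda>_. 1)"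
    and inf: "(\<lambda>w. h (inverse w)) \<in> O[at 0](\<lambda>w. w)"
    and p: "p \<notin> F"
  shows "h p = 0"
proof -
  have "\<exists>g. g holomorphic_on UNIV \<and> (\<forall>z\<in>UNIV - F. g z = h z)"
  proof (rule removable_singularities)
    show "h holomorphic_on UNIV - F" using hol by (simp add: Compl_eq_Diff_UNIV)
    fix a assume "a \<in> F"
    from bdd[OF this] show "h \<in> O[at a](\<lambda>_. 1)"
      by (simp add: at_to_0[of a] landau_o.big.in_filtermap_iff add.commute)
  qed (use F in auto)
  then obtain g where g: "g holomorphic_on UNIV" "\<And>z. z \<notin> F \<Longrightarrow> g z = h z" by auto
  have "((\<lambda>w. h (inverse w)) \<longlongrightarrow> 0) (at 0)"
  proof (rule landau_o.bigE[OF inf])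
    fix c assume "\<forall>\<^sub>F w in at 0. norm (h (inverse w)) \<le> c * norm w"
    moreover have "((\<lambda>w::complex. c * norm w) \<longlongrightarrow> 0) (at 0)"
      by (rule tendsto_eq_intros refl | simp)+
    ultimately show ?thesis by (rule Lim_null_comparison)
  qed
  hence "(h \<longlongrightarrow> 0) at_infinity" by (simp add: lim_at_infinity_0 o_def)
  moreover have "\<forall>\<^sub>F z in at_infinity. h z = g z"
  proof -
    obtain b where "\<And>z. z \<in> F \<Longrightarrow> norm z \<le> b"
      using finite_imp_bounded[OF F] unfolding bounded_iff by blast
    hence "z \<notin> F" if "b + 1 \<le> norm z" for z using that by fastforce
    thus ?thesis unfolding eventually_at_infinity using g(2) by (intro exI[of _ "b + 1"]) auto
  qed
  ultimately have "(g \<longlongrightarrow> 0) at_infinity" by (simp add: tendsto_cong)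
  from Liouville_weak_0[OF g(1) this, of p] g(2)[OF p] show ?thesis by simp
qed

text \<open>The complement of a finite set is connected. The centre \<open>a\<close> may itself lie
  in \<open>F\<close>: a neighbourhood of it without \<open>a\<close> and \<open>F\<close> is still
  open and nonempty.\<close>

lemma identity_off_finite:
  assumes "finite F" "f holomorphic_on -F" "g holomorphic_on -F"
    and "\<forall>\<^sub>F p in at a. f p = g p" and "p \<notin> F"
  shows "f p = g p"
proof -
  have op: "open (-F)" using assms(1) by (simp add: finite_imp_closed open_Compl)
  have con: "connected (-F)"
    using connected_open_diff_countable[of UNIV F] assms(1)
    by (simp add: Compl_eq_Diff_UNIV countable_finite connected_UNIV)
  obtain S where S: "open S" "a \<in> S" "\<And>p. p \<in> S - {a} \<Longrightarrow> f p = g p"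
    using assms(4) unfolding eventually_at_topological by auto
  have "\<not> finite S" using S(1,2) finite_imp_not_open by blast
  hence ne: "S - insert a F \<noteq> {}" using assms(1) by (metis Diff_eq_empty_iff finite_insert finite_subset)
  show ?thesis
  proof (rule analytic_continuation_open[of "S - insert a F" "-F" f g])
    show "open (S - insert a F)" using S(1) assms(1) by (simp add: finite_imp_closed open_Diff)
  qed (use ne con op assms S(3) in auto)
qed

text \<open>Connectedness of \<open>{0..1}\<close>: agreement with the single-valued
  \<open>W\<close> passes between any two parameters close to a given \<open>u\<close>. The path may
  run through points of \<open>F\<close>, where \<open>W\<close> need not be holomorphic, so
  agreement is always stated on punctured neighbourhoods.\<close>

lemma continuation_along_path:
  assumes \<gamma>: "path \<gamma>" and F: "finite F" "W holomorphic_on -F"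
    and hol: "\<And>u. u \<in> {0..1} \<Longrightarrow> \<exists>r>0. \<Theta> u holomorphic_on ball (\<gamma> u) r"
    and cont: "\<And>u. u \<in> {0..1} \<Longrightarrow>
        \<forall>\<^sub>F u' in at u within {0..1}. \<forall>\<^sub>F p in nhds (\<gamma> u'). \<Theta> u' p = \<Theta> u p"
    and start: "\<forall>\<^sub>F p in at (\<gamma> 0). \<Theta> 0 p = W p"
  shows "\<forall>\<^sub>F p in at (\<gamma> 1). \<Theta> 1 p = W p"
proof (rule connected_induction_simple[where S = "{0..1::real}" and a = 0 and b = 1
      and P = "\<lambda>u. \<forall>\<^sub>F p in at (\<gamma> u). \<Theta> u p = W p"])
  fix u :: real assume u: "u \<in> {0..1}"
  obtain r where r: "r > 0" "\<Theta> u holomorphic_on ball (\<gamma> u) r" using hol[OF u] by blast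
  \<comment> \<open>Only the centre \<open>\<gamma> u\<close> is allowed to lie in \<open>F\<close>,
    so both functions are holomorphic on the small disc \<open>b\<close> without its centre, which
    is a connected set.\<close>
  have "open (- (F - {\<gamma> u}))" by (intro open_Compl finite_imp_closed finite_Diff F(1))
  then obtain r' where r': "r' > 0" "ball (\<gamma> u) r' \<subseteq> - (F - {\<gamma> u})"
    using open_contains_ball by (metis ComplI DiffD2 singletonI)
  define b where "b = ball (\<gamma> u) (min r r')"
  have b: "\<Theta> u holomorphic_on b - {\<gamma> u}" "W holomorphic_on b - {\<gamma> u}"
    unfolding b_def using r r' by (auto intro!: holomorphic_on_subset[OF r(2)] holomorphic_on_subset[OF F(2)])
  have "continuous_on {0..1} \<gamma>" using \<gamma> by (simp add: path_def)
  hence "\<forall>\<^sub>F u' in at u within {0..1}. \<gamma> u' \<in> b"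
    using u r(1) r'(1) unfolding continuous_on_def b_def
    by (intro topological_tendstoD[of _ "\<gamma> u"]) auto
  with cont[OF u] have "\<forall>\<^sub>F u' in at u within {0..1}.
      \<gamma> u' \<in> b \<and> (\<forall>\<^sub>F p in nhds (\<gamma> u'). \<Theta> u' p = \<Theta> u p)"
    by eventually_elim auto
  then obtain V where V: "open V" "u \<in> V"
    "\<And>u'. u' \<in> V \<Longrightarrow> u' \<noteq> u \<Longrightarrow> u' \<in> {0..1} \<Longrightarrow>
        \<gamma> u' \<in> b \<and> (\<forall>\<^sub>F p in nhds (\<gamma> u'). \<Theta> u' p = \<Theta> u p)"
    unfolding eventually_at_topological by blast
  have Vb: "\<gamma> u' \<in> b" "\<forall>\<^sub>F p in at (\<gamma> u'). \<Theta> u' p = \<Theta> u p" if "u' \<in> V" "u' \<in> {0..1}" for u'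
  proof -
    have "\<gamma> u' \<in> b \<and> (\<forall>\<^sub>F p in nhds (\<gamma> u'). \<Theta> u' p = \<Theta> u p)"
      using V(3)[of u'] that r(1) r'(1) by (cases "u' = u") (auto simp: b_def)
    thus "\<gamma> u' \<in> b" "\<forall>\<^sub>F p in at (\<gamma> u'). \<Theta> u' p = \<Theta> u p"
      by (auto simp: eventually_at_filter elim: eventually_mono)
  qed
  have "\<forall>\<^sub>F p in at (\<gamma> y). \<Theta> y p = W p"
    if x: "x \<in> V" "x \<in> {0..1}" and y: "y \<in> V" "y \<in> {0..1}" and Px: "\<forall>\<^sub>F p in at (\<gamma> x). \<Theta> x p = W p" for x y
  proof -
    have ob: "open b" and cb: "connected (b - {\<gamma> u})"
      unfolding b_def by (auto intro!: connected_open_diff_countable)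
    have "\<forall>\<^sub>F p in at (\<gamma> x). \<Theta> u p = W p" using Vb(2)[OF x] Px by eventually_elim auto
    then obtain S where S: "open S" "\<gamma> x \<in> S" "\<And>p. p \<in> S - {\<gamma> x} \<Longrightarrow> \<Theta> u p = W p"
      unfolding eventually_at_topological by auto
    have "open (S \<inter> b)" "\<gamma> x \<in> S \<inter> b" using S ob Vb(1)[OF x] by auto
    hence "\<not> finite (S \<inter> b)" using finite_imp_not_open by blast
    \<comment> \<open>\<open>\<gamma> x\<close> is removed because agreement is known only off it,
      \<open>\<gamma> u\<close> because \<open>W\<close> may be singular there.\<close>
    hence ne: "S \<inter> b - {\<gamma> x, \<gamma> u} \<noteq> {}" by (metis Diff_eq_empty_iff finite.emptyI finite_insert finite_subset)
    have eq: "\<Theta> u p = W p" if "p \<in> b - {\<gamma> u}" for p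
      by (rule analytic_continuation_open[of "S \<inter> b - {\<gamma> x, \<gamma> u}" "b - {\<gamma> u}" "\<Theta> u" W])
        (use S ob ne cb b that in \<open>auto simp: open_Diff open_Int\<close>)
    have "\<forall>\<^sub>F p in at (\<gamma> y). p \<in> b - {\<gamma> u}"
    proof -
      have "\<forall>\<^sub>F p in at (\<gamma> y). p \<in> b"
        using eventually_nhds_in_open[OF ob Vb(1)[OF y]]
        by (simp add: eventually_at_filter eventually_mono)
      moreover have "\<forall>\<^sub>F p in at (\<gamma> y). p \<noteq> \<gamma> u" by (rule eventually_neq_at_within)
      ultimately show ?thesis by eventually_elim auto
    qed
    with Vb(2)[OF y] show ?thesis by eventually_elim (use eq in auto)
  qed
  hence "\<forall>x\<in>{0..1} \<inter> V. \<forall>y\<in>{0..1} \<inter> V.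
      (\<forall>\<^sub>F p in at (\<gamma> x). \<Theta> x p = W p) \<longrightarrow> (\<forall>\<^sub>F p in at (\<gamma> y). \<Theta> y p = W p)" by blast
  moreover have "openin (top_of_set {0..1}) ({0..1} \<inter> V)" using V(1) by (rule openin_open_Int)
  moreover have "u \<in> {0..1} \<inter> V" using V(2) u by blast
  ultimately show "\<exists>T. openin (top_of_set {0..1}) T \<and> u \<in> T \<and>
      (\<forall>x\<in>T. \<forall>y\<in>T. (\<forall>\<^sub>F p in at (\<gamma> x). \<Theta> x p = W p) \<longrightarrow> (\<forall>\<^sub>F p in at (\<gamma> y). \<Theta> y p = W p))"
    by blast
next
  show "\<forall>\<^sub>F p in at (\<gamma> 0). \<Theta> 0 p = W p" by (rule start)
qed simp_all

section \<open>Expansions at the punctures\<close>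

lemma hol_t_const [simp]: "hol_t M T (\<lambda>_. c)"
  by (simp add: hol_t_def)

lemma hol_t_add: "hol_t M T f \<Longrightarrow> hol_t M T g \<Longrightarrow> hol_t M T (\<lambda>t. f t + g t)"
  by (simp add: hol_t_def holomorphic_on_add)

lemma hol_t_mult: "hol_t M T f \<Longrightarrow> hol_t M T g \<Longrightarrow> hol_t M T (\<lambda>t. f t * g t)"
  by (simp add: hol_t_def holomorphic_on_mult)

lemma hol_t_sum: "(\<And>k. k \<in> I \<Longrightarrow> hol_t M T (f k)) \<Longrightarrow> hol_t M T (\<lambda>t. \<Sum>k\<in>I. f k t)"
  by (induction I rule: infinite_finite_induct) (auto intro: hol_t_add)

text \<open>Each coefficient of a power is a polynomial in finitely many coefficients of the series,
  so no convergence is involved. Here \<open>punctures\<close> is merely a variable for a family of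
  power series.\<close>

lemma hol_t_fps_power:
  assumes "\<And>k. hol_t M T (\<lambda>t. fps_nth (punctures t) k)"
  shows "hol_t M T (\<lambda>t. fps_nth (punctures t ^ n) k)"
proof (induction n arbitrary: k)
  case 0
  show ?case by simp
next
  case (Suc n)
  have "hol_t M T (\<lambda>t. \<Sum>i=0..k. fps_nth (punctures t) i * fps_nth (punctures t ^ n) (k - i))"
    by (intro hol_t_sum hol_t_mult assms Suc)
  thus ?case by (simp add: fps_mult_nth)
qed

text \<open>\<open>slice\<close> forgets the \<open>a\<close> entry of its base point, so what is
  assumed at \<open>t(a := s)\<close> speaks about the slice through \<open>t\<close>.\<close>

lemma hol_pt_cdiff2:
  assumes "open_pt M D" "hol_pt M D f" "(p, t(a := s)) \<in> D" "a \<in> tidx M"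
  shows "cdiff2 (\<lambda>x. f (fst x) (t(a := snd x))) (p, s)"
proof -
  have eq: "slice D (t(a := s)) a = slice D t a" by (simp add: slice_def)
  have "open (slice D t a)"
    using assms(1,3,4) unfolding open_pt_def eq[symmetric] by fastforce
  moreover have "hol2_on (\<lambda>(p', s'). f p' (t(a := s'))) (slice D t a)"
    using assms(2-4) unfolding hol_pt_def eq[symmetric] by fastforce
  moreover have "(p, s) \<in> slice D t a" using assms(3) by (simp add: slice_def)
  ultimately have "cdiff2 (\<lambda>(p', s'). f p' (t(a := s'))) (p, s)" by (simp add: hol2_on_open)
  thus ?thesis by (simp add: case_prod_unfold)
qed

text \<open>The series is \<open>w^(-n) * G(w)\<close>, and its principal part is a polynomial in
  \<open>x = 1/w\<close>. The constant term \<open>k = n\<close> is left out, which is why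
  \<open>proj_inf\<close> adds it separately.\<close>

lemma poly_fls_prpart_shift:
  "poly (fls_prpart (fls_shift (int n) (fps_to_fls G))) x = (\<Sum>k<n. fps_nth G k * x ^ (n - k))"
  for x :: complex
proof -
  let ?p = "fls_prpart (fls_shift (int n) (fps_to_fls G))"
  have c: "coeff ?p i = (if 0 < i \<and> i \<le> n then fps_nth G (n - i) else 0)" for i
    by (auto simp: nat_diff_distrib)
  have "degree ?p \<le> n" by (rule degree_le) (simp add: c)
  hence "poly ?p x = (\<Sum>i\<le>n. coeff ?p i * x ^ i)"
    unfolding poly_altdef[of ?p] by (intro sum.mono_neutral_left) (auto simp: coeff_eq_0 simp del: fls_prpart_coeff)
  also have "\<dots> = (\<Sum>i\<in>{1..n}. fps_nth G (n - i) * x ^ i)"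
    by (intro sum.mono_neutral_cong_right) (auto simp: c simp del: fls_prpart_coeff)
  also have "\<dots> = (\<Sum>k<n. fps_nth G k * x ^ (n - k))"
    by (rule sum.reindex_bij_witness[of _ "\<lambda>k. n - k" "\<lambda>i. n - i"]) auto
  finally show ?thesis .
qed

text \<open>Only the data at the punctures are collected here. The string equations, the
  single-valued coefficients and the branches of the logarithm enter as explicit assumptions of
  later lemmas or in the theorem.\<close>

locale whitham =
  fixes M :: nat and T :: "times set" and \<rho> :: "nat \<Rightarrow> times \<Rightarrow> real"
    and z m :: "nat \<Rightarrow> pt_fun"
    and q d :: "nat \<Rightarrow> times \<Rightarrow> complex" and dd v :: "nat \<Rightarrow> nat \<Rightarrow> times \<Rightarrow> complex"
  assumes T_open: "open_t M T"
    and rho_pos: "\<And>\<alpha> t. \<alpha> \<le> M \<Longrightarrow> t \<in> T \<Longrightarrow> \<rho> \<alpha> t > 0"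
    and q_distinct: "\<And>t. t \<in> T \<Longrightarrow> inj_on (\<lambda>i. q i t) {1..M}"
    and d_nonzero: "\<And>i t. i \<in> {1..M} \<Longrightarrow> t \<in> T \<Longrightarrow> d i t \<noteq> 0"
    and qd_hol: "\<And>i. i \<in> {1..M} \<Longrightarrow> hol_t M T (q i) \<and> hol_t M T (d i)"
    and coeff_hol: "\<And>\<alpha> n. \<alpha> \<le> M \<Longrightarrow> hol_t M T (dd \<alpha> n) \<and> hol_t M T (v \<alpha> n)"
    and zm_hol: "\<And>\<alpha>. \<alpha> \<le> M \<Longrightarrow> open_pt M (over T (pnbhd q \<rho> \<alpha>)) \<and>
      hol_pt M (over T (pnbhd q \<rho> \<alpha>)) (z \<alpha>) \<and> hol_pt M (over T (pnbhd q \<rho> \<alpha>)) (m \<alpha>)"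
    and z0_expansion: "\<And>t p. t \<in> T \<Longrightarrow> p \<in> pnbhd q \<rho> 0 t \<Longrightarrow>
      (\<lambda>n. dd 0 (Suc n) t / p ^ Suc n) sums (z 0 p t - p)"
    and zi_expansion: "\<And>i t p. i \<in> {1..M} \<Longrightarrow> t \<in> T \<Longrightarrow> p \<in> pnbhd q \<rho> i t \<Longrightarrow>
      (\<lambda>n. dd i n t * (p - q i t) ^ n) sums (z i p t - d i t / (p - q i t))"
    and z_nonzero: "\<And>\<alpha> t p. \<alpha> \<le> M \<Longrightarrow> t \<in> T \<Longrightarrow> p \<in> pnbhd q \<rho> \<alpha> t \<Longrightarrow> z \<alpha> p t \<noteq> 0"
    and m_summable: "\<And>\<alpha> t p. \<alpha> \<le> M \<Longrightarrow> t \<in> T \<Longrightarrow> p \<in> pnbhd q \<rho> \<alpha> t \<Longrightarrow>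
      summable (\<lambda>n. of_nat (Suc n) * t (\<alpha>, Suc n) * z \<alpha> p t ^ n) \<and>
      summable (\<lambda>n. v \<alpha> (n + 2) t / z \<alpha> p t ^ (n + 2))"
    and m_expansion: "\<And>\<alpha> t p. \<alpha> \<le> M \<Longrightarrow> t \<in> T \<Longrightarrow> p \<in> pnbhd q \<rho> \<alpha> t \<Longrightarrow>
      m \<alpha> p t = (\<Sum>n. of_nat (Suc n) * t (\<alpha>, Suc n) * z \<alpha> p t ^ n)
        + tzero M \<alpha> t / z \<alpha> p t + (\<Sum>n. v \<alpha> (n + 2) t / z \<alpha> p t ^ (n + 2))"
begin

abbreviation U :: "nat \<Rightarrow> times \<Rightarrow> complex set" where "U \<equiv> pnbhd q \<rho>"

text \<open>The expansion of \<open>z\<^sub>\<alpha>\<close> reads \<open>w z\<^sub>\<alpha> = \<Sum>\<^sub>k zcoeff \<alpha> k t w\<^sup>k\<close> at every puncture, the point at infinity included.\<close>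

definition zcoeff :: "nat \<Rightarrow> nat \<Rightarrow> times \<Rightarrow> complex" where
  "zcoeff \<alpha> k t = (if \<alpha> = 0 then (if k = 0 then 1 else if k = 1 then 0 else dd 0 (k - 1) t)
     else if k = 0 then d \<alpha> t else dd \<alpha> (k - 1) t)"

definition loc :: "nat \<Rightarrow> complex \<Rightarrow> times \<Rightarrow> complex" where
  "loc \<alpha> w t = (if \<alpha> = 0 then inverse w else q \<alpha> t + w)"

definition loc_radius :: "nat \<Rightarrow> times \<Rightarrow> real" where
  "loc_radius \<alpha> t = (if \<alpha> = 0 then inverse (\<rho> 0 t) else \<rho> \<alpha> t)"

definition zfps :: "nat \<Rightarrow> times \<Rightarrow> complex fps" where
  "zfps \<alpha> t = Abs_fps (\<lambda>k. zcoeff \<alpha> k t)"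

definition zpow_coeff :: "nat \<Rightarrow> nat \<Rightarrow> nat \<Rightarrow> times \<Rightarrow> complex" where
  "zpow_coeff \<alpha> n k t = fps_nth (zfps \<alpha> t ^ n) k"

text \<open>\<open>Omega\<close> is a Laurent projection taken at each fixed time; this closed form
  makes its dependence on the times visible. The sum includes \<open>k = n\<close> at infinity
  because the projector there keeps the constant term.\<close>

definition Omega_expl :: "nat \<Rightarrow> nat \<Rightarrow> pt_fun" where
  "Omega_expl \<alpha> n p t = (if \<alpha> = 0 then \<Sum>k\<le>n. zpow_coeff 0 n k t * p ^ (n - k)
     else \<Sum>k<n. zpow_coeff \<alpha> n k t * inverse (p - q \<alpha> t) ^ (n - k))"

lemma eventually_T: "t \<in> T \<Longrightarrow> a \<in> tidx M \<Longrightarrow> \<forall>\<^sub>F s in nhds (t a). t(a := s) \<in> T"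
  using eventually_nhds_in_open[of "{s. t(a := s) \<in> T}" "t a"] T_open
  by (simp add: open_t_def)

lemma hol_t_differentiable:
  assumes "hol_t M T f" "t \<in> T" "a \<in> tidx M" "t(a := s) \<in> T"
  shows "(\<lambda>s. f (t(a := s))) field_differentiable at s"
  using assms T_open unfolding hol_t_def open_t_def
  by (intro holomorphic_on_imp_differentiable_at[of _ "{s. t(a := s) \<in> T}"]) auto

lemma hol_t_deriv:
  assumes "hol_t M T f" "t \<in> T" "a \<in> tidx M"
  shows "((\<lambda>s. f (t(a := s))) has_field_derivative deriv (\<lambda>s. f (t(a := s))) (t a)) (at (t a))"
  using hol_t_differentiable[OF assms, of "t a"] assms(2) by (simp add: field_differentiable_derivI)

lemma q_hol: "0 < i \<Longrightarrow> i \<le> M \<Longrightarrow> hol_t M T (q i)"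
  using qd_hol[of i] by simp

lemma zcoeff_hol: "\<alpha> \<le> M \<Longrightarrow> hol_t M T (zcoeff \<alpha> k)"
  using qd_hol[of \<alpha>] coeff_hol[of \<alpha>] unfolding zcoeff_def[abs_def]
  by (cases "\<alpha> = 0"; cases "k = 0"; cases "k = 1") simp_all

lemma zpow_coeff_hol: "\<alpha> \<le> M \<Longrightarrow> hol_t M T (zpow_coeff \<alpha> n k)"
  unfolding zpow_coeff_def[abs_def] by (rule hol_t_fps_power) (simp add: zfps_def zcoeff_hol)

lemma zcoeff_0_nonzero: "\<alpha> \<le> M \<Longrightarrow> t \<in> T \<Longrightarrow> zcoeff \<alpha> 0 t \<noteq> 0"
  using d_nonzero by (auto simp: zcoeff_def)

lemma loc_radius_pos: "\<alpha> \<le> M \<Longrightarrow> t \<in> T \<Longrightarrow> loc_radius \<alpha> t > 0"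
  using rho_pos by (auto simp: loc_radius_def)

lemma loc_mem:
  assumes "\<alpha> \<le> M" "t \<in> T" "w \<noteq> 0" "norm w < loc_radius \<alpha> t"
  shows "loc \<alpha> w t \<in> U \<alpha> t"
proof (cases "\<alpha> = 0")
  case True
  have "norm w < inverse (\<rho> 0 t)" using assms True by (simp add: loc_radius_def)
  hence "\<rho> 0 t < inverse (norm w)"
    using assms(3) rho_pos[of 0 t] assms(2) by (simp add: field_simps)
  thus ?thesis using True by (simp add: loc_def pnbhd_def norm_inverse)
qed (use assms in \<open>auto simp: loc_def pnbhd_def loc_radius_def dist_norm\<close>)

lemma wz_sums:
  assumes "\<alpha> \<le> M" "t \<in> T" "w \<noteq> 0" "norm w < loc_radius \<alpha> t"
  shows "(\<lambda>k. zcoeff \<alpha> k t * w ^ k) sums (w * z \<alpha> (loc \<alpha> w t) t)"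
proof (cases "\<alpha> = 0")
  case True
  have "(\<lambda>n. dd 0 (Suc n) t / inverse w ^ Suc n) sums (z 0 (inverse w) t - inverse w)"
    using z0_expansion[OF assms(2), of "inverse w"] loc_mem[OF assms] True by (simp add: loc_def)
  hence "(\<lambda>n. w * (dd 0 (Suc n) t / inverse w ^ Suc n)) sums (w * (z 0 (inverse w) t - inverse w))"
    by (rule sums_mult)
  \<comment> \<open>The expansion of \<open>z 0\<close> has no constant term: the coefficients of
    index 0 and 1 are 1 and 0, and the given series starts at index 2.\<close>
  hence "(\<lambda>n. zcoeff 0 (Suc (Suc n)) t * w ^ Suc (Suc n)) sums (w * z 0 (inverse w) t - 1)"
    using assms(3) by (simp add: zcoeff_def power_inverse right_diff_distrib divide_inverse inverse_mult_distrib mult_ac)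
  hence "(\<lambda>n. zcoeff 0 (n + 2) t * w ^ (n + 2)) sums (w * z 0 (inverse w) t - 1)" by simp
  hence "(\<lambda>n. zcoeff 0 n t * w ^ n) sums (w * z 0 (inverse w) t - 1 + (\<Sum>i<2. zcoeff 0 i t * w ^ i))"
    using sums_iff_shift'[of "\<lambda>n. zcoeff 0 n t * w ^ n" 2] sums_iff_shift[of "\<lambda>n. zcoeff 0 n t * w ^ n" 2] by simp
  thus ?thesis using True by (simp add: zcoeff_def loc_def numeral_2_eq_2)
next
  case False
  have "(\<lambda>n. dd \<alpha> n t * w ^ n) sums (z \<alpha> (q \<alpha> t + w) t - d \<alpha> t / w)"
    using zi_expansion[of \<alpha> t "q \<alpha> t + w"] loc_mem[OF assms] False assms by (simp add: loc_def)
  hence "(\<lambda>n. w * (dd \<alpha> n t * w ^ n)) sums (w * (z \<alpha> (q \<alpha> t + w) t - d \<alpha> t / w))"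
    by (rule sums_mult)
  hence "(\<lambda>n. zcoeff \<alpha> (Suc n) t * w ^ Suc n) sums (w * z \<alpha> (q \<alpha> t + w) t - zcoeff \<alpha> 0 t * w ^ 0)"
    using False assms(3) by (simp add: zcoeff_def right_diff_distrib mult_ac)
  hence "(\<lambda>n. zcoeff \<alpha> n t * w ^ n) sums
      (w * z \<alpha> (q \<alpha> t + w) t - zcoeff \<alpha> 0 t * w ^ 0 + zcoeff \<alpha> 0 t * w ^ 0)"
    using sums_Suc_iff[of "\<lambda>n. zcoeff \<alpha> n t * w ^ n"] by blast
  thus ?thesis using False by (simp add: loc_def)
qed

text \<open>Summability at the positive real points of the disc already bounds the radius of
  convergence from below.\<close>

lemma zfps_radius:
  assumes "\<alpha> \<le> M" "t \<in> T"
  shows "fps_conv_radius (zfps \<alpha> t) \<ge> loc_radius \<alpha> t"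
  unfolding fps_conv_radius_def
proof (rule conv_radius_geI_ex')
  fix r :: real assume "0 < r" "ereal r < ereal (loc_radius \<alpha> t)"
  thus "summable (\<lambda>n. fps_nth (zfps \<alpha> t) n * complex_of_real r ^ n)"
    using wz_sums[OF assms, of "of_real r"] by (simp add: zfps_def sums_iff)
qed

lemma zfps_radius_gt:
  assumes "\<alpha> \<le> M" "t \<in> T" "norm w < loc_radius \<alpha> t"
  shows "ereal (norm w) < fps_conv_radius (zfps \<alpha> t)"
    "ereal (norm w) < fps_conv_radius (zfps \<alpha> t ^ n)"
  using zfps_radius[OF assms(1,2)] fps_conv_radius_power[of "zfps \<alpha> t" n] assms(3)
  by (meson ereal_less(2) less_ereal.simps(1) less_le_trans order_trans)+

lemma eval_zfps:
  assumes "\<alpha> \<le> M" "t \<in> T" "w \<noteq> 0" "norm w < loc_radius \<alpha> t"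
  shows "eval_fps (zfps \<alpha> t ^ n) w = (w * z \<alpha> (loc \<alpha> w t) t) ^ n"
proof -
  have "eval_fps (zfps \<alpha> t) w = w * z \<alpha> (loc \<alpha> w t) t"
    using sums_unique2[OF sums_eval_fps[OF zfps_radius_gt(1)[OF assms(1,2,4)]]] wz_sums[OF assms]
    by (simp add: zfps_def)
  thus ?thesis using eval_fps_power[OF zfps_radius_gt(1)[OF assms(1,2,4)]] by simp
qed

lemma eventually_loc_radius: "\<alpha> \<le> M \<Longrightarrow> t \<in> T \<Longrightarrow> \<forall>\<^sub>F w in at (0::complex). w \<noteq> 0 \<and> norm w < loc_radius \<alpha> t"
  unfolding eventually_at using loc_radius_pos[of \<alpha> t] by (intro exI[of _ "loc_radius \<alpha> t"]) auto

text \<open>The power is \<open>w^(-n)\<close> times the power series of \<open>(w * z)^n\<close>,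
  whose coefficients are polynomials in those of \<open>z\<close> and hence holomorphic in the
  times.\<close>

lemma z_power_laurent:
  assumes "\<alpha> \<le> M" "t \<in> T"
  shows "(\<lambda>w. z \<alpha> (loc \<alpha> w t) t ^ n) has_laurent_expansion
    fls_shift (int n) (fps_to_fls (zfps \<alpha> t ^ n))"
proof -
  have "0 < fps_conv_radius (zfps \<alpha> t ^ n)"
    using zfps_radius_gt(2)[OF assms, of 0 n] loc_radius_pos[OF assms] by (simp add: zero_ereal_def)
  hence "eval_fps (zfps \<alpha> t ^ n) has_laurent_expansion fps_to_fls (zfps \<alpha> t ^ n)"
    by (intro has_laurent_expansion_fps eval_fps_has_fps_expansion)
  hence "(\<lambda>w. eval_fps (zfps \<alpha> t ^ n) w * w powi (- int n)) has_laurent_expansion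
      fls_shift (int n) (fps_to_fls (zfps \<alpha> t ^ n))"
    by (rule has_laurent_expansion_shift')
  moreover have "\<forall>\<^sub>F w in at 0. eval_fps (zfps \<alpha> t ^ n) w * w powi (- int n) = z \<alpha> (loc \<alpha> w t) t ^ n"
    using eventually_loc_radius[OF assms]
    by eventually_elim
      (use eval_zfps[OF assms] in \<open>auto simp: power_int_minus power_mult_distrib\<close>)
  ultimately show ?thesis by (subst (asm) has_laurent_expansion_cong[OF _ refl])
qed

text \<open>Uniqueness of Laurent expansions at each fixed time. As it holds at every time in
  \<open>T\<close>, the explicit sum may be differentiated in place of the projection.\<close>

lemma Omega_eq_expl:
  assumes "\<alpha> \<le> M" "t \<in> T" "n \<ge> 1"
  shows "Omega q L z (\<alpha>, n) p t = Omega_expl \<alpha> n p t"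
proof (cases "\<alpha> = 0")
  case True
  let ?G = "zfps 0 t ^ n"
  have "laurent_expansion (\<lambda>w. z 0 (inverse w) t ^ n) 0 = fls_shift (int n) (fps_to_fls ?G)"
    using z_power_laurent[OF assms(1,2), of n] True
    by (intro laurent_expansion_eqI) (simp add: loc_def)
  hence "Omega q L z (\<alpha>, n) p t = (\<Sum>k<n. fps_nth ?G k * p ^ (n - k)) + fps_nth ?G n"
    using True assms(3) by (simp add: Omega_def proj_inf_def poly_fls_prpart_shift Let_def)
  thus ?thesis using True by (simp add: Omega_expl_def zpow_coeff_def lessThan_Suc_atMost[symmetric])
next
  case False
  have "laurent_expansion (\<lambda>p. z \<alpha> p t ^ n) (q \<alpha> t) = fls_shift (int n) (fps_to_fls (zfps \<alpha> t ^ n))"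
    using z_power_laurent[OF assms(1,2), of n] False
    by (intro laurent_expansion_eqI) (simp add: loc_def)
  thus ?thesis using False assms(3)
    by (simp add: Omega_def proj_at_def poly_fls_prpart_shift Omega_expl_def zpow_coeff_def)
qed

text \<open>Agreement up to \<open>O(w)\<close> at infinity and up to \<open>O(1)\<close> at the finite punctures is what Liouville's
  theorem needs.\<close>

definition contact_order :: "nat \<Rightarrow> nat" where "contact_order \<alpha> = (if \<alpha> = 0 then 1 else 0)"

text \<open>The remainder is \<open>w^n\<close> times the shifted series, which is continuous at
  0.\<close>

lemma fps_remainder_bigo:
  fixes F :: "complex fps"
  assumes "fps_conv_radius F > 0"
  shows "(\<lambda>w. eval_fps F w - (\<Sum>k<n. fps_nth F k * w ^ k)) \<in> O[at 0](\<lambda>w. w ^ n)"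
proof -
  have r: "fps_conv_radius (fps_shift n F) > 0" using assms by simp
  have "isCont (eval_fps (fps_shift n F)) 0"
    using r by (intro continuous_eval_fps) (simp add: zero_ereal_def)
  hence "eval_fps (fps_shift n F) \<in> O[at 0](\<lambda>_. 1)" by (rule continuous_imp_bigo_1)
  hence "(\<lambda>w. w ^ n * eval_fps (fps_shift n F) w) \<in> O[at 0](\<lambda>w. w ^ n * 1)"
    by (intro landau_o.big.mult) auto
  moreover have "\<forall>\<^sub>F w in at 0. w ^ n * eval_fps (fps_shift n F) w
      = eval_fps F w - (\<Sum>k<n. fps_nth F k * w ^ k)"
  proof -
    have "\<forall>\<^sub>F w in at 0. w \<in> eball 0 (fps_conv_radius F) - {0}"
      using assms by (intro eventually_at_in_open) (auto simp: zero_ereal_def)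
    thus ?thesis
    proof eventually_elim
      case (elim w)
      hence "ereal (norm w) < fps_conv_radius F" by simp
      hence 1: "(\<lambda>k. fps_nth F k * w ^ k) sums eval_fps F w" by (rule sums_eval_fps)
      have "(\<lambda>k. fps_nth (fps_shift n F) k * w ^ k) sums eval_fps (fps_shift n F) w"
        using elim by (intro sums_eval_fps) simp
      hence "(\<lambda>k. w ^ n * (fps_nth (fps_shift n F) k * w ^ k)) sums
          (w ^ n * eval_fps (fps_shift n F) w)" by (rule sums_mult)
      hence "(\<lambda>k. fps_nth F (k + n) * w ^ (k + n)) sums (w ^ n * eval_fps (fps_shift n F) w)"
        by (simp add: power_add mult_ac)
      hence "(\<lambda>k. fps_nth F k * w ^ k) sums
          (w ^ n * eval_fps (fps_shift n F) w + (\<Sum>k<n. fps_nth F k * w ^ k))"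
        using sums_iff_shift[of "\<lambda>k. fps_nth F k * w ^ k" n] by simp
      from sums_unique2[OF 1 this] show ?case by simp
    qed
  qed
  ultimately show ?thesis by (subst landau_o.big.in_cong[symmetric]) auto
qed

text \<open>Multiplication by \<open>w^n\<close> turns the Hamiltonian into a truncation of the
  power series of \<open>(w * z)^n\<close>. The extra term counted by \<open>contact_order\<close>
  at infinity is the constant term, kept by the projector there and dropped at finite
  punctures.\<close>

lemma Omega_expl_loc:
  assumes "w \<noteq> 0"
  shows "w ^ n * Omega_expl \<alpha> n (loc \<alpha> w t) t = (\<Sum>k<n + contact_order \<alpha>. zpow_coeff \<alpha> n k t * w ^ k)"
proof (cases "\<alpha> = 0")
  case True
  have "w ^ n * Omega_expl \<alpha> n (loc \<alpha> w t) t = (\<Sum>k\<le>n. zpow_coeff 0 n k t * (w ^ n * inverse w ^ (n - k)))"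
    using True by (simp add: Omega_expl_def loc_def sum_distrib_left mult_ac)
  also have "\<dots> = (\<Sum>k\<le>n. zpow_coeff 0 n k t * w ^ k)"
    using assms by (intro sum.cong refl) (simp add: power_inverse power_diff field_simps)
  finally show ?thesis using True by (simp add: contact_order_def lessThan_Suc_atMost)
next
  case False
  have "w ^ n * Omega_expl \<alpha> n (loc \<alpha> w t) t = (\<Sum>k<n. zpow_coeff \<alpha> n k t * (w ^ n * inverse w ^ (n - k)))"
    using False by (simp add: Omega_expl_def loc_def sum_distrib_left mult_ac)
  also have "\<dots> = (\<Sum>k<n. zpow_coeff \<alpha> n k t * w ^ k)"
    using assms by (intro sum.cong refl) (simp add: power_inverse power_diff field_simps)
  finally show ?thesis using False by (simp add: contact_order_def)
qed

lemma Omega_expl_order: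
  assumes "\<alpha> \<le> M" "t \<in> T"
  shows "(\<lambda>w. z \<alpha> (loc \<alpha> w t) t ^ n - Omega_expl \<alpha> n (loc \<alpha> w t) t) \<in> O[at 0](\<lambda>w. w ^ contact_order \<alpha>)"
proof -
  have r: "fps_conv_radius (zfps \<alpha> t ^ n) > 0"
    using zfps_radius_gt(2)[OF assms, of 0 n] loc_radius_pos[OF assms] by (simp add: zero_ereal_def)
  from fps_remainder_bigo[OF r, of "n + contact_order \<alpha>"]
  have "(\<lambda>w. inverse (w ^ n) * (eval_fps (zfps \<alpha> t ^ n) w - (\<Sum>k<n + contact_order \<alpha>. zpow_coeff \<alpha> n k t * w ^ k)))
      \<in> O[at 0](\<lambda>w. inverse (w ^ n) * w ^ (n + contact_order \<alpha>))"
    by (intro landau_o.big.mult) (auto simp: zpow_coeff_def)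
  also have "\<forall>\<^sub>F w in at (0::complex). inverse (w ^ n) * w ^ (n + contact_order \<alpha>) = w ^ contact_order \<alpha>"
    by (auto simp: eventually_at_filter power_add)
  hence "O[at 0](\<lambda>w. inverse (w ^ n) * w ^ (n + contact_order \<alpha>)) = O[at 0](\<lambda>w::complex. w ^ contact_order \<alpha>)"
    by (rule landau_o.big.cong)
  finally have "(\<lambda>w. inverse (w ^ n) * (eval_fps (zfps \<alpha> t ^ n) w - (\<Sum>k<n + contact_order \<alpha>. zpow_coeff \<alpha> n k t * w ^ k)))
      \<in> O[at 0](\<lambda>w. w ^ contact_order \<alpha>)" .
  moreover have "\<forall>\<^sub>F w in at 0. inverse (w ^ n) * (eval_fps (zfps \<alpha> t ^ n) w
      - (\<Sum>k<n + contact_order \<alpha>. zpow_coeff \<alpha> n k t * w ^ k)) = z \<alpha> (loc \<alpha> w t) t ^ n - Omega_expl \<alpha> n (loc \<alpha> w t) t"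
    using eventually_loc_radius[OF assms]
  proof eventually_elim
    case (elim w)
    have "inverse (w ^ n) * (eval_fps (zfps \<alpha> t ^ n) w - (\<Sum>k<n + contact_order \<alpha>. zpow_coeff \<alpha> n k t * w ^ k))
        = inverse (w ^ n) * (w ^ n * (z \<alpha> (loc \<alpha> w t) t ^ n - Omega_expl \<alpha> n (loc \<alpha> w t) t))"
      using elim assms Omega_expl_loc[of w n \<alpha> t]
      by (simp add: eval_zfps power_mult_distrib right_diff_distrib)
    thus ?case using elim by simp
  qed
  ultimately show ?thesis by (subst landau_o.big.in_cong[symmetric]) auto
qed

lemma zfps_radius_pos: "\<alpha> \<le> M \<Longrightarrow> t \<in> T \<Longrightarrow> fps_conv_radius (zfps \<alpha> t) > 0"
  using zfps_radius_gt(1)[of \<alpha> t 0] loc_radius_pos[of \<alpha> t] by (simp add: zero_ereal_def)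

lemma wz_tendsto:
  assumes "\<alpha> \<le> M" "t \<in> T"
  shows "((\<lambda>w. w * z \<alpha> (loc \<alpha> w t) t) \<longlongrightarrow> zcoeff \<alpha> 0 t) (at 0)"
proof -
  have "isCont (eval_fps (zfps \<alpha> t)) 0"
    using zfps_radius_pos[OF assms] by (intro continuous_eval_fps) (simp add: zero_ereal_def)
  hence "(eval_fps (zfps \<alpha> t) \<longlongrightarrow> zcoeff \<alpha> 0 t) (at 0)"
    by (simp add: isCont_def eval_fps_at_0 zfps_def)
  moreover have "\<forall>\<^sub>F w in at 0. eval_fps (zfps \<alpha> t) w = w * z \<alpha> (loc \<alpha> w t) t"
    using eventually_loc_radius[OF assms] by eventually_elim (use eval_zfps[OF assms, of _ 1] in simp)
  ultimately show ?thesis by (rule Lim_transform_eventually)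
qed

text \<open>The leading coefficient is nonzero, so \<open>z\<close> has a genuine simple pole; this
  converts powers of \<open>1/z\<close> into powers of \<open>w\<close>.\<close>

lemma inverse_z_tendsto:
  assumes "\<alpha> \<le> M" "t \<in> T"
  shows "((\<lambda>w. inverse (z \<alpha> (loc \<alpha> w t) t)) \<longlongrightarrow> 0) (at 0)"
    and "(\<lambda>w. inverse (z \<alpha> (loc \<alpha> w t) t)) \<in> O[at 0](\<lambda>w. w)"
proof -
  have *: "((\<lambda>w. inverse (w * z \<alpha> (loc \<alpha> w t) t)) \<longlongrightarrow> inverse (zcoeff \<alpha> 0 t)) (at 0)"
    by (intro tendsto_inverse wz_tendsto assms zcoeff_0_nonzero)
  have ev: "\<forall>\<^sub>F w in at 0. w * inverse (w * z \<alpha> (loc \<alpha> w t) t) = inverse (z \<alpha> (loc \<alpha> w t) t)"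
    by (auto simp: eventually_at_filter)
  have "((\<lambda>w. w * inverse (w * z \<alpha> (loc \<alpha> w t) t)) \<longlongrightarrow> 0 * inverse (zcoeff \<alpha> 0 t)) (at 0)"
    by (intro tendsto_mult * tendsto_ident_at)
  thus "((\<lambda>w. inverse (z \<alpha> (loc \<alpha> w t) t)) \<longlongrightarrow> 0) (at 0)"
    using Lim_transform_eventually[OF _ ev] by simp
  have "(\<lambda>w. inverse (w * z \<alpha> (loc \<alpha> w t) t)) \<in> O[at 0](\<lambda>_. 1)"
    using * by (intro bigoI_tendsto[where c = "inverse (zcoeff \<alpha> 0 t)"]) auto
  hence "(\<lambda>w. w * inverse (w * z \<alpha> (loc \<alpha> w t) t)) \<in> O[at 0](\<lambda>w. w * 1)"
    by (intro landau_o.big.mult) auto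
  thus "(\<lambda>w. inverse (z \<alpha> (loc \<alpha> w t) t)) \<in> O[at 0](\<lambda>w. w)"
    by (subst landau_o.big.in_cong[OF ev, symmetric]) simp
qed

text \<open>\<open>m\<^sub>\<alpha> = mreg(z\<^sub>\<alpha>) + t\<^sub>\<alpha>\<^sub>0 / z\<^sub>\<alpha> + mrem\<close>; summability for arbitrarily large \<open>z\<^sub>\<alpha>\<close> makes \<open>mreg\<close> entire.\<close>

definition mreg :: "nat \<Rightarrow> times \<Rightarrow> complex fps" where
  "mreg \<alpha> t = Abs_fps (\<lambda>n. of_nat (Suc n) * t (\<alpha>, Suc n))"

lemma mreg_radius:
  assumes "\<alpha> \<le> M" "t \<in> T"
  shows "fps_conv_radius (mreg \<alpha> t) = \<infinity>"
  unfolding fps_conv_radius_def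
proof (rule ereal_top)
  fix B :: real
  have "\<forall>\<^sub>F w in at 0. norm (inverse (z \<alpha> (loc \<alpha> w t) t)) < inverse (\<bar>B\<bar> + 1)"
    using inverse_z_tendsto(1)[OF assms] by (intro order_tendstoD(2)[of _ 0] tendsto_norm_zero) auto
  with eventually_loc_radius[OF assms] have "\<forall>\<^sub>F w in at 0. w \<noteq> 0 \<and> norm w < loc_radius \<alpha> t \<and>
      norm (inverse (z \<alpha> (loc \<alpha> w t) t)) < inverse (\<bar>B\<bar> + 1)"
    by eventually_elim auto
  then obtain w where w: "w \<noteq> 0" "norm w < loc_radius \<alpha> t"
    "norm (inverse (z \<alpha> (loc \<alpha> w t) t)) < inverse (\<bar>B\<bar> + 1)"
    using eventually_happens'[OF at_neq_bot] by blast
  have mem: "loc \<alpha> w t \<in> U \<alpha> t" using loc_mem assms w by blast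
  have "\<bar>B\<bar> + 1 < norm (z \<alpha> (loc \<alpha> w t) t)"
    using w(3) z_nonzero[OF assms mem] by (simp add: norm_inverse)
  moreover have "norm (z \<alpha> (loc \<alpha> w t) t) \<le> conv_radius (fps_nth (mreg \<alpha> t))"
    using m_summable[OF assms mem] by (intro conv_radius_geI) (simp add: mreg_def)
  ultimately show "ereal B \<le> conv_radius (fps_nth (mreg \<alpha> t))"
    by (smt (verit) ereal_less_eq(3) order_trans)
qed

definition mrem :: "nat \<Rightarrow> complex \<Rightarrow> times \<Rightarrow> complex" where
  "mrem \<alpha> w t = m \<alpha> (loc \<alpha> w t) t - eval_fps (mreg \<alpha> t) (z \<alpha> (loc \<alpha> w t) t)
     - tzero M \<alpha> t / z \<alpha> (loc \<alpha> w t) t"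

text \<open>The tail is \<open>x^2\<close> times a power series in \<open>x = 1/z\<close>, and
  \<open>x\<close> tends to 0 at the puncture.\<close>

lemma mrem_order:
  assumes "\<alpha> \<le> M" "t \<in> T"
  shows "(\<lambda>w. mrem \<alpha> w t) \<in> O[at 0](\<lambda>w. w ^ 2)"
proof -
  define G where "G = Abs_fps (\<lambda>n. v \<alpha> (n + 2) t)"
  let ?x = "\<lambda>w. inverse (z \<alpha> (loc \<alpha> w t) t)"
  have sm: "summable (\<lambda>n. fps_nth G n * ?x w ^ n)" "mrem \<alpha> w t = ?x w ^ 2 * eval_fps G (?x w)" "?x w \<noteq> 0"
    if w: "w \<noteq> 0" "norm w < loc_radius \<alpha> t" for w
  proof -
    have mem: "loc \<alpha> w t \<in> U \<alpha> t" using loc_mem assms w by blast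
    show nz: "?x w \<noteq> 0" using z_nonzero[OF assms mem] by simp
    have eq: "v \<alpha> (n + 2) t / z \<alpha> (loc \<alpha> w t) t ^ (n + 2) = ?x w ^ 2 * (fps_nth G n * ?x w ^ n)" for n
      by (simp add: G_def power_add power_inverse divide_inverse mult_ac power2_eq_square)
    have "summable (\<lambda>n. ?x w ^ 2 * (fps_nth G n * ?x w ^ n))"
      using m_summable[OF assms mem] unfolding eq by blast
    thus s: "summable (\<lambda>n. fps_nth G n * ?x w ^ n)"
      using nz by (subst (asm) summable_cmult_iff) simp
    show "mrem \<alpha> w t = ?x w ^ 2 * eval_fps G (?x w)"
      unfolding mrem_def m_expansion[OF assms mem] eq suminf_mult[OF s] eval_fps_def
      by (simp add: mreg_def)
  qed
  \<comment> \<open>Summability at the single nonzero point \<open>?x w1\<close> already gives a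
    positive radius of convergence.\<close>
  from eventually_happens'[OF at_neq_bot eventually_loc_radius[OF assms]]
  obtain w1 :: complex where w1: "w1 \<noteq> 0" "norm w1 < loc_radius \<alpha> t" by auto
  have "norm (?x w1) \<le> fps_conv_radius G"
    unfolding fps_conv_radius_def by (intro conv_radius_geI sm w1)
  moreover have "norm (?x w1) > 0" using sm(3)[OF w1] by simp
  ultimately have "fps_conv_radius G > 0"
    by (metis ereal_less(2) less_le_trans)
  hence "isCont (eval_fps G) 0" by (intro continuous_eval_fps) (simp add: zero_ereal_def)
  hence "((\<lambda>w. eval_fps G (?x w)) \<longlongrightarrow> eval_fps G 0) (at 0)"
    by (rule isCont_tendsto_compose) (rule inverse_z_tendsto[OF assms])
  hence "(\<lambda>w. eval_fps G (?x w)) \<in> O[at 0](\<lambda>_. 1)"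
    by (intro bigoI_tendsto[where c = "eval_fps G 0"]) auto
  hence "(\<lambda>w. ?x w ^ 2 * eval_fps G (?x w)) \<in> O[at 0](\<lambda>w. w ^ 2 * 1)"
    by (intro landau_o.big.mult landau_o.big_power inverse_z_tendsto assms)
  moreover have "\<forall>\<^sub>F w in at 0. mrem \<alpha> w t = ?x w ^ 2 * eval_fps G (?x w)"
    using eventually_loc_radius[OF assms] by eventually_elim (use sm in auto)
  ultimately show ?thesis by (subst landau_o.big.in_cong) auto
qed

section \<open>Dependence of \<open>m\<close> on one time at fixed \<open>z\<close>\<close>

definition tzero_dt :: "nat \<Rightarrow> nat \<times> nat \<Rightarrow> complex" where
  "tzero_dt \<alpha> a = (if snd a \<noteq> 0 then 0 else if \<alpha> = 0 then - 1 else if fst a = \<alpha> then 1 else 0)"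

lemma tzero_upd:
  assumes "a \<in> tidx M"
  shows "tzero M \<alpha> (t(a := s)) = tzero M \<alpha> t + tzero_dt \<alpha> a * (s - t a)"
proof (cases "\<alpha> = 0 \<and> snd a = 0")
  case True
  then obtain i where a: "a = (i, 0)" "i \<in> {1..M}" using assms by (cases a) (auto simp: tidx_def)
  have "(\<Sum>j = 1..M. (t(a := s)) (j, 0)) = s + (\<Sum>j\<in>{1..M}-{i}. t (j, 0))"
    using a(2) by (subst sum.remove[of _ i]) (auto simp: a(1))
  also have "\<dots> = (\<Sum>j = 1..M. t (j, 0)) + (s - t a)"
    using a(2) by (subst (2) sum.remove[of _ i]) (auto simp: a(1))
  finally show ?thesis using True by (simp add: tzero_def tzero_dt_def)
next
  case False
  thus ?thesis by (cases a) (auto simp: tzero_def tzero_dt_def)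
qed

text \<open>This is both the coefficient of the time \<open>t a\<close> in the regular part of
  \<open>m\<close> and, with \<open>n = snd a\<close>, the derivative of \<open>\<zeta>^n\<close>;
  the coincidence is what pairs \<open>m\<close> with the Hamiltonians. At \<open>n = 0\<close> the
  factor 0 absorbs the truncated exponent.\<close>

definition mreg_dt :: "nat \<Rightarrow> nat \<times> nat \<Rightarrow> complex \<Rightarrow> complex" where
  "mreg_dt \<alpha> a \<zeta> = (if fst a = \<alpha> then of_nat (snd a) * \<zeta> ^ (snd a - 1) else 0)"

text \<open>Changing one time alters at most one coefficient, so the dependence on \<open>s\<close>
  is affine and the only infinite series is the one at the fixed time \<open>t\<close>.\<close>

lemma mreg_upd:
  assumes "\<alpha> \<le> M" "t \<in> T"
  shows "eval_fps (mreg \<alpha> (t(a := s))) \<zeta> = eval_fps (mreg \<alpha> t) \<zeta> + mreg_dt \<alpha> a \<zeta> * (s - t a)"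
proof (cases "fst a = \<alpha> \<and> snd a \<noteq> 0")
  case True
  then obtain k where a: "a = (\<alpha>, Suc k)" by (cases a) (auto simp: gr0_conv_Suc)
  have "(\<lambda>n. fps_nth (mreg \<alpha> t) n * \<zeta> ^ n) sums eval_fps (mreg \<alpha> t) \<zeta>"
    using mreg_radius[OF assms] by (intro sums_eval_fps) simp
  moreover have "(\<lambda>n. if n = k then of_nat (Suc n) * \<zeta> ^ n * (s - t a) else 0) sums
      (of_nat (Suc k) * \<zeta> ^ k * (s - t a))" by (rule sums_single)
  ultimately have "(\<lambda>n. fps_nth (mreg \<alpha> t) n * \<zeta> ^ n +
        (if n = k then of_nat (Suc n) * \<zeta> ^ n * (s - t a) else 0))
      sums (eval_fps (mreg \<alpha> t) \<zeta> + of_nat (Suc k) * \<zeta> ^ k * (s - t a))"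
    by (rule sums_add)
  also have "(\<lambda>n. fps_nth (mreg \<alpha> t) n * \<zeta> ^ n +
        (if n = k then of_nat (Suc n) * \<zeta> ^ n * (s - t a) else 0))
      = (\<lambda>n. fps_nth (mreg \<alpha> (t(a := s))) n * \<zeta> ^ n)"
    by (auto simp: mreg_def a algebra_simps)
  finally have "eval_fps (mreg \<alpha> (t(a := s))) \<zeta> = eval_fps (mreg \<alpha> t) \<zeta> + of_nat (Suc k) * \<zeta> ^ k * (s - t a)"
    unfolding eval_fps_def by (rule sums_unique[symmetric])
  thus ?thesis by (simp add: mreg_dt_def a)
next
  case False
  hence "mreg \<alpha> (t(a := s)) = mreg \<alpha> t" by (cases a) (auto simp: mreg_def fps_eq_iff)
  thus ?thesis using False by (auto simp: mreg_dt_def)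
qed

end

section \<open>Derivatives in local coordinates\<close>

lemma eventually_nhds_slice2:
  assumes "\<forall>\<^sub>F x in nhds (a, b). P x"
  shows "\<forall>\<^sub>F y in nhds b. P (a, y)"
proof -
  have "filterlim (\<lambda>x. (a, x)) (nhds (a, b)) (nhds b)"
    by (intro tendsto_intros) (simp add: filterlim_ident)
  with assms show ?thesis by (auto simp: filterlim_iff)
qed

context whitham
begin

lemma eventually_U:
  assumes "\<alpha> \<le> M" "t \<in> T" "p \<in> U \<alpha> t" "a \<in> tidx M"
  shows "\<forall>\<^sub>F x in nhds (p, t a). t(a := snd x) \<in> T \<and> fst x \<in> U \<alpha> (t(a := snd x))"
proof -
  have pt: "(p, t) \<in> over T (U \<alpha>)" using assms(2,3) by (simp add: over_def)
  have "open (slice (over T (U \<alpha>)) t a)"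
    using zm_hol[OF assms(1)] pt assms(4) unfolding open_pt_def by fastforce
  moreover have "(p, t a) \<in> slice (over T (U \<alpha>)) t a" using pt by (simp add: slice_def)
  ultimately have "\<forall>\<^sub>F x in nhds (p, t a). x \<in> slice (over T (U \<alpha>)) t a"
    by (rule eventually_nhds_in_open)
  thus ?thesis by eventually_elim (auto simp: slice_def over_def)
qed

definition dom :: "nat \<Rightarrow> times \<Rightarrow> nat \<times> nat \<Rightarrow> complex \<times> complex \<Rightarrow> bool" where
  "dom \<alpha> t a x \<longleftrightarrow> fst x \<noteq> 0 \<and> t(a := snd x) \<in> T \<and> norm (fst x) < loc_radius \<alpha> (t(a := snd x))"

text \<open>No continuity of \<open>\<rho>\<close> in the times is assumed. A lower bound for the
  radius near \<open>t\<close> comes instead from openness of the domain: one test point of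
  \<open>U \<alpha> t\<close> stays in the domain at nearby times, and this keeps the radius from
  collapsing.\<close>

lemma eventually_dom:
  assumes \<alpha>: "\<alpha> \<le> M" and t: "t \<in> T" and a: "a \<in> tidx M"
  shows "\<forall>\<^sub>F x in nhds (0, t a). fst x \<noteq> 0 \<longrightarrow> dom \<alpha> t a x"
proof -
  have "\<exists>r>0. \<forall>\<^sub>F s in nhds (t a). t(a := s) \<in> T \<and> r < loc_radius \<alpha> (t(a := s))"
  proof (cases "\<alpha> = 0")
    case True
    \<comment> \<open>The test point at infinity is the real number \<open>\<rho> 0 t + 1\<close>;
      that it stays in the domain means \<open>\<rho> 0 < R\<close> at nearby times.\<close>
    define R where "R = \<rho> 0 t + 1"
    have R: "R > 0" using rho_pos[of 0 t] t by (simp add: R_def)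
    have "complex_of_real R \<in> U \<alpha> t" using True R by (simp add: pnbhd_def R_def)
    from eventually_nhds_slice2[OF eventually_U[OF \<alpha> t this a]]
    have "\<forall>\<^sub>F s in nhds (t a). t(a := s) \<in> T \<and> inverse R < loc_radius \<alpha> (t(a := s))"
    proof eventually_elim
      case (elim s)
      hence "\<rho> 0 (t(a := s)) < R" using True R by (simp add: pnbhd_def)
      thus ?case using elim True rho_pos[of 0 "t(a := s)"] by (simp add: loc_radius_def less_imp_inverse_less)
    qed
    thus ?thesis using R by (intro exI[of _ "inverse R"]) auto
  next
    case False
    define R where "R = \<rho> \<alpha> t / 2"
    have R: "R > 0" using rho_pos[OF \<alpha> t] by (simp add: R_def)
    have "q \<alpha> t + complex_of_real R \<in> U \<alpha> t"
      using False rho_pos[OF \<alpha> t] by (auto simp: pnbhd_def R_def dist_norm)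
    note 1 = eventually_nhds_slice2[OF eventually_U[OF \<alpha> t this a]]
    have "isCont (\<lambda>s. q \<alpha> (t(a := s))) (t a)"
      using hol_t_differentiable[OF q_hol t a, of \<alpha> "t a"] False \<alpha> t
      by (simp add: field_differentiable_imp_continuous_at)
    hence "((\<lambda>s. q \<alpha> (t(a := s))) \<longlongrightarrow> q \<alpha> (t(a := t a))) (nhds (t a))"
      unfolding isCont_def by (rule tendsto_at_iff_tendsto_nhds[THEN iffD1])
    hence "((\<lambda>s. q \<alpha> (t(a := s))) \<longlongrightarrow> q \<alpha> t) (nhds (t a))" by simp
    hence "\<forall>\<^sub>F s in nhds (t a). dist (q \<alpha> (t(a := s))) (q \<alpha> t) < R / 2"
      using R by (intro tendstoD) auto
    with 1 have "\<forall>\<^sub>F s in nhds (t a). t(a := s) \<in> T \<and> R / 2 < loc_radius \<alpha> (t(a := s))"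
    proof eventually_elim
      case (elim s)
      have "dist (q \<alpha> (t(a := s))) (q \<alpha> t + complex_of_real R) < \<rho> \<alpha> (t(a := s))"
        using elim False by (simp add: pnbhd_def)
      moreover have "R = dist (q \<alpha> t) (q \<alpha> t + complex_of_real R)" using R by (simp add: dist_norm)
      \<comment> \<open>The puncture has moved by less than \<open>R / 2\<close> and the test point
        is within the new radius of it, so by the triangle inequality that radius exceeds
        \<open>R / 2\<close>.\<close>
      ultimately have "R < R / 2 + \<rho> \<alpha> (t(a := s))"
        using elim(2) dist_triangle[of "q \<alpha> t" "q \<alpha> t + complex_of_real R" "q \<alpha> (t(a := s))"]
        by (simp only: dist_commute[of "q \<alpha> t" "q \<alpha> (t(a := s))"])
      thus ?case using elim False by (simp add: loc_radius_def)
    qed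
    thus ?thesis using R by (intro exI[of _ "R / 2"]) auto
  qed
  then obtain r where r: "r > 0" "\<forall>\<^sub>F s in nhds (t a). t(a := s) \<in> T \<and> r < loc_radius \<alpha> (t(a := s))"
    by blast
  have "\<forall>\<^sub>F w in nhds (0::complex). norm w < r"
    using r(1) unfolding eventually_nhds_metric by (auto intro!: exI[of _ r])
  from eventually_prodI[OF this r(2)] show ?thesis
    unfolding nhds_prod by eventually_elim (auto simp: dom_def)
qed

lemma dom_loc_mem:
  assumes "dom \<alpha> t a x" "\<alpha> \<le> M" "a \<in> tidx M"
  shows "loc \<alpha> (fst x) (t(a := snd x)) \<in> U \<alpha> (t(a := snd x))"
  using assms by (auto simp: dom_def intro: loc_mem)

lemma loc_cdiff2:
  assumes "\<alpha> \<le> M" "t \<in> T" "a \<in> tidx M" "w \<noteq> 0" "t(a := s) \<in> T"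
  shows "cdiff2 (\<lambda>x. loc \<alpha> (fst x) (t(a := snd x))) (w, s)"
proof (cases "\<alpha> = 0")
  case True
  thus ?thesis using assms by (simp add: loc_def cdiff2_inverse)
next
  case False
  thus ?thesis unfolding loc_def if_not_P[OF False] using assms
    by (intro cdiff2_add cdiff2_fst cdiff2_fun_snd[of "\<lambda>s. q \<alpha> (t(a := s))"] hol_t_differentiable q_hol) auto
qed

lemma pullback_cdiff2:
  assumes "\<alpha> \<le> M" "t \<in> T" "a \<in> tidx M" "w \<noteq> 0" "t(a := s) \<in> T"
    "cdiff2 (\<lambda>x. f (fst x) (t(a := snd x))) (loc \<alpha> w (t(a := s)), s)"
  shows "cdiff2 (\<lambda>x. f (loc \<alpha> (fst x) (t(a := snd x))) (t(a := snd x))) (w, s)"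
  using cdiff2_compose2[of "\<lambda>x. f (fst x) (t(a := snd x))" "\<lambda>x. loc \<alpha> (fst x) (t(a := snd x))" "(w, s)" snd]
    loc_cdiff2[OF assms(1-5)] assms(6) by simp

lemma zm_cdiff2:
  assumes "\<alpha> \<le> M" "a \<in> tidx M" "p \<in> U \<alpha> (t(a := s))" "t(a := s) \<in> T"
  shows "cdiff2 (\<lambda>x. z \<alpha> (fst x) (t(a := snd x))) (p, s)"
    and "cdiff2 (\<lambda>x. m \<alpha> (fst x) (t(a := snd x))) (p, s)"
  using hol_pt_cdiff2[of M "over T (U \<alpha>)" _ p t a s] zm_hol[OF assms(1)] assms
  by (auto simp: over_def)

lemma zm_loc_cdiff2:
  assumes "\<alpha> \<le> M" "t \<in> T" "a \<in> tidx M" "dom \<alpha> t a (w, s)"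
  shows "cdiff2 (\<lambda>x. z \<alpha> (loc \<alpha> (fst x) (t(a := snd x))) (t(a := snd x))) (w, s)"
    and "cdiff2 (\<lambda>x. m \<alpha> (loc \<alpha> (fst x) (t(a := snd x))) (t(a := snd x))) (w, s)"
  using assms dom_loc_mem[OF assms(4,1,3)]
  by (auto simp: dom_def intro!: pullback_cdiff2 zm_cdiff2)

text \<open>Derivatives at fixed local coordinate \<open>w\<close>, where the puncture stands still.\<close>

definition dloc_t :: "nat \<Rightarrow> nat \<times> nat \<Rightarrow> pt_fun \<Rightarrow> complex \<Rightarrow> times \<Rightarrow> complex" where
  "dloc_t \<alpha> a f w t = deriv (\<lambda>s. f (loc \<alpha> w (t(a := s))) (t(a := s))) (t a)"

definition dloc_w :: "nat \<Rightarrow> pt_fun \<Rightarrow> complex \<Rightarrow> times \<Rightarrow> complex" where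
  "dloc_w \<alpha> f w t = deriv (\<lambda>w. f (loc \<alpha> w t) t) w"

text \<open>Velocity of the puncture in the \<open>p\<close>-plane; the point at infinity does not
  move.\<close>

definition loc_dt :: "nat \<Rightarrow> nat \<times> nat \<Rightarrow> times \<Rightarrow> complex" where
  "loc_dt \<alpha> a t = (if \<alpha> = 0 then 0 else deriv (\<lambda>s. q \<alpha> (t(a := s))) (t a))"

definition loc_dw :: "nat \<Rightarrow> complex \<Rightarrow> complex" where
  "loc_dw \<alpha> w = (if \<alpha> = 0 then - (inverse w ^ 2) else 1)"

lemma loc_deriv_s:
  assumes "\<alpha> \<le> M" "t \<in> T" "a \<in> tidx M"
  shows "((\<lambda>s. loc \<alpha> w (t(a := s))) has_field_derivative loc_dt \<alpha> a t) (at (t a))"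
  using assms hol_t_deriv[OF q_hol, of \<alpha> t a]
  by (cases "\<alpha> = 0") (auto simp: loc_def loc_dt_def intro!: derivative_eq_intros)

lemma loc_deriv_w:
  assumes "w \<noteq> 0"
  shows "((\<lambda>w. loc \<alpha> w t) has_field_derivative loc_dw \<alpha> w) (at w)"
  using assms by (cases "\<alpha> = 0")
    (auto simp: loc_def loc_dw_def power2_eq_square intro!: derivative_eq_intros)

text \<open>The second summand is the transport term: at fixed \<open>w\<close> the point
  \<open>p\<close> is carried along with the puncture.\<close>

lemma dsl_chain:
  assumes "\<alpha> \<le> M" "t \<in> T" "a \<in> tidx M"
    "cdiff2 (\<lambda>x. f (fst x) (t(a := snd x))) (loc \<alpha> w t, t a)"
  shows "dloc_t \<alpha> a f w t = pd (Ct a) f (loc \<alpha> w t) t + loc_dt \<alpha> a t * pd Cp f (loc \<alpha> w t) t"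
proof -
  have "((\<lambda>s. f (loc \<alpha> w (t(a := s))) (t(a := s))) has_field_derivative
      (deriv (\<lambda>p. f p t) (loc \<alpha> w t) * loc_dt \<alpha> a t +
       deriv (\<lambda>s. f (loc \<alpha> w t) (t(a := s))) (t a) * 1)) (at (t a))"
    using cdiff2_curve[of "\<lambda>x. f (fst x) (t(a := snd x))" "\<lambda>s. loc \<alpha> w (t(a := s))" "t a" "\<lambda>s. s",
        OF _ loc_deriv_s[OF assms(1-3)] DERIV_ident] assms(4) by simp
  from DERIV_imp_deriv[OF this] show ?thesis by (simp add: dloc_t_def mult.commute)
qed

lemma dwl_chain:
  assumes "w \<noteq> 0" "cdiff2 (\<lambda>x. f (fst x) (t(a := snd x))) (loc \<alpha> w t, t a)"
  shows "dloc_w \<alpha> f w t = loc_dw \<alpha> w * pd Cp f (loc \<alpha> w t) t"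
proof -
  have "((\<lambda>p. f p t) has_field_derivative deriv (\<lambda>p. f p t) (loc \<alpha> w t)) (at (loc \<alpha> w t))"
    using cdiff2_fst_deriv[OF assms(2)] by simp
  from DERIV_chain2[OF this loc_deriv_w[OF assms(1)]] show ?thesis
    unfolding dloc_w_def by (simp add: DERIV_imp_deriv mult.commute)
qed

section \<open>Orders of the derivatives of \<open>z\<close> at a puncture\<close>

lemma eventually_at_of_nhds_pair:
  assumes "\<forall>\<^sub>F x in nhds (0::complex, s::complex). fst x \<noteq> 0 \<longrightarrow> P x"
  shows "\<forall>\<^sub>F w in at 0. w \<noteq> 0 \<and> P (w, s)"
  using eventually_nhds_slice[OF assms] by (simp add: eventually_at_filter eventually_mono)

lemma eventually_at_dom:
  assumes "\<alpha> \<le> M" "t \<in> T" "a \<in> tidx M"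
  shows "\<forall>\<^sub>F w in at 0. dom \<alpha> t a (w, t a)"
  using eventually_at_of_nhds_pair[OF eventually_dom[OF assms]] by eventually_elim auto

text \<open>The pole \<open>1/w\<close> subtracted at infinity does not depend on the times, so it
  disappears from the time derivative, which thereby gains one order there.\<close>

lemma z_minus_pole_order:
  assumes "\<alpha> \<le> M" "t \<in> T"
  shows "(\<lambda>w. z \<alpha> (loc \<alpha> w t) t - (if \<alpha> = 0 then inverse w else 0)) \<in> O[at 0](\<lambda>w. w ^ contact_order \<alpha> / w)"
proof -
  have "(\<lambda>w. inverse w * (eval_fps (zfps \<alpha> t) w - (\<Sum>k<contact_order \<alpha>. fps_nth (zfps \<alpha> t) k * w ^ k)))
      \<in> O[at 0](\<lambda>w. inverse w * w ^ contact_order \<alpha>)"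
    by (intro landau_o.big.mult fps_remainder_bigo zfps_radius_pos assms) auto
  moreover have "\<forall>\<^sub>F w in at 0. inverse w * (eval_fps (zfps \<alpha> t) w - (\<Sum>k<contact_order \<alpha>. fps_nth (zfps \<alpha> t) k * w ^ k))
      = z \<alpha> (loc \<alpha> w t) t - (if \<alpha> = 0 then inverse w else 0)"
    using eventually_loc_radius[OF assms]
    by eventually_elim (use eval_zfps[OF assms, of _ 1] in
      \<open>auto simp: contact_order_def zfps_def zcoeff_def right_diff_distrib mult.assoc[symmetric]\<close>)
  ultimately have "(\<lambda>w. z \<alpha> (loc \<alpha> w t) t - (if \<alpha> = 0 then inverse w else 0))
      \<in> O[at 0](\<lambda>w. inverse w * w ^ contact_order \<alpha>)"
    using landau_o.big.in_cong by fast
  thus ?thesis by (simp add: divide_inverse mult.commute)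
qed

lemma z_dt_order:
  assumes "\<alpha> \<le> M" "t \<in> T" "a \<in> tidx M"
  shows "(\<lambda>w. dloc_t \<alpha> a (z \<alpha>) w t) \<in> O[at 0](\<lambda>w. w ^ contact_order \<alpha> / w)"
proof -
  let ?c = "\<lambda>w::complex. if \<alpha> = 0 then inverse w else 0"
  define f where "f = (\<lambda>x. z \<alpha> (loc \<alpha> (fst x) (t(a := snd x))) (t(a := snd x)) - ?c (fst x))"
  have "(\<lambda>w. deriv (\<lambda>s. f (w, s)) (t a)) \<in> O[at 0](\<lambda>w. w ^ contact_order \<alpha> / w)"
  proof (rule bigo_param_deriv)
    show "\<forall>\<^sub>F x in nhds (0, t a). fst x \<noteq> 0 \<longrightarrow> cdiff2 f x"
      using eventually_dom[OF assms]
    proof eventually_elim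
      case (elim x)
      show ?case
      proof
        assume x: "fst x \<noteq> 0"
        have "cdiff2 (\<lambda>x. ?c (fst x)) x" using x by (cases "\<alpha> = 0") (auto intro: cdiff2_inverse)
        moreover have "cdiff2 (\<lambda>x. z \<alpha> (loc \<alpha> (fst x) (t(a := snd x))) (t(a := snd x))) (fst x, snd x)"
          using elim x by (intro zm_loc_cdiff2 assms) auto
        ultimately show "cdiff2 f x" unfolding f_def by (intro cdiff2_diff) auto
      qed
    qed
    show "\<forall>\<^sub>F s in nhds (t a). (\<lambda>w. f (w, s)) \<in> O[at 0](\<lambda>w. w ^ contact_order \<alpha> / w)"
      using eventually_T[OF assms(2,3)] by eventually_elim (use z_minus_pole_order[OF assms(1)] in \<open>simp only: f_def fst_conv snd_conv\<close>)
    show "(\<lambda>w::complex. w ^ contact_order \<alpha> / w) holomorphic_on - {0}" by (intro holomorphic_intros) auto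
  qed auto
  moreover have "\<forall>\<^sub>F w in at 0. deriv (\<lambda>s. f (w, s)) (t a) = dloc_t \<alpha> a (z \<alpha>) w t"
    using eventually_at_dom[OF assms]
  proof eventually_elim
    case (elim w)
    from cdiff2_snd_deriv[OF zm_loc_cdiff2(1)[OF assms elim]]
    have "((\<lambda>s. f (w, s)) has_field_derivative (dloc_t \<alpha> a (z \<alpha>) w t - 0)) (at (t a))"
      unfolding f_def dloc_t_def fst_conv snd_conv by (intro DERIV_diff DERIV_const)
    from DERIV_imp_deriv[OF this] show ?case by simp
  qed
  ultimately show ?thesis by (subst (asm) landau_o.big.in_cong)
qed

lemma z_dw_formula:
  assumes "\<alpha> \<le> M" "t \<in> T" "w \<noteq> 0" "norm w < loc_radius \<alpha> t"
  shows "dloc_w \<alpha> (z \<alpha>) w t = eval_fps (fps_deriv (zfps \<alpha> t)) w / w - z \<alpha> (loc \<alpha> w t) t / w"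
proof -
  have "((\<lambda>w. eval_fps (zfps \<alpha> t) w / w) has_field_derivative
      (eval_fps (fps_deriv (zfps \<alpha> t)) w * w - eval_fps (zfps \<alpha> t) w * 1) / (w * w)) (at w)"
    by (intro DERIV_divide has_field_derivative_eval_fps zfps_radius_gt assms DERIV_ident)
  hence "((\<lambda>w. z \<alpha> (loc \<alpha> w t) t) has_field_derivative
      (eval_fps (fps_deriv (zfps \<alpha> t)) w * w - eval_fps (zfps \<alpha> t) w * 1) / (w * w)) (at w)"
    by (rule has_field_derivative_transform_within_open[of _ _ _ "ball 0 (loc_radius \<alpha> t) - {0}"])
      (use eval_zfps[OF assms(1,2), of _ 1] assms in \<open>auto simp: open_delete\<close>)
  from DERIV_imp_deriv[OF this] show ?thesis
    using assms eval_zfps[OF assms, of 1] by (simp add: dloc_w_def diff_divide_distrib)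
qed

lemma zfps_deriv_bounded:
  assumes "\<alpha> \<le> M" "t \<in> T"
  shows "eval_fps (fps_deriv (zfps \<alpha> t)) \<in> O[at 0](\<lambda>_. 1)"
proof (rule continuous_imp_bigo_1)
  have "fps_conv_radius (fps_deriv (zfps \<alpha> t)) > 0"
    using zfps_radius_pos[OF assms] fps_conv_radius_deriv[of "zfps \<alpha> t"] by (rule less_le_trans)
  thus "isCont (eval_fps (fps_deriv (zfps \<alpha> t))) 0"
    by (intro continuous_eval_fps) (simp add: zero_ereal_def)
qed

lemma z_order:
  assumes "\<alpha> \<le> M" "t \<in> T"
  shows "(\<lambda>w. z \<alpha> (loc \<alpha> w t) t) \<in> O[at 0](\<lambda>w. 1 / w)"
  by (rule bigoI_tendsto[where c = "zcoeff \<alpha> 0 t"])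
    (use wz_tendsto[OF assms] in \<open>auto simp: mult.commute eventually_at_filter\<close>)

text \<open>A simple pole has logarithmic derivative \<open>-1/w\<close> up to a bounded term; the
  second estimate is what meets the derivative of the logarithm in \<open>omega\<close>.\<close>

lemma z_dw_order:
  assumes "\<alpha> \<le> M" "t \<in> T"
  shows "(\<lambda>w. dloc_w \<alpha> (z \<alpha>) w t) \<in> O[at 0](\<lambda>w. 1 / w ^ 2)"
    and "(\<lambda>w. dloc_w \<alpha> (z \<alpha>) w t * inverse (z \<alpha> (loc \<alpha> w t) t) + 1 / w) \<in> O[at 0](\<lambda>_. 1)"
proof -
  let ?Z = "eval_fps (fps_deriv (zfps \<alpha> t))" and ?z = "\<lambda>w. z \<alpha> (loc \<alpha> w t) t"
  have "(\<lambda>w. ?Z w * (1 / w)) \<in> O[at 0](\<lambda>w. 1 * (1 / w))"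
    by (intro landau_o.big.mult zfps_deriv_bounded assms) auto
  also have "(\<lambda>w. 1 * (1 / w)) \<in> O[at 0](\<lambda>w::complex. 1 / w ^ 2)"
    by (rule bigoI_tendsto[where c = 0])
      (auto simp: eventually_at_filter power2_eq_square intro!: tendsto_eq_intros)
  finally have 1: "(\<lambda>w. ?Z w / w) \<in> O[at 0](\<lambda>w. 1 / w ^ 2)" by simp
  have "(\<lambda>w. ?z w * (1 / w)) \<in> O[at 0](\<lambda>w. 1 / w * (1 / w))"
    by (intro landau_o.big.mult z_order assms) auto
  hence 2: "(\<lambda>w. ?z w / w) \<in> O[at 0](\<lambda>w. 1 / w ^ 2)" by (simp add: power2_eq_square)
  have ev: "\<forall>\<^sub>F w in at 0. dloc_w \<alpha> (z \<alpha>) w t = ?Z w / w - ?z w / w"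
    using eventually_loc_radius[OF assms] by eventually_elim (use z_dw_formula[OF assms] in auto)
  show "(\<lambda>w. dloc_w \<alpha> (z \<alpha>) w t) \<in> O[at 0](\<lambda>w. 1 / w ^ 2)"
    by (subst landau_o.big.in_cong[OF ev]) (intro sum_in_bigo 1 2)
  have "(\<lambda>w. ?Z w * (inverse (?z w) * (1 / w))) \<in> O[at 0](\<lambda>w. 1 * (w * (1 / w)))"
    by (intro landau_o.big.mult zfps_deriv_bounded inverse_z_tendsto assms) auto
  also have "\<forall>\<^sub>F w::complex in at 0. 1 * (w * (1 / w)) = 1" by (simp add: eventually_at_filter)
  hence "O[at 0](\<lambda>w::complex. 1 * (w * (1 / w))) = O[at 0](\<lambda>_. 1)" by (rule landau_o.big.cong)
  finally have 3: "(\<lambda>w. ?Z w * (inverse (?z w) * (1 / w))) \<in> O[at 0](\<lambda>_. 1)" .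
  have ev2: "\<forall>\<^sub>F w in at 0. dloc_w \<alpha> (z \<alpha>) w t * inverse (?z w) + 1 / w = ?Z w * (inverse (?z w) * (1 / w))"
    using ev eventually_loc_radius[OF assms]
  proof eventually_elim
    case (elim w)
    thus ?case using z_nonzero[OF assms loc_mem[OF assms]] by (simp add: field_simps)
  qed
  show "(\<lambda>w. dloc_w \<alpha> (z \<alpha>) w t * inverse (?z w) + 1 / w) \<in> O[at 0](\<lambda>_. 1)"
    by (subst landau_o.big.in_cong[OF ev2]) (rule 3)
qed

text \<open>\<open>mreg_upd\<close> moves the dependence on \<open>s\<close> out of the series, so
  only the entire function belonging to the fixed time \<open>t\<close> is composed with
  \<open>z\<close>.\<close>

lemma mrem_cdiff2:
  assumes "\<alpha> \<le> M" "t \<in> T" "a \<in> tidx M" "dom \<alpha> t a (w, s)"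
  shows "cdiff2 (\<lambda>x. mrem \<alpha> (fst x) (t(a := snd x))) (w, s)"
proof -
  let ?z = "\<lambda>x. z \<alpha> (loc \<alpha> (fst x) (t(a := snd x))) (t(a := snd x))"
  have nz: "?z (w, s) \<noteq> 0"
    using z_nonzero[OF assms(1) _ dom_loc_mem[OF assms(4,1,3)]] assms(4) by (simp add: dom_def)
  have F: "cdiff2 (\<lambda>x. eval_fps (mreg \<alpha> t) (?z x)) (w, s)"
    by (intro cdiff2_compose1[of "eval_fps (mreg \<alpha> t)"] zm_loc_cdiff2 assms)
      (auto simp: field_differentiable_def mreg_radius[OF assms(1,2)]
        intro!: exI has_field_derivative_eval_fps)
  have k: "cdiff2 (\<lambda>x. mreg_dt \<alpha> a (?z x)) (w, s)"
    unfolding mreg_dt_def using zm_loc_cdiff2(1)[OF assms]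
    by (cases "fst a = \<alpha>") (auto intro!: cdiff2_intros)
  have "cdiff2 (\<lambda>x. m \<alpha> (loc \<alpha> (fst x) (t(a := snd x))) (t(a := snd x))
      - (eval_fps (mreg \<alpha> t) (?z x) + mreg_dt \<alpha> a (?z x) * (snd x - t a))
      - (tzero M \<alpha> t + tzero_dt \<alpha> a * (snd x - t a)) / ?z x) (w, s)"
    using nz by (intro cdiff2_intros F k zm_loc_cdiff2 assms)
  thus ?thesis unfolding mrem_def by (simp only: mreg_upd[OF assms(1,2)] tzero_upd[OF assms(3)])
qed

lemma mrem_dt_order:
  assumes "\<alpha> \<le> M" "t \<in> T" "a \<in> tidx M"
  shows "(\<lambda>w. deriv (\<lambda>s. mrem \<alpha> w (t(a := s))) (t a)) \<in> O[at 0](\<lambda>w. w ^ 2)"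
proof -
  have "(\<lambda>w. deriv (\<lambda>s. (\<lambda>x. mrem \<alpha> (fst x) (t(a := snd x))) (w, s)) (t a)) \<in> O[at 0](\<lambda>w. w ^ 2)"
  proof (rule bigo_param_deriv)
    show "\<forall>\<^sub>F x in nhds (0, t a). fst x \<noteq> 0 \<longrightarrow> cdiff2 (\<lambda>x. mrem \<alpha> (fst x) (t(a := snd x))) x"
      using eventually_dom[OF assms] by eventually_elim (use mrem_cdiff2[OF assms] in force)
    show "\<forall>\<^sub>F s in nhds (t a). (\<lambda>w. mrem \<alpha> (fst (w, s)) (t(a := snd (w, s)))) \<in> O[at 0](\<lambda>w. w ^ 2)"
      using eventually_T[OF assms(2,3)] by eventually_elim (use mrem_order[OF assms(1)] in simp)
  qed (auto intro!: holomorphic_intros)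
  thus ?thesis by simp
qed

text \<open>The time \<open>x\<close> always exists. It serves as the dummy direction wherever only
  \<open>p\<close> or \<open>w\<close> is differentiated, because holomorphy is stated jointly with
  one time.\<close>

lemma zero_one_in_tidx: "(0, 1) \<in> tidx M"
  by (simp add: tidx_def)

lemma mrem_dw_order:
  assumes "\<alpha> \<le> M" "t \<in> T"
  shows "(\<lambda>w. deriv (\<lambda>w. mrem \<alpha> w t) w) \<in> O[at 0](\<lambda>w. w)"
proof -
  have "\<forall>\<^sub>F w in at 0. (\<lambda>w. mrem \<alpha> w t) field_differentiable at w"
    using eventually_at_dom[OF assms zero_one_in_tidx]
  proof eventually_elim
    case (elim w)
    from cdiff2_fst_deriv[OF mrem_cdiff2[OF assms zero_one_in_tidx elim]] show ?case
      unfolding field_differentiable_def by auto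
  qed
  from bigo_deriv_power[OF this mrem_order[OF assms]] show ?thesis by simp
qed

text \<open>\<open>m_z_deriv\<close> is \<open>\<partial>m\<^sub>\<alpha>/\<partial>z\<^sub>\<alpha>\<close> at fixed times and \<open>m_t_deriv\<close> the derivative of \<open>m\<^sub>\<alpha>\<close> in an explicit time
  at fixed \<open>z\<^sub>\<alpha>\<close>, both without the contribution of \<open>mrem\<close>. The former cancels in \<open>dz\<^sub>\<alpha> \<and> dm\<^sub>\<alpha>\<close>.\<close>

definition m_t_deriv :: "nat \<Rightarrow> nat \<times> nat \<Rightarrow> complex \<Rightarrow> complex" where
  "m_t_deriv \<alpha> a \<zeta> = mreg_dt \<alpha> a \<zeta> + tzero_dt \<alpha> a * inverse \<zeta>"

definition m_z_deriv :: "nat \<Rightarrow> complex \<Rightarrow> times \<Rightarrow> complex" where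
  "m_z_deriv \<alpha> w t = eval_fps (fps_deriv (mreg \<alpha> t)) (z \<alpha> (loc \<alpha> w t) t)
     - tzero M \<alpha> t * inverse (z \<alpha> (loc \<alpha> w t) t) ^ 2"

lemma mreg_dt_differentiable: "mreg_dt \<alpha> a field_differentiable at \<zeta>"
  unfolding mreg_dt_def by (cases "fst a = \<alpha>") (auto intro!: derivative_intros)

lemma m_dt_formula:
  assumes "\<alpha> \<le> M" "t \<in> T" "a \<in> tidx M" "dom \<alpha> t a (w, t a)"
  shows "dloc_t \<alpha> a (m \<alpha>) w t = m_z_deriv \<alpha> w t * dloc_t \<alpha> a (z \<alpha>) w t + m_t_deriv \<alpha> a (z \<alpha> (loc \<alpha> w t) t)
    + deriv (\<lambda>s. mrem \<alpha> w (t(a := s))) (t a)"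
proof -
  let ?z = "\<lambda>s. z \<alpha> (loc \<alpha> w (t(a := s))) (t(a := s))"
  define zs where "zs = dloc_t \<alpha> a (z \<alpha>) w t"
  define Hs where "Hs = deriv (\<lambda>s. mrem \<alpha> w (t(a := s))) (t a)"
  have nz: "?z (t a) \<noteq> 0"
    using z_nonzero[OF assms(1) _ dom_loc_mem[OF assms(4,1,3)]] assms(4) by (simp add: dom_def)
  have z: "(?z has_field_derivative zs) (at (t a))"
    using cdiff2_snd_deriv[OF zm_loc_cdiff2(1)[OF assms]] by (simp add: zs_def dloc_t_def)
  have H: "((\<lambda>s. mrem \<alpha> w (t(a := s))) has_field_derivative Hs) (at (t a))"
    using cdiff2_snd_deriv[OF mrem_cdiff2[OF assms]] by (simp add: Hs_def)
  have F: "((\<lambda>s. eval_fps (mreg \<alpha> t) (?z s)) has_field_derivative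
      eval_fps (fps_deriv (mreg \<alpha> t)) (?z (t a)) * zs) (at (t a))"
    by (rule DERIV_chain2[OF has_field_derivative_eval_fps z]) (simp add: mreg_radius[OF assms(1,2)])
  \<comment> \<open>Only the existence of \<open>k'\<close> matters: in the product rule it is
    multiplied by \<open>s - t a\<close>, which is 0 at \<open>s = t a\<close>.\<close>
  obtain k' where k: "((\<lambda>s. mreg_dt \<alpha> a (?z s)) has_field_derivative k') (at (t a))"
    using DERIV_chain2[OF _ z] mreg_dt_differentiable[of \<alpha> a "?z (t a)"]
    unfolding field_differentiable_def by blast
  have "((\<lambda>s. (eval_fps (mreg \<alpha> t) (?z s) + mreg_dt \<alpha> a (?z s) * (s - t a))
      + (tzero M \<alpha> t + tzero_dt \<alpha> a * (s - t a)) * inverse (?z s) + mrem \<alpha> w (t(a := s)))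
      has_field_derivative (m_z_deriv \<alpha> w t * zs + m_t_deriv \<alpha> a (z \<alpha> (loc \<alpha> w t) t) + Hs)) (at (t a))"
    using nz by (auto intro!: derivative_eq_intros F k H z
      simp: m_z_deriv_def m_t_deriv_def mreg_radius[OF assms(1,2)] power2_eq_square algebra_simps)
  also have "(\<lambda>s. (eval_fps (mreg \<alpha> t) (?z s) + mreg_dt \<alpha> a (?z s) * (s - t a))
      + (tzero M \<alpha> t + tzero_dt \<alpha> a * (s - t a)) * inverse (?z s) + mrem \<alpha> w (t(a := s)))
      = (\<lambda>s. m \<alpha> (loc \<alpha> w (t(a := s))) (t(a := s)))"
    unfolding mrem_def by (simp add: mreg_upd[OF assms(1,2)] tzero_upd[OF assms(3)] divide_inverse)
  finally show ?thesis unfolding zs_def Hs_def by (simp add: dloc_t_def DERIV_imp_deriv)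
qed

lemma m_dw_formula:
  assumes "\<alpha> \<le> M" "t \<in> T" "w \<noteq> 0" "norm w < loc_radius \<alpha> t"
  shows "dloc_w \<alpha> (m \<alpha>) w t = m_z_deriv \<alpha> w t * dloc_w \<alpha> (z \<alpha>) w t + deriv (\<lambda>w. mrem \<alpha> w t) w"
proof -
  define a :: "nat \<times> nat" where "a = (0, 1)"
  have a: "a \<in> tidx M" using zero_one_in_tidx by (simp add: a_def)
  have d: "dom \<alpha> t a (w, t a)" using assms by (simp add: dom_def)
  let ?z = "\<lambda>w. z \<alpha> (loc \<alpha> w t) t"
  define zw where "zw = dloc_w \<alpha> (z \<alpha>) w t"
  define Hw where "Hw = deriv (\<lambda>w. mrem \<alpha> w t) w"
  have nz: "?z w \<noteq> 0" using z_nonzero[OF assms(1,2) loc_mem[OF assms]] .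
  have z: "(?z has_field_derivative zw) (at w)"
    using cdiff2_fst_deriv[OF zm_loc_cdiff2(1)[OF assms(1,2) a d]] by (simp add: zw_def dloc_w_def)
  have H: "((\<lambda>w. mrem \<alpha> w t) has_field_derivative Hw) (at w)"
    using cdiff2_fst_deriv[OF mrem_cdiff2[OF assms(1,2) a d]] by (simp add: Hw_def)
  have F: "((\<lambda>w. eval_fps (mreg \<alpha> t) (?z w)) has_field_derivative
      eval_fps (fps_deriv (mreg \<alpha> t)) (?z w) * zw) (at w)"
    by (rule DERIV_chain2[OF has_field_derivative_eval_fps z]) (simp add: mreg_radius[OF assms(1,2)])
  have "((\<lambda>w. eval_fps (mreg \<alpha> t) (?z w) + tzero M \<alpha> t * inverse (?z w) + mrem \<alpha> w t)
      has_field_derivative (m_z_deriv \<alpha> w t * zw + Hw)) (at w)"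
    using nz by (auto intro!: derivative_eq_intros F H z simp: m_z_deriv_def mreg_radius[OF assms(1,2)] power2_eq_square algebra_simps)
  also have "(\<lambda>w. eval_fps (mreg \<alpha> t) (?z w) + tzero M \<alpha> t * inverse (?z w) + mrem \<alpha> w t)
      = (\<lambda>w. m \<alpha> (loc \<alpha> w t) t)"
    unfolding mrem_def by (simp add: divide_inverse)
  finally show ?thesis unfolding zw_def Hw_def by (simp add: dloc_w_def DERIV_imp_deriv)
qed

end

section \<open>Comparison with the Hamiltonians\<close>

lemma eventually_nonzero_at_0: "\<forall>\<^sub>F w in at (0::complex). w \<noteq> 0"
  by (rule eventually_neq_at_within)

lemma one_bigo_inverse_power: "(\<lambda>_. 1) \<in> O[at 0](\<lambda>w::complex. inverse w ^ n)"
proof (rule bigoI_tendsto[where c = "0 ^ n"])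
  show "((\<lambda>w::complex. 1 / inverse w ^ n) \<longlongrightarrow> 0 ^ n) (at 0)"
    by (auto simp: power_inverse divide_inverse intro!: tendsto_eq_intros)
qed (rule eventually_mono[OF eventually_nonzero_at_0], simp)

context whitham
begin

definition punctures :: "times \<Rightarrow> complex set" where "punctures t = (\<lambda>i. q i t) ` {1..M}"

lemma punctures_finite [simp]: "finite (punctures t)"
  by (simp add: punctures_def)

lemma q_neq:
  assumes "t \<in> T" "i \<le> M" "j \<le> M" "i \<noteq> 0" "j \<noteq> 0" "i \<noteq> j"
  shows "q i t \<noteq> q j t"
proof
  assume "q i t = q j t"
  from inj_onD[OF q_distinct[OF assms(1)] this] show False using assms by simp
qed

lemma Omega_expl_cdiff2:
  assumes "\<beta> \<le> M" "t \<in> T" "a \<in> tidx M" "t(a := s) \<in> T" "\<beta> = 0 \<or> p \<noteq> q \<beta> (t(a := s))"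
  shows "cdiff2 (\<lambda>x. Omega_expl \<beta> n (fst x) (t(a := snd x))) (p, s)"
proof -
  have Z: "cdiff2 (\<lambda>x. zpow_coeff \<beta> n k (t(a := snd x))) (p, s)" for k
    using assms by (intro cdiff2_fun_snd[of "\<lambda>s. zpow_coeff \<beta> n k (t(a := s))"] hol_t_differentiable zpow_coeff_hol) auto
  show ?thesis
  proof (cases "\<beta> = 0")
    case True
    have "cdiff2 (\<lambda>x. \<Sum>k\<le>n. zpow_coeff \<beta> n k (t(a := snd x)) * fst x ^ (n - k)) (p, s)"
      by (intro cdiff2_intros Z)
    thus ?thesis using True by (simp add: Omega_expl_def)
  next
    case False
    have qd: "cdiff2 (\<lambda>x. q \<beta> (t(a := snd x))) (p, s)"
      using assms False
      by (intro cdiff2_fun_snd[of "\<lambda>s. q \<beta> (t(a := s))"] hol_t_differentiable q_hol) auto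
    have "cdiff2 (\<lambda>x. \<Sum>k<n. zpow_coeff \<beta> n k (t(a := snd x)) * inverse (fst x - q \<beta> (t(a := snd x))) ^ (n - k)) (p, s)"
      using assms(5) False by (intro cdiff2_intros Z cdiff2_inverse qd) auto
    thus ?thesis using False by (simp add: Omega_expl_def)
  qed
qed

lemma eventually_loc_avoids:
  assumes "\<alpha> \<le> M" "\<beta> \<le> M" "t \<in> T" "a \<in> tidx M" "\<beta> \<noteq> 0"
  shows "\<forall>\<^sub>F x in nhds (0, t a). fst x \<noteq> 0 \<longrightarrow>
    loc \<alpha> (fst x) (t(a := snd x)) \<noteq> q \<beta> (t(a := snd x))"
proof (cases "\<beta> = \<alpha>")
  case True
  thus ?thesis using assms(5) by (simp add: loc_def)
next
  case False
  \<comment> \<open>At infinity the condition is multiplied by \<open>w\<close>, which yields a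
    function that is continuous and equal to 1 at \<open>w = 0\<close>.\<close>
  define g where "g = (\<lambda>x. if \<alpha> = 0 then 1 - fst x * q \<beta> (t(a := snd x))
      else q \<alpha> (t(a := snd x)) + fst x - q \<beta> (t(a := snd x)))"
  have qd: "cdiff2 (\<lambda>x. q i (t(a := snd x))) (0, t a)" if "i \<noteq> 0" "i \<le> M" for i
    using assms that by (intro cdiff2_fun_snd[of "\<lambda>s. q i (t(a := s))"] hol_t_differentiable q_hol) auto
  have "cdiff2 g (0, t a)"
    unfolding g_def using qd assms by (cases "\<alpha> = 0") (auto intro!: cdiff2_intros)
  hence "(g \<longlongrightarrow> g (0, t a)) (nhds (0, t a))"
    using cdiff2_isCont unfolding isCont_def tendsto_at_iff_tendsto_nhds by blast
  moreover have "g (0, t a) \<noteq> 0"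
    using q_neq[OF assms(3,1,2)] assms(5) False by (simp add: g_def)
  ultimately have "\<forall>\<^sub>F x in nhds (0, t a). g x \<in> - {0}"
    by (intro topological_tendstoD) auto
  thus ?thesis by eventually_elim (auto simp: g_def loc_def field_simps split: if_splits)
qed

lemma inverse_shift_order:
  "(\<lambda>w. inverse (inverse w - c)) \<in> O[at 0](\<lambda>w::complex. w)"
proof (rule bigoI_tendsto[where c = 1])
  have "((\<lambda>w::complex. inverse (1 - w * c)) \<longlongrightarrow> 1) (at 0)"
    by (auto intro!: tendsto_eq_intros)
  moreover have "\<forall>\<^sub>F w in at 0. inverse (1 - w * c) = inverse (inverse w - c) / w"
    by (auto simp: eventually_at_filter field_simps)
  ultimately show "((\<lambda>w. inverse (inverse w - c) / w) \<longlongrightarrow> 1) (at 0)"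
    by (rule Lim_transform_eventually)
qed (auto simp: eventually_at_filter)

text \<open>At its own puncture this is \<open>Omega_expl_order\<close>. At another finite puncture
  the Hamiltonian is holomorphic, hence bounded. At infinity, a Hamiltonian of a finite puncture is
  a polynomial without constant term in \<open>1/(p - q \<beta> t)\<close>, hence
  \<open>O(w)\<close>.\<close>

lemma zpow_minus_Omega_order:
  assumes "\<alpha> \<le> M" "\<beta> \<le> M" "t \<in> T"
  shows "(\<lambda>w. (if \<beta> = \<alpha> then z \<alpha> (loc \<alpha> w t) t ^ n else 0) - Omega_expl \<beta> n (loc \<alpha> w t) t)
    \<in> O[at 0](\<lambda>w. w ^ contact_order \<alpha>)"
proof -
  consider "\<beta> = \<alpha>" | "\<beta> \<noteq> \<alpha>" "\<alpha> \<noteq> 0" | "\<beta> \<noteq> \<alpha>" "\<alpha> = 0" by blast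
  thus ?thesis
  proof cases
    case 1
    thus ?thesis using Omega_expl_order[OF assms(1,3)] by simp
  next
    case 2
    have "\<beta> = 0 \<or> q \<alpha> t \<noteq> q \<beta> t"
      using q_neq[OF assms(3,1,2)] 2 by auto
    hence "cdiff2 (\<lambda>x. Omega_expl \<beta> n (fst x) (t((0, 1) := snd x))) (q \<alpha> t, t (0, 1))"
      using assms zero_one_in_tidx by (intro Omega_expl_cdiff2) auto
    from cdiff2_fst_deriv[OF this] have "isCont (\<lambda>p. Omega_expl \<beta> n p t) (q \<alpha> t)"
      by (simp add: DERIV_isCont)
    hence "isCont (\<lambda>w. Omega_expl \<beta> n (q \<alpha> t + w) t) 0"
      by (intro isCont_o2[of 0 "\<lambda>w. q \<alpha> t + w" "\<lambda>p. Omega_expl \<beta> n p t"]) auto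
    hence "(\<lambda>w. Omega_expl \<beta> n (q \<alpha> t + w) t) \<in> O[at 0](\<lambda>_. 1)" by (rule continuous_imp_bigo_1)
    thus ?thesis using 2 by (simp add: loc_def contact_order_def)
  next
    case 3
    let ?x = "\<lambda>w. inverse (inverse w - q \<beta> t)"
    have "(\<lambda>w. \<Sum>k<n. zpow_coeff \<beta> n k t * ?x w ^ (n - k)) \<in> O[at 0](\<lambda>w. w)"
    proof (rule big_sum_in_bigo)
      fix k assume k: "k \<in> {..<n}"
      have "(\<lambda>w. ?x w ^ (n - k)) \<in> O[at 0](\<lambda>w. w ^ (n - k))"
        by (intro landau_o.big_power inverse_shift_order)
      also obtain j where j: "n - k = Suc j" using k by (metis Suc_diff_Suc lessThan_iff)
      have "(\<lambda>w. w * w ^ j) \<in> O[at 0](\<lambda>w::complex. w * 1)"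
        by (intro landau_o.big.mult continuous_imp_bigo_1) auto
      hence "(\<lambda>w. w ^ (n - k)) \<in> O[at 0](\<lambda>w::complex. w)" by (simp add: j)
      finally show "(\<lambda>w. zpow_coeff \<beta> n k t * ?x w ^ (n - k)) \<in> O[at 0](\<lambda>w. w)" by simp
    qed
    thus ?thesis using 3 by (simp add: loc_def contact_order_def Omega_expl_def)
  qed
qed

text \<open>For \<open>n \<ge> 1\<close> the principal part of \<open>z\<^sub>\<alpha>\<^sup>n\<close> is \<open>\<Omega>\<^sub>\<alpha>\<^sub>n\<close>; being an identity up to
  \<open>O(w)\<close> at infinity and \<open>O(1)\<close> at \<open>q\<^sub>i\<close> for every time, it may be differentiated.\<close>

lemma zpow_minus_Omega_deriv_order:
  assumes "\<alpha> \<le> M" "\<beta> \<le> M" "t \<in> T" "a \<in> tidx M"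
  shows "(\<lambda>w. mreg_dt \<alpha> (\<beta>, n) (z \<alpha> (loc \<alpha> w t) t) * dloc_t \<alpha> a (z \<alpha>) w t - dloc_t \<alpha> a (Omega_expl \<beta> n) w t)
      \<in> O[at 0](\<lambda>w. w ^ contact_order \<alpha>)" (is ?A)
    and "(\<lambda>w. mreg_dt \<alpha> (\<beta>, n) (z \<alpha> (loc \<alpha> w t) t) * dloc_w \<alpha> (z \<alpha>) w t - dloc_w \<alpha> (Omega_expl \<beta> n) w t)
      \<in> O[at 0](\<lambda>_. 1)" (is ?B)
    and "\<forall>\<^sub>F w in at 0. w \<noteq> 0 \<and>
      cdiff2 (\<lambda>x. Omega_expl \<beta> n (fst x) (t(a := snd x))) (loc \<alpha> w t, t a)" (is ?C)
proof -
  let ?z = "\<lambda>x. z \<alpha> (loc \<alpha> (fst x) (t(a := snd x))) (t(a := snd x))"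
  let ?O = "\<lambda>x. Omega_expl \<beta> n (loc \<alpha> (fst x) (t(a := snd x))) (t(a := snd x))"
  define f where "f = (\<lambda>x. (if \<beta> = \<alpha> then ?z x ^ n else 0) - ?O x)"
  have av: "\<forall>\<^sub>F x in nhds (0, t a). fst x \<noteq> 0 \<longrightarrow>
      \<beta> = 0 \<or> loc \<alpha> (fst x) (t(a := snd x)) \<noteq> q \<beta> (t(a := snd x))"
    using eventually_loc_avoids[OF assms] by (cases "\<beta> = 0") auto
  have ev: "\<forall>\<^sub>F x in nhds (0, t a). fst x \<noteq> 0 \<longrightarrow>
      cdiff2 (\<lambda>x. Omega_expl \<beta> n (fst x) (t(a := snd x))) (loc \<alpha> (fst x) (t(a := snd x)), snd x)
      \<and> cdiff2 ?z x \<and> cdiff2 ?O x"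
    using av eventually_dom[OF assms(1,3,4)]
  proof eventually_elim
    case (elim x)
    show ?case
    proof
      assume x: "fst x \<noteq> 0"
      hence d: "dom \<alpha> t a (fst x, snd x)" using elim by simp
      have O: "cdiff2 (\<lambda>x. Omega_expl \<beta> n (fst x) (t(a := snd x))) (loc \<alpha> (fst x) (t(a := snd x)), snd x)"
        using elim x d assms by (intro Omega_expl_cdiff2) (auto simp: dom_def)
      moreover have "cdiff2 ?O (fst x, snd x)"
        using d by (intro pullback_cdiff2[where f = "Omega_expl \<beta> n"] assms x O) (simp add: dom_def)
      moreover have "cdiff2 ?z (fst x, snd x)" by (rule zm_loc_cdiff2(1)[OF assms(1,3,4) d])
      ultimately show "cdiff2 (\<lambda>x. Omega_expl \<beta> n (fst x) (t(a := snd x))) (loc \<alpha> (fst x) (t(a := snd x)), snd x)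
        \<and> cdiff2 ?z x \<and> cdiff2 ?O x" by simp
    qed
  qed
  have evf: "\<forall>\<^sub>F x in nhds (0, t a). fst x \<noteq> 0 \<longrightarrow> cdiff2 f x"
    using ev
  proof eventually_elim
    case (elim x)
    have "cdiff2 (\<lambda>x. if \<beta> = \<alpha> then ?z x ^ n else 0) x" if "fst x \<noteq> 0"
      using elim that by (cases "\<beta> = \<alpha>") (simp_all add: cdiff2_power)
    hence "cdiff2 f x" if "fst x \<noteq> 0"
      using elim that unfolding f_def by (intro cdiff2_diff) simp_all
    thus ?case by blast
  qed
  have ev0: "\<forall>\<^sub>F w in at 0. w \<noteq> 0 \<and>
      cdiff2 (\<lambda>x. Omega_expl \<beta> n (fst x) (t(a := snd x))) (loc \<alpha> w t, t a)
      \<and> cdiff2 ?z (w, t a) \<and> cdiff2 ?O (w, t a)"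
    using eventually_at_of_nhds_pair[OF ev] by simp
  thus ?C by eventually_elim auto
  have "(\<lambda>w. deriv (\<lambda>s. f (w, s)) (t a)) \<in> O[at 0](\<lambda>w. w ^ contact_order \<alpha>)"
  proof (rule bigo_param_deriv[OF evf])
    show "\<forall>\<^sub>F s in nhds (t a). (\<lambda>w. f (w, s)) \<in> O[at 0](\<lambda>w. w ^ contact_order \<alpha>)"
      using eventually_T[OF assms(3,4)] unfolding f_def fst_conv snd_conv
      by eventually_elim (rule zpow_minus_Omega_order[OF assms(1,2)])
  qed (auto intro!: holomorphic_intros)
  moreover have "\<forall>\<^sub>F w in at 0. deriv (\<lambda>s. f (w, s)) (t a)
      = mreg_dt \<alpha> (\<beta>, n) (z \<alpha> (loc \<alpha> w t) t) * dloc_t \<alpha> a (z \<alpha>) w t - dloc_t \<alpha> a (Omega_expl \<beta> n) w t"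
    using ev0
  proof eventually_elim
    case (elim w)
    have "((\<lambda>s. ?z (w, s)) has_field_derivative dloc_t \<alpha> a (z \<alpha>) w t) (at (t a))"
      "((\<lambda>s. ?O (w, s)) has_field_derivative dloc_t \<alpha> a (Omega_expl \<beta> n) w t) (at (t a))"
      using elim cdiff2_snd_deriv[of ?z w "t a"] cdiff2_snd_deriv[of ?O w "t a"]
      by (simp_all add: dloc_t_def)
    hence "((\<lambda>s. f (w, s)) has_field_derivative
        (mreg_dt \<alpha> (\<beta>, n) (z \<alpha> (loc \<alpha> w t) t) * dloc_t \<alpha> a (z \<alpha>) w t - dloc_t \<alpha> a (Omega_expl \<beta> n) w t)) (at (t a))"
      unfolding f_def mreg_dt_def by (cases "\<beta> = \<alpha>") (auto intro!: derivative_eq_intros)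
    thus ?case by (rule DERIV_imp_deriv)
  qed
  ultimately show ?A by (subst (asm) landau_o.big.in_cong)
  have dw: "\<forall>\<^sub>F w in at 0. ((\<lambda>w. f (w, t a)) has_field_derivative
        (mreg_dt \<alpha> (\<beta>, n) (z \<alpha> (loc \<alpha> w t) t) * dloc_w \<alpha> (z \<alpha>) w t - dloc_w \<alpha> (Omega_expl \<beta> n) w t)) (at w)"
    using ev0
  proof eventually_elim
    case (elim w)
    have "((\<lambda>w. ?z (w, t a)) has_field_derivative dloc_w \<alpha> (z \<alpha>) w t) (at w)"
      "((\<lambda>w. ?O (w, t a)) has_field_derivative dloc_w \<alpha> (Omega_expl \<beta> n) w t) (at w)"
      using elim cdiff2_fst_deriv[of ?z w "t a"] cdiff2_fst_deriv[of ?O w "t a"]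
      by (simp_all add: dloc_w_def)
    thus ?case
      unfolding f_def mreg_dt_def by (cases "\<beta> = \<alpha>") (auto intro!: derivative_eq_intros)
  qed
  have "deriv (\<lambda>w. f (w, t a)) \<in> O[at 0](\<lambda>w. w ^ (contact_order \<alpha> - 1))"
  proof (rule bigo_deriv_power)
    show "\<forall>\<^sub>F w in at 0. (\<lambda>w. f (w, t a)) field_differentiable at w"
      using dw by eventually_elim (auto simp: field_differentiable_def)
    show "(\<lambda>w. f (w, t a)) \<in> O[at 0](\<lambda>w. w ^ contact_order \<alpha>)"
      unfolding f_def fst_conv snd_conv fun_upd_triv by (rule zpow_minus_Omega_order[OF assms(1-3)])
  qed
  \<comment> \<open>On natural numbers both \<open>1 - 1\<close> and \<open>0 - 1\<close> are 0, so
    the bound is \<open>O(1)\<close> at every puncture.\<close>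
  hence "deriv (\<lambda>w. f (w, t a)) \<in> O[at 0](\<lambda>w. 1)" by (simp add: contact_order_def split: if_splits)
  moreover have "\<forall>\<^sub>F w in at 0. deriv (\<lambda>w. f (w, t a)) w =
      mreg_dt \<alpha> (\<beta>, n) (z \<alpha> (loc \<alpha> w t) t) * dloc_w \<alpha> (z \<alpha>) w t - dloc_w \<alpha> (Omega_expl \<beta> n) w t"
    using dw by eventually_elim (rule DERIV_imp_deriv)
  ultimately show ?B by (subst (asm) landau_o.big.in_cong)
qed

text \<open>The derivatives of \<open>\<Omega>\<^sub>b\<close>; for \<open>b = (i, 0)\<close> they do not depend on the branch of the logarithm.\<close>

definition dOmega :: "coord \<Rightarrow> nat \<times> nat \<Rightarrow> pt_fun" where
  "dOmega c b p t = (if snd b = 0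
     then (case c of Cp \<Rightarrow> - 1 | Ct a \<Rightarrow> deriv (\<lambda>s. q (fst b) (t(a := s))) (t a))
       * inverse (p - q (fst b) t)
     else pd c (Omega_expl (fst b) (snd b)) p t)"

text \<open>Time derivative of the Hamiltonian at fixed \<open>w\<close>, written with the transport
  term so that it covers the logarithms without reference to a branch.\<close>

definition dOmega_loc :: "nat \<Rightarrow> nat \<times> nat \<Rightarrow> nat \<times> nat \<Rightarrow> complex \<Rightarrow> times \<Rightarrow> complex" where
  "dOmega_loc \<alpha> a b w t = dOmega (Ct a) b (loc \<alpha> w t) t + loc_dt \<alpha> a t * dOmega Cp b (loc \<alpha> w t) t"

lemma z_log_dt_order:
  assumes "\<alpha> \<le> M" "t \<in> T" "a \<in> tidx M"
  shows "(\<lambda>w. inverse (z \<alpha> (loc \<alpha> w t) t) * dloc_t \<alpha> a (z \<alpha>) w t) \<in> O[at 0](\<lambda>w. w ^ contact_order \<alpha>)"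
proof -
  have "(\<lambda>w. inverse (z \<alpha> (loc \<alpha> w t) t) * dloc_t \<alpha> a (z \<alpha>) w t) \<in> O[at 0](\<lambda>w. w * (w ^ contact_order \<alpha> / w))"
    by (intro landau_o.big.mult inverse_z_tendsto z_dt_order assms)
  also have "\<forall>\<^sub>F w in at (0::complex). w * (w ^ contact_order \<alpha> / w) = w ^ contact_order \<alpha>"
    by (simp add: eventually_at_filter)
  hence "O[at 0](\<lambda>w. w * (w ^ contact_order \<alpha> / w)) = O[at 0](\<lambda>w::complex. w ^ contact_order \<alpha>)"
    by (rule landau_o.big.cong)
  finally show ?thesis .
qed

lemma inverse_q_order:
  assumes "\<alpha> \<le> M" "t \<in> T" "i \<in> {1..M}" "i \<noteq> \<alpha>"
  shows "(\<lambda>w. inverse (loc \<alpha> w t - q i t)) \<in> O[at 0](\<lambda>w. w ^ contact_order \<alpha>)"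
proof (cases "\<alpha> = 0")
  case True
  thus ?thesis using inverse_shift_order by (simp add: loc_def contact_order_def)
next
  case False
  have "q \<alpha> t - q i t \<noteq> 0"
    using q_neq[OF assms(2,1), of i] assms(3,4) False by simp
  hence "isCont (\<lambda>w. inverse (q \<alpha> t + w - q i t)) 0" by (intro continuous_intros) auto
  hence "(\<lambda>w. inverse (q \<alpha> t + w - q i t)) \<in> O[at 0](\<lambda>_. 1)" by (rule continuous_imp_bigo_1)
  thus ?thesis using False by (simp add: loc_def contact_order_def)
qed

text \<open>For \<open>snd b \<noteq> 0\<close> this is the differentiated principal part. For a
  logarithm the two terms are small separately: the logarithmic time derivative of \<open>z\<close>
  has the required order, and away from its own puncture the Hamiltonian contributes a constant
  times \<open>1/(p - q i t)\<close>.\<close>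

lemma dOmega_dt_order:
  assumes "\<alpha> \<le> M" "t \<in> T" "a \<in> tidx M" "b \<in> tidx M"
  shows "(\<lambda>w. m_t_deriv \<alpha> b (z \<alpha> (loc \<alpha> w t) t) * dloc_t \<alpha> a (z \<alpha>) w t - dOmega_loc \<alpha> a b w t)
    \<in> O[at 0](\<lambda>w. w ^ contact_order \<alpha>)"
proof (cases "snd b = 0")
  case False
  have b: "fst b \<le> M" using assms(4) by (auto simp: tidx_def)
  have "\<forall>\<^sub>F w in at 0. dloc_t \<alpha> a (Omega_expl (fst b) (snd b)) w t = dOmega_loc \<alpha> a b w t"
    using zpow_minus_Omega_deriv_order(3)[OF assms(1) b assms(2,3), of "snd b"]
    by eventually_elim (use False in \<open>simp add: dsl_chain[OF assms(1-3)] dOmega_loc_def dOmega_def\<close>)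
  hence "\<forall>\<^sub>F w in at 0. mreg_dt \<alpha> b (z \<alpha> (loc \<alpha> w t) t) * dloc_t \<alpha> a (z \<alpha>) w t - dloc_t \<alpha> a (Omega_expl (fst b) (snd b)) w t
      = m_t_deriv \<alpha> b (z \<alpha> (loc \<alpha> w t) t) * dloc_t \<alpha> a (z \<alpha>) w t - dOmega_loc \<alpha> a b w t"
    by eventually_elim (use False in \<open>simp add: m_t_deriv_def tzero_dt_def\<close>)
  with zpow_minus_Omega_deriv_order(1)[OF assms(1) b assms(2,3), of "snd b"] show ?thesis
    by (simp only: prod.collapse) (subst (asm) landau_o.big.in_cong)
next
  case True
  then obtain i where b: "b = (i, 0)" and i: "i \<in> {1..M}" using assms(4) by (cases b) (auto simp: tidx_def)
  note zz = z_log_dt_order[OF assms(1-3)]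
  consider "i = \<alpha>" | "i \<noteq> \<alpha>" by blast
  thus ?thesis
  proof cases
    case 1
    \<comment> \<open>At its own puncture the Hamiltonian is \<open>-log w\<close>, which at fixed
      \<open>w\<close> does not change with the times.\<close>
    hence "dOmega_loc \<alpha> a b w t = 0" for w
      using i by (simp add: dOmega_loc_def dOmega_def b loc_dt_def loc_def)
    thus ?thesis using zz 1 i by (simp add: m_t_deriv_def mreg_dt_def tzero_dt_def b)
  next
    case 2
    define c where "c = deriv (\<lambda>s. q i (t(a := s))) (t a) - loc_dt \<alpha> a t"
    have dO: "dOmega_loc \<alpha> a b w t = c * inverse (loc \<alpha> w t - q i t)" for w
      by (simp add: dOmega_loc_def dOmega_def b c_def algebra_simps)
    have "(\<lambda>w. c * inverse (loc \<alpha> w t - q i t)) \<in> O[at 0](\<lambda>w. w ^ contact_order \<alpha>)"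
      using inverse_q_order[OF assms(1,2) i 2] by simp
    moreover have "(\<lambda>w. m_t_deriv \<alpha> b (z \<alpha> (loc \<alpha> w t) t) * dloc_t \<alpha> a (z \<alpha>) w t) \<in> O[at 0](\<lambda>w. w ^ contact_order \<alpha>)"
      using zz 2 by (cases "\<alpha> = 0") (simp_all add: m_t_deriv_def mreg_dt_def tzero_dt_def b)
    ultimately show ?thesis unfolding dO by (intro sum_in_bigo)
  qed
qed

text \<open>At infinity \<open>O(1/w)\<close> is enough: this is a coefficient of \<open>dw\<close>,
  and passing to \<open>dp\<close> divides it by \<open>-1/w^2\<close>.\<close>

lemma dOmega_dw_order:
  assumes "\<alpha> \<le> M" "t \<in> T" "b \<in> tidx M"
  shows "(\<lambda>w. m_t_deriv \<alpha> b (z \<alpha> (loc \<alpha> w t) t) * dloc_w \<alpha> (z \<alpha>) w t - loc_dw \<alpha> w * dOmega Cp b (loc \<alpha> w t) t)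
    \<in> O[at 0](\<lambda>w. inverse w ^ contact_order \<alpha>)"
proof -
  note one = one_bigo_inverse_power[of "contact_order \<alpha>"]
  show ?thesis
  proof (cases "snd b = 0")
    case False
    have b: "fst b \<le> M" using assms(3) by (auto simp: tidx_def)
    have "\<forall>\<^sub>F w in at 0. dloc_w \<alpha> (Omega_expl (fst b) (snd b)) w t = loc_dw \<alpha> w * dOmega Cp b (loc \<alpha> w t) t"
      using zpow_minus_Omega_deriv_order(3)[OF assms(1) b assms(2) zero_one_in_tidx, of "snd b"]
    proof eventually_elim
      case (elim w)
      thus ?case using dwl_chain[of w "Omega_expl (fst b) (snd b)" t "(0, 1)" \<alpha>] False by (simp add: dOmega_def)
    qed
    hence "\<forall>\<^sub>F w in at 0. mreg_dt \<alpha> b (z \<alpha> (loc \<alpha> w t) t) * dloc_w \<alpha> (z \<alpha>) w t - dloc_w \<alpha> (Omega_expl (fst b) (snd b)) w t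
        = m_t_deriv \<alpha> b (z \<alpha> (loc \<alpha> w t) t) * dloc_w \<alpha> (z \<alpha>) w t - loc_dw \<alpha> w * dOmega Cp b (loc \<alpha> w t) t"
      by eventually_elim (use False in \<open>simp add: m_t_deriv_def tzero_dt_def\<close>)
    with zpow_minus_Omega_deriv_order(2)[OF assms(1) b assms(2) zero_one_in_tidx, of "snd b"]
    have "(\<lambda>w. m_t_deriv \<alpha> b (z \<alpha> (loc \<alpha> w t) t) * dloc_w \<alpha> (z \<alpha>) w t - loc_dw \<alpha> w * dOmega Cp b (loc \<alpha> w t) t)
        \<in> O[at 0](\<lambda>_. 1)"
      by (simp only: prod.collapse) (subst (asm) landau_o.big.in_cong)
    also note one
    finally show ?thesis .
  next
    case True
    then obtain i where b: "b = (i, 0)" and i: "i \<in> {1..M}" using assms(3) by (cases b) (auto simp: tidx_def)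
    note zz = z_dw_order(2)[OF assms(1,2)]
    consider "i = \<alpha>" | "i \<noteq> \<alpha>" "\<alpha> \<noteq> 0" | "\<alpha> = 0" by blast
    thus ?thesis
    proof cases
      \<comment> \<open>Both terms are \<open>-1/w\<close> up to a bounded function, by the
        logarithmic derivative of \<open>z\<close> and by that of \<open>w\<close>.\<close>
      case 1
      thus ?thesis using zz i
        by (simp add: m_t_deriv_def mreg_dt_def tzero_dt_def b dOmega_def loc_dw_def loc_def contact_order_def divide_inverse mult.commute)
    next
      case 2
      thus ?thesis using inverse_q_order[OF assms(1,2) i] 
        by (simp add: m_t_deriv_def mreg_dt_def tzero_dt_def b dOmega_def loc_dw_def contact_order_def)
    next
      \<comment> \<open>Here \<open>tzero_dt\<close> is -1, from the minus sign in the definition of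
        \<open>tzero\<close> at infinity. Each of the two terms is \<open>O(1/w)\<close>.\<close>
      case 3
      have "(\<lambda>_. 1) \<in> O[at 0](\<lambda>w::complex. 1 / w)"
        using one 3 by (simp add: contact_order_def divide_inverse)
      from landau_o.big_trans[OF zz this]
      have a: "(\<lambda>w. 1 / w - (dloc_w \<alpha> (z \<alpha>) w t * inverse (z \<alpha> (loc \<alpha> w t) t) + 1 / w)) \<in> O[at 0](\<lambda>w. 1 / w)"
        by (intro sum_in_bigo(2)) auto
      have "(\<lambda>w. inverse w ^ 2 * inverse (inverse w - q i t)) \<in> O[at 0](\<lambda>w. inverse w ^ 2 * w)"
        by (intro landau_o.big.mult inverse_shift_order) auto
      also have "\<forall>\<^sub>F w in at (0::complex). inverse w ^ 2 * w = 1 / w"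
        by (simp add: eventually_at_filter power2_eq_square divide_inverse)
      hence "O[at 0](\<lambda>w. inverse w ^ 2 * w) = O[at 0](\<lambda>w::complex. 1 / w)"
        by (rule landau_o.big.cong)
      finally have c: "(\<lambda>w. inverse w ^ 2 * inverse (inverse w - q i t)) \<in> O[at 0](\<lambda>w. 1 / w)" .
      from sum_in_bigo(2)[OF a c] show ?thesis using 3 i
        by (simp add: m_t_deriv_def mreg_dt_def tzero_dt_def b dOmega_def loc_dw_def contact_order_def loc_def divide_inverse mult.commute)
    qed
  qed
qed

section \<open>Orders of the coefficients of the two-forms\<close>

abbreviation zm_form :: "nat \<Rightarrow> coord \<Rightarrow> coord \<Rightarrow> pt_fun" where
  "zm_form \<alpha> \<equiv> wedge (d_fun (z \<alpha>)) (d_fun (m \<alpha>))"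

lemma z_dt_mrem_order:
  assumes "\<alpha> \<le> M" "t \<in> T" "a \<in> tidx M" "b \<in> tidx M"
  shows "(\<lambda>w. dloc_t \<alpha> a (z \<alpha>) w t * deriv (\<lambda>s. mrem \<alpha> w (t(b := s))) (t b)) \<in> O[at 0](\<lambda>w. w ^ contact_order \<alpha>)"
proof -
  have "(\<lambda>w. dloc_t \<alpha> a (z \<alpha>) w t * deriv (\<lambda>s. mrem \<alpha> w (t(b := s))) (t b)) \<in> O[at 0](\<lambda>w. w ^ contact_order \<alpha> / w * w ^ 2)"
    by (intro landau_o.big.mult z_dt_order mrem_dt_order assms)
  also have "(\<lambda>w. w ^ contact_order \<alpha> / w * w ^ 2) \<in> O[at 0](\<lambda>w::complex. w ^ contact_order \<alpha>)"
  proof (rule bigoI_tendsto[where c = 0])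
    have "\<forall>\<^sub>F w in at (0::complex). w = w ^ contact_order \<alpha> / w * w ^ 2 / w ^ contact_order \<alpha>"
      by (simp add: eventually_at_filter power2_eq_square)
    thus "((\<lambda>w::complex. w ^ contact_order \<alpha> / w * w ^ 2 / w ^ contact_order \<alpha>) \<longlongrightarrow> 0) (at 0)"
      by (rule Lim_transform_eventually[OF tendsto_ident_at])
  qed (rule eventually_mono[OF eventually_nonzero_at_0], simp)
  finally show ?thesis .
qed

lemma zm_cdiff2_loc:
  assumes "\<alpha> \<le> M" "t \<in> T" "a \<in> tidx M" "w \<noteq> 0" "norm w < loc_radius \<alpha> t"
  shows "cdiff2 (\<lambda>x. z \<alpha> (fst x) (t(a := snd x))) (loc \<alpha> w t, t a)"
    and "cdiff2 (\<lambda>x. m \<alpha> (fst x) (t(a := snd x))) (loc \<alpha> w t, t a)"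
  using zm_cdiff2[OF assms(1,3), of "loc \<alpha> w t" t "t a"] loc_mem[OF assms(1,2,4,5)] assms(2) by auto

text \<open>The coefficient of \<open>dw \<and> dt\<close> is \<open>loc_dw\<close> times that of
  \<open>dp \<and> dt\<close>, since the transport terms cancel by antisymmetry. Beside the
  Hamiltonian only products with derivatives of \<open>mrem\<close> remain.\<close>

lemma wedge_pt_order:
  assumes "\<alpha> \<le> M" "t \<in> T" "a \<in> tidx M"
  shows "(\<lambda>w. zm_form \<alpha> Cp (Ct a) (loc \<alpha> w t) t - dOmega Cp a (loc \<alpha> w t) t) \<in> O[at 0](\<lambda>w. w ^ contact_order \<alpha>)"
proof -
  note one = one_bigo_inverse_power[of "contact_order \<alpha>"]
  let ?z = "\<lambda>w. z \<alpha> (loc \<alpha> w t) t"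
  let ?zw = "\<lambda>w. dloc_w \<alpha> (z \<alpha>) w t" and ?zs = "\<lambda>w. dloc_t \<alpha> a (z \<alpha>) w t"
  let ?Hs = "\<lambda>w. deriv (\<lambda>s. mrem \<alpha> w (t(a := s))) (t a)" and ?Hw = "\<lambda>w. deriv (\<lambda>w. mrem \<alpha> w t) w"
  have "(\<lambda>w. ?zw w * ?Hs w) \<in> O[at 0](\<lambda>w. 1 / w ^ 2 * w ^ 2)"
    by (intro landau_o.big.mult z_dw_order mrem_dt_order assms)
  also have "(\<lambda>w. 1 / w ^ 2 * w ^ 2) \<in> O[at 0](\<lambda>w::complex. 1)"
    by (rule bigoI[of _ 1]) (auto simp: eventually_at_filter)
  finally have 1: "(\<lambda>w. ?zw w * ?Hs w) \<in> O[at 0](\<lambda>w. inverse w ^ contact_order \<alpha>)"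
    using one landau_o.big_trans by blast
  have "(\<lambda>w. ?zs w * ?Hw w) \<in> O[at 0](\<lambda>w. w ^ contact_order \<alpha> / w * w)"
    by (intro landau_o.big.mult z_dt_order mrem_dw_order assms)
  also have "(\<lambda>w. w ^ contact_order \<alpha> / w * w) \<in> O[at 0](\<lambda>w::complex. 1)"
  proof -
    have "\<forall>\<^sub>F w in at (0::complex). w ^ contact_order \<alpha> / w * w = w ^ contact_order \<alpha>" by (simp add: eventually_at_filter)
    moreover have "(\<lambda>w::complex. w ^ contact_order \<alpha>) \<in> O[at 0](\<lambda>w. 1)"
      by (intro continuous_imp_bigo_1 continuous_intros)
    ultimately show ?thesis by (subst landau_o.big.in_cong)
  qed
  finally have 2: "(\<lambda>w. ?zs w * ?Hw w) \<in> O[at 0](\<lambda>w. inverse w ^ contact_order \<alpha>)"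
    using one landau_o.big_trans by blast
  have ev: "\<forall>\<^sub>F w in at 0. zm_form \<alpha> Cp (Ct a) (loc \<alpha> w t) t - dOmega Cp a (loc \<alpha> w t) t = inverse (loc_dw \<alpha> w) *
      ((m_t_deriv \<alpha> a (?z w) * ?zw w - loc_dw \<alpha> w * dOmega Cp a (loc \<alpha> w t) t) + ?zw w * ?Hs w - ?zs w * ?Hw w)"
    using eventually_loc_radius[OF assms(1,2)] eventually_at_dom[OF assms]
  proof eventually_elim
    case (elim w)
    have w: "w \<noteq> 0" "norm w < loc_radius \<alpha> t" using elim by auto
    note c = zm_cdiff2_loc[OF assms w]
    have j: "loc_dw \<alpha> w \<noteq> 0" using w by (simp add: loc_dw_def)
    have "loc_dw \<alpha> w * zm_form \<alpha> Cp (Ct a) (loc \<alpha> w t) t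
        = ?zw w * dloc_t \<alpha> a (m \<alpha>) w t - ?zs w * dloc_w \<alpha> (m \<alpha>) w t"
      unfolding dsl_chain[OF assms c(1)] dsl_chain[OF assms c(2)] dwl_chain[OF w(1) c(1)]
        dwl_chain[OF w(1) c(2)] wedge_def d_fun_def by (simp add: algebra_simps)
    also have "\<dots> = m_t_deriv \<alpha> a (?z w) * ?zw w + ?zw w * ?Hs w - ?zs w * ?Hw w"
      unfolding m_dt_formula[OF assms elim(2)] m_dw_formula[OF assms(1,2) w] by (simp add: algebra_simps)
    finally have "loc_dw \<alpha> w * (zm_form \<alpha> Cp (Ct a) (loc \<alpha> w t) t - dOmega Cp a (loc \<alpha> w t) t) =
      (m_t_deriv \<alpha> a (?z w) * ?zw w - loc_dw \<alpha> w * dOmega Cp a (loc \<alpha> w t) t) + ?zw w * ?Hs w - ?zs w * ?Hw w"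
      by (simp add: algebra_simps)
    thus ?case using j by (metis (no_types, lifting) left_inverse mult.assoc mult.left_neutral)
  qed
  \<comment> \<open>The reciprocal of \<open>loc_dw\<close> is \<open>-w^2\<close> at infinity and 1
    elsewhere, whence the exponent. Against the bound
    \<open>inverse w ^ contact_order \<alpha>\<close> for the second factor this leaves
    \<open>w ^ contact_order \<alpha>\<close>.\<close>
  have "(\<lambda>w. inverse (loc_dw \<alpha> w)) \<in> O[at 0](\<lambda>w. w ^ (2 * contact_order \<alpha>))"
    by (cases "\<alpha> = 0") (simp_all add: loc_dw_def contact_order_def power_inverse)
  from landau_o.big.mult[OF this sum_in_bigo(2)[OF sum_in_bigo(1)[OF dOmega_dw_order[OF assms] 1] 2]]
  have "(\<lambda>w. inverse (loc_dw \<alpha> w) *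
      ((m_t_deriv \<alpha> a (?z w) * ?zw w - loc_dw \<alpha> w * dOmega Cp a (loc \<alpha> w t) t) + ?zw w * ?Hs w - ?zs w * ?Hw w))
      \<in> O[at 0](\<lambda>w. w ^ (2 * contact_order \<alpha>) * inverse w ^ contact_order \<alpha>)" .
  also have "\<forall>\<^sub>F w in at (0::complex). w ^ (2 * contact_order \<alpha>) * inverse w ^ contact_order \<alpha> = w ^ contact_order \<alpha>"
    by (auto simp: eventually_at_filter contact_order_def power2_eq_square)
  hence "O[at 0](\<lambda>w::complex. w ^ (2 * contact_order \<alpha>) * inverse w ^ contact_order \<alpha>) = O[at 0](\<lambda>w. w ^ contact_order \<alpha>)"
    by (rule landau_o.big.cong)
  finally show ?thesis by (subst landau_o.big.in_cong[OF ev])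
qed

text \<open>Rewriting the time derivatives at fixed \<open>w\<close> through those at fixed
  \<open>p\<close> adds, to the \<open>dt \<and> dt\<close> coefficient, velocities of the puncture
  times \<open>dp \<and> dt\<close> coefficients. The last two summands are these corrections; they
  vanish once the \<open>dp \<and> dt\<close> coefficients are identified.\<close>

lemma wedge_tt_order:
  assumes "\<alpha> \<le> M" "t \<in> T" "a \<in> tidx M" "b \<in> tidx M"
  shows "(\<lambda>w. (zm_form \<alpha> (Ct a) (Ct b) (loc \<alpha> w t) t - (dOmega (Ct a) b (loc \<alpha> w t) t - dOmega (Ct b) a (loc \<alpha> w t) t))
      + loc_dt \<alpha> a t * (zm_form \<alpha> Cp (Ct b) (loc \<alpha> w t) t - dOmega Cp b (loc \<alpha> w t) t)
      - loc_dt \<alpha> b t * (zm_form \<alpha> Cp (Ct a) (loc \<alpha> w t) t - dOmega Cp a (loc \<alpha> w t) t)) \<in> O[at 0](\<lambda>w. w ^ contact_order \<alpha>)"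
proof -
  let ?z = "\<lambda>w. z \<alpha> (loc \<alpha> w t) t"
  let ?zs = "\<lambda>a w. dloc_t \<alpha> a (z \<alpha>) w t" and ?Hs = "\<lambda>a w. deriv (\<lambda>s. mrem \<alpha> w (t(a := s))) (t a)"
  have ev: "\<forall>\<^sub>F w in at 0. (zm_form \<alpha> (Ct a) (Ct b) (loc \<alpha> w t) t - (dOmega (Ct a) b (loc \<alpha> w t) t - dOmega (Ct b) a (loc \<alpha> w t) t))
      + loc_dt \<alpha> a t * (zm_form \<alpha> Cp (Ct b) (loc \<alpha> w t) t - dOmega Cp b (loc \<alpha> w t) t)
      - loc_dt \<alpha> b t * (zm_form \<alpha> Cp (Ct a) (loc \<alpha> w t) t - dOmega Cp a (loc \<alpha> w t) t)
    = (m_t_deriv \<alpha> b (?z w) * ?zs a w - dOmega_loc \<alpha> a b w t) - (m_t_deriv \<alpha> a (?z w) * ?zs b w - dOmega_loc \<alpha> b a w t)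
      + ?zs a w * ?Hs b w - ?zs b w * ?Hs a w"
    using eventually_loc_radius[OF assms(1,2)] eventually_at_dom[OF assms(1-3)] eventually_at_dom[OF assms(1,2,4)]
  proof eventually_elim
    case (elim w)
    have w: "w \<noteq> 0" "norm w < loc_radius \<alpha> t" using elim by auto
    note ca = zm_cdiff2_loc[OF assms(1-3) w] and cb = zm_cdiff2_loc[OF assms(1,2,4) w]
    have "zm_form \<alpha> (Ct a) (Ct b) (loc \<alpha> w t) t + loc_dt \<alpha> a t * zm_form \<alpha> Cp (Ct b) (loc \<alpha> w t) t
        - loc_dt \<alpha> b t * zm_form \<alpha> Cp (Ct a) (loc \<alpha> w t) t
        = ?zs a w * dloc_t \<alpha> b (m \<alpha>) w t - ?zs b w * dloc_t \<alpha> a (m \<alpha>) w t"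
      unfolding dsl_chain[OF assms(1-3) ca(1)] dsl_chain[OF assms(1-3) ca(2)]
        dsl_chain[OF assms(1,2,4) cb(1)] dsl_chain[OF assms(1,2,4) cb(2)] wedge_def d_fun_def
      by (simp add: algebra_simps)
    also have "\<dots> = m_t_deriv \<alpha> b (?z w) * ?zs a w - m_t_deriv \<alpha> a (?z w) * ?zs b w
        + ?zs a w * ?Hs b w - ?zs b w * ?Hs a w"
      unfolding m_dt_formula[OF assms(1-3) elim(2)] m_dt_formula[OF assms(1,2,4) elim(3)]
      by (simp add: algebra_simps)
    finally show ?case unfolding dOmega_loc_def by (simp add: algebra_simps)
  qed
  show ?thesis
    by (subst landau_o.big.in_cong[OF ev])
      (rule sum_in_bigo(2)[OF sum_in_bigo(1)[OF sum_in_bigo(2)[OF dOmega_dt_order dOmega_dt_order] z_dt_mrem_order] z_dt_mrem_order];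
        fact assms)
qed

section \<open>Identification of the coefficients by Liouville's theorem\<close>

lemma loc_avoid:
  assumes "\<alpha> \<le> M" "t \<in> T"
  shows "\<forall>\<^sub>F w in at 0. loc \<alpha> w t \<in> U \<alpha> t - punctures t"
proof -
  have "\<forall>\<^sub>F w in at 0. \<forall>i\<in>{1..M}. loc \<alpha> w t \<noteq> q i t"
  proof (rule eventually_ball_finite)
    show "\<forall>i\<in>{1..M}. \<forall>\<^sub>F w in at 0. loc \<alpha> w t \<noteq> q i t"
    proof
      fix i assume i: "i \<in> {1..M}"
      hence "\<forall>\<^sub>F x in nhds (0, t (0, 1)). fst x \<noteq> 0 \<longrightarrow>
          loc \<alpha> (fst x) (t((0, 1) := snd x)) \<noteq> q i (t((0, 1) := snd x))"
        using assms zero_one_in_tidx by (intro eventually_loc_avoids) auto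
      from eventually_at_of_nhds_pair[OF this] show "\<forall>\<^sub>F w in at 0. loc \<alpha> w t \<noteq> q i t"
        by eventually_elim simp
    qed
  qed simp
  with eventually_loc_radius[OF assms] show ?thesis
    by eventually_elim (use loc_mem[OF assms] in \<open>auto simp: punctures_def\<close>)
qed

lemma zero_of_local_orders:
  assumes "t \<in> T" "h holomorphic_on - punctures t" "p \<notin> punctures t"
    "\<And>\<alpha>. \<alpha> \<le> M \<Longrightarrow> (\<lambda>w. h (loc \<alpha> w t)) \<in> O[at 0](\<lambda>w. w ^ contact_order \<alpha>)"
  shows "h p = 0"
proof (rule Liouville_removable[where F = "punctures t" and h = h and p = p])
  fix c assume "c \<in> punctures t"
  then obtain i where "i \<in> {1..M}" "c = q i t" by (auto simp: punctures_def)
  thus "(\<lambda>w. h (c + w)) \<in> O[at 0](\<lambda>_. 1)" using assms(4)[of i] by (simp add: loc_def contact_order_def)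
next
  show "(\<lambda>w. h (inverse w)) \<in> O[at 0](\<lambda>w. w)" using assms(4)[of 0] by (simp add: loc_def contact_order_def)
qed (use assms in auto)

lemma dOmega_holomorphic:
  assumes "t \<in> T" "b \<in> tidx M" "c \<in> coords M"
  shows "(\<lambda>p. dOmega c b p t) holomorphic_on - punctures t"
proof (cases "snd b = 0")
  case True
  then obtain i where b: "b = (i, 0)" and i: "i \<in> {1..M}" using assms(2) by (cases b) (auto simp: tidx_def)
  show ?thesis unfolding dOmega_def using i by (auto simp: b punctures_def intro!: holomorphic_intros)
next
  case False
  have op: "open (- punctures t)" by (simp add: finite_imp_closed open_Compl)
  have b: "fst b \<le> M" using assms(2) by (auto simp: tidx_def)
  have av: "fst b = 0 \<or> p \<noteq> q (fst b) t" if "p \<in> - punctures t" for p using that b by (auto simp: punctures_def)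
  have "(\<lambda>p. pd c (Omega_expl (fst b) (snd b)) p t) holomorphic_on - punctures t"
  proof (cases c)
    case Cp
    have "cdiff2 (\<lambda>x. Omega_expl (fst b) (snd b) (fst x) (t((0,1) := snd x))) (p, t (0,1))" if "p \<in> - punctures t" for p
      using av[OF that] assms b zero_one_in_tidx by (intro Omega_expl_cdiff2) auto
    from cdiff2_fst_deriv[OF this] have "(\<lambda>p. Omega_expl (fst b) (snd b) p t) holomorphic_on - punctures t"
      unfolding holomorphic_on_open[OF op] by auto
    thus ?thesis using op by (simp add: Cp holomorphic_deriv)
  next
    case (Ct a)
    have a: "a \<in> tidx M" using assms(3) Ct by (auto simp: coords_def)
    \<comment> \<open>\<open>S\<close> is the interior of the set of points of differentiability,
      because \<open>holomorphic_partial_deriv\<close> asks for an open set in both variables; it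
      contains \<open>(p, t a)\<close> for all \<open>p\<close> off the punctures.\<close>
    define S where "S = {x. \<exists>V. open V \<and> x \<in> V \<and> (\<forall>y\<in>V. cdiff2 (\<lambda>x. Omega_expl (fst b) (snd b) (fst x) (t(a := snd x))) y)}"
    have "open S" unfolding S_def by (subst open_subopen) blast
    moreover have "(p, t a) \<in> S" if p: "p \<in> - punctures t" for p
    proof -
      have "\<forall>\<^sub>F x in nhds (p, t a). fst b = 0 \<or> fst x \<noteq> q (fst b) (t(a := snd x))"
      proof (cases "fst b = 0")
        case False
        define g where "g = (\<lambda>x. fst x - q (fst b) (t(a := snd x)))"
        have "cdiff2 g (p, t a)" unfolding g_def using False b assms(1) a
          by (intro cdiff2_intros cdiff2_fun_snd[of "\<lambda>s. q (fst b) (t(a := s))"] hol_t_differentiable q_hol) auto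
        hence "(g \<longlongrightarrow> g (p, t a)) (nhds (p, t a))"
          using cdiff2_isCont unfolding isCont_def tendsto_at_iff_tendsto_nhds by blast
        moreover have "g (p, t a) \<noteq> 0" using av[OF p] False by (simp add: g_def)
        ultimately have "\<forall>\<^sub>F x in nhds (p, t a). g x \<in> - {0}" by (intro topological_tendstoD) auto
        thus ?thesis by eventually_elim (auto simp: g_def)
      qed simp
      moreover have "\<forall>\<^sub>F x in nhds (p, t a). t(a := snd x) \<in> T"
        using eventually_T[OF assms(1) a] eventually_prod2[of "nhds p" "\<lambda>s. t(a := s) \<in> T" "nhds (t a)"]
        unfolding nhds_prod case_prod_beta by simp
      ultimately have "\<forall>\<^sub>F x in nhds (p, t a). cdiff2 (\<lambda>x. Omega_expl (fst b) (snd b) (fst x) (t(a := snd x))) x"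
      proof eventually_elim
        case (elim x)
        have "cdiff2 (\<lambda>x. Omega_expl (fst b) (snd b) (fst x) (t(a := snd x))) (fst x, snd x)"
          using elim b assms(1) a by (intro Omega_expl_cdiff2) auto
        thus ?case by simp
      qed
      thus ?thesis unfolding S_def eventually_nhds by blast
    qed
    moreover have "(\<lambda>p. deriv (\<lambda>s. (\<lambda>x. Omega_expl (fst b) (snd b) (fst x) (t(a := snd x))) (p, s)) (t a))
        holomorphic_on {p. (p, t a) \<in> S}"
    proof (rule holomorphic_partial_deriv[OF \<open>open S\<close>])
      show "cdiff2 (\<lambda>x. Omega_expl (fst b) (snd b) (fst x) (t(a := snd x))) x" if "x \<in> S" for x
        using that unfolding S_def by blast
    qed
    ultimately have "(\<lambda>p. deriv (\<lambda>s. (\<lambda>x. Omega_expl (fst b) (snd b) (fst x) (t(a := snd x))) (p, s)) (t a))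
        holomorphic_on - punctures t"
      by (elim holomorphic_on_subset) auto
    thus ?thesis by (simp add: Ct)
  qed
  thus ?thesis using False by (simp add: dOmega_def)
qed

lemma wedge_pt_eq:
  assumes "t \<in> T" "a \<in> tidx M" "W holomorphic_on - punctures t" "p \<notin> punctures t"
    and W: "\<And>\<alpha> p. \<alpha> \<le> M \<Longrightarrow> p \<in> U \<alpha> t - punctures t \<Longrightarrow> zm_form \<alpha> Cp (Ct a) p t = W p"
  shows "W p = dOmega Cp a p t"
proof -
  have "W p - dOmega Cp a p t = 0"
  proof (rule zero_of_local_orders[where h = "\<lambda>p. W p - dOmega Cp a p t", OF assms(1)])
    show "(\<lambda>p. W p - dOmega Cp a p t) holomorphic_on - punctures t"
      using assms by (intro holomorphic_intros dOmega_holomorphic) (auto simp: coords_def)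
    fix \<alpha> assume \<alpha>: "\<alpha> \<le> M"
    have "\<forall>\<^sub>F w in at 0. zm_form \<alpha> Cp (Ct a) (loc \<alpha> w t) t - dOmega Cp a (loc \<alpha> w t) t
        = W (loc \<alpha> w t) - dOmega Cp a (loc \<alpha> w t) t"
      using loc_avoid[OF \<alpha> assms(1)] by eventually_elim (use W[OF \<alpha>] in simp)
    with wedge_pt_order[OF \<alpha> assms(1,2)]
    show "(\<lambda>w. W (loc \<alpha> w t) - dOmega Cp a (loc \<alpha> w t) t) \<in> O[at 0](\<lambda>w. w ^ contact_order \<alpha>)"
      by (subst (asm) landau_o.big.in_cong)
  qed (use assms in auto)
  thus ?thesis by simp
qed

text \<open>The assumptions \<open>a\<close> and \<open>b\<close> annihilate the correction terms of
  \<open>wedge_tt_order\<close>, which leaves the bare difference for Liouville's theorem.\<close>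

lemma wedge_tt_eq:
  assumes "t \<in> T" "a \<in> tidx M" "b \<in> tidx M" "W holomorphic_on - punctures t" "p \<notin> punctures t"
    and W: "\<And>\<alpha> p. \<alpha> \<le> M \<Longrightarrow> p \<in> U \<alpha> t - punctures t \<Longrightarrow> zm_form \<alpha> (Ct a) (Ct b) p t = W p"
    and a: "\<And>\<alpha> p. \<alpha> \<le> M \<Longrightarrow> p \<in> U \<alpha> t - punctures t \<Longrightarrow> zm_form \<alpha> Cp (Ct a) p t = dOmega Cp a p t"
    and b: "\<And>\<alpha> p. \<alpha> \<le> M \<Longrightarrow> p \<in> U \<alpha> t - punctures t \<Longrightarrow> zm_form \<alpha> Cp (Ct b) p t = dOmega Cp b p t"
  shows "W p = dOmega (Ct a) b p t - dOmega (Ct b) a p t"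
proof -
  let ?D = "\<lambda>p. dOmega (Ct a) b p t - dOmega (Ct b) a p t"
  have "W p - ?D p = 0"
  proof (rule zero_of_local_orders[where h = "\<lambda>p. W p - ?D p", OF assms(1)])
    show "(\<lambda>p. W p - ?D p) holomorphic_on - punctures t"
      using assms by (intro holomorphic_intros dOmega_holomorphic) (auto simp: coords_def)
    fix \<alpha> assume \<alpha>: "\<alpha> \<le> M"
    have "\<forall>\<^sub>F w in at 0. (zm_form \<alpha> (Ct a) (Ct b) (loc \<alpha> w t) t - ?D (loc \<alpha> w t))
        + loc_dt \<alpha> a t * (zm_form \<alpha> Cp (Ct b) (loc \<alpha> w t) t - dOmega Cp b (loc \<alpha> w t) t)
        - loc_dt \<alpha> b t * (zm_form \<alpha> Cp (Ct a) (loc \<alpha> w t) t - dOmega Cp a (loc \<alpha> w t) t)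
        = W (loc \<alpha> w t) - ?D (loc \<alpha> w t)"
      using loc_avoid[OF \<alpha> assms(1)] by eventually_elim (use W[OF \<alpha>] a[OF \<alpha>] b[OF \<alpha>] in simp)
    with wedge_tt_order[OF \<alpha> assms(1-3)]
    show "(\<lambda>w. W (loc \<alpha> w t) - ?D (loc \<alpha> w t)) \<in> O[at 0](\<lambda>w. w ^ contact_order \<alpha>)"
      by (subst (asm) landau_o.big.in_cong)
  qed (use assms in auto)
  thus ?thesis by simp
qed

end

section \<open>The string equations\<close>

text \<open>Agreement of germs holds on a neighbourhood in \<open>p\<close> and the time
  \<open>t a\<close> together, so it persists at nearby points and survives differentiation in
  either variable.\<close>

lemma germ_eq_pd:
  assumes "germ_eq a p t f g" "c = Cp \<or> c = Ct a"
  shows "\<forall>\<^sub>F p' in nhds p. pd c f p' t = pd c g p' t"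
proof -
  have "\<forall>\<^sub>F x in nhds (p, t a). f (fst x) (t(a := snd x)) = g (fst x) (t(a := snd x))"
    using assms(1) unfolding germ_eq_def by (simp add: case_prod_unfold)
  hence "\<forall>\<^sub>F x in nhds (p, t a). \<forall>\<^sub>F y in nhds x. f (fst y) (t(a := snd y)) = g (fst y) (t(a := snd y))"
    by (simp add: eventually_eventually)
  from eventually_nhds_slice[OF this] show ?thesis
  proof eventually_elim
    case (elim p')
    from eventually_nhds_slice[OF elim] eventually_nhds_slice2[OF elim] assms(2) show ?case
      by (auto intro!: deriv_cong_ev)
  qed
qed

lemma germ_hol_pd:
  assumes "germ_hol a p t f" "c = Cp \<or> c = Ct a"
  shows "\<exists>r>0. (\<lambda>p. pd c f p t) holomorphic_on ball p r"
proof -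
  define f' where "f' = (\<lambda>x. f (fst x) (t(a := snd x)))"
  obtain S where S: "open S" "(p, t a) \<in> S" "\<And>x. x \<in> S \<Longrightarrow> cdiff2 f' x"
    using assms(1) unfolding germ_hol_def f'_def by (auto simp: hol2_on_open case_prod_unfold)
  obtain r where r: "r > 0" "\<And>x y. x \<in> cball p r \<Longrightarrow> y \<in> cball (t a) r \<Longrightarrow> (x, y) \<in> S"
    using eventually_nhds_in_open[OF S(1,2)] by (rule eventually_nhds_prodE) blast
  have sub: "ball p r \<subseteq> {p. (p, t a) \<in> S}" using r by auto
  from assms(2) show ?thesis
  proof
    assume c: "c = Cp"
    have "((\<lambda>p. f p t) has_field_derivative deriv (\<lambda>p. f p t) p') (at p')" if "p' \<in> ball p r" for p'
      using cdiff2_fst_deriv[of f' p' "t a"] S(3) sub that by (auto simp: f'_def)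
    hence "(\<lambda>p. f p t) holomorphic_on ball p r"
      unfolding holomorphic_on_open[OF open_ball] by blast
    thus ?thesis using r(1) c by (auto intro!: exI[of _ r] holomorphic_deriv)
  next
    assume c: "c = Ct a"
    have "(\<lambda>p. deriv (\<lambda>s. f' (p, s)) (t a)) holomorphic_on ball p r"
      by (rule holomorphic_on_subset[OF holomorphic_partial_deriv[OF S(1,3)] sub])
    thus ?thesis using r(1) c by (auto simp: f'_def)
  qed
qed

text \<open>Germs live on planes spanned by \<open>p\<close> and one time; for \<open>Cp\<close> the
  time \<open>x\<close> supplies the plane.\<close>

lemma coords_cases:
  assumes "c \<in> coords M"
  obtains a where "a \<in> tidx M" "c = Cp \<or> c = Ct a"
proof (cases c)
  case Cp
  have "(0, 1) \<in> tidx M" by (simp add: tidx_def)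
  with Cp show ?thesis using that by blast
next
  case (Ct a)
  with assms show ?thesis using that by (auto simp: coords_def)
qed

text \<open>The continued functions may be multivalued, so it is the coefficient formed from their
  germs that is followed along the path and compared with the single-valued \<open>W\<close>. The
  endpoint may lie in \<open>F\<close>, hence the punctured neighbourhood in the conclusion.\<close>

lemma wedge_continuation:
  assumes "continues_to M t \<gamma> f0 f1" "continues_to M t \<gamma> g0 g1"
    and c: "c \<in> coords M" "c' \<in> coords M"
    and W: "finite F" "W holomorphic_on -F"
    and start: "\<forall>\<^sub>F p in nhds (pathstart \<gamma>). wedge (d_fun f0) (d_fun g0) c c' p t = W p"
  shows "\<forall>\<^sub>F p in at (pathfinish \<gamma>). wedge (d_fun f1) (d_fun g1) c c' p t = W p"
proof -
  \<comment> \<open>One family \<open>\<Phi>\<close> serves all time directions, so derivatives in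
    two different times are taken of the same continuation.\<close>
  obtain \<Phi> where path: "path \<gamma>" and \<Phi>': "\<forall>a\<in>tidx M. germ_eq a (pathstart \<gamma>) t (\<Phi> 0) f0 \<and>
      germ_eq a (pathfinish \<gamma>) t (\<Phi> 1) f1 \<and>
      (\<forall>u\<in>{0..1}. germ_hol a (\<gamma> u) t (\<Phi> u) \<and>
        (\<forall>\<^sub>F u' in at u within {0..1}. germ_eq a (\<gamma> u') t (\<Phi> u') (\<Phi> u)))"
    using assms(1) unfolding continues_to_def by blast
  obtain \<Psi> where \<Psi>': "\<forall>a\<in>tidx M. germ_eq a (pathstart \<gamma>) t (\<Psi> 0) g0 \<and>
      germ_eq a (pathfinish \<gamma>) t (\<Psi> 1) g1 \<and>
      (\<forall>u\<in>{0..1}. germ_hol a (\<gamma> u) t (\<Psi> u) \<and>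
        (\<forall>\<^sub>F u' in at u within {0..1}. germ_eq a (\<gamma> u') t (\<Psi> u') (\<Psi> u)))"
    using assms(2) unfolding continues_to_def by blast
  have \<Phi>: "germ_eq a (\<gamma> 0) t (\<Phi> 0) f0" "germ_eq a (\<gamma> 1) t (\<Phi> 1) f1"
      "u \<in> {0..1} \<Longrightarrow> germ_hol a (\<gamma> u) t (\<Phi> u)"
      "u \<in> {0..1} \<Longrightarrow> \<forall>\<^sub>F u' in at u within {0..1}. germ_eq a (\<gamma> u') t (\<Phi> u') (\<Phi> u)"
    if "a \<in> tidx M" for a u
    using bspec[OF \<Phi>' that] by (simp_all add: pathstart_def pathfinish_def)
  have \<Psi>: "germ_eq a (\<gamma> 0) t (\<Psi> 0) g0" "germ_eq a (\<gamma> 1) t (\<Psi> 1) g1"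
      "u \<in> {0..1} \<Longrightarrow> germ_hol a (\<gamma> u) t (\<Psi> u)"
      "u \<in> {0..1} \<Longrightarrow> \<forall>\<^sub>F u' in at u within {0..1}. germ_eq a (\<gamma> u') t (\<Psi> u') (\<Psi> u)"
    if "a \<in> tidx M" for a u
    using bspec[OF \<Psi>' that] by (simp_all add: pathstart_def pathfinish_def)
  define \<Theta> where "\<Theta> u p = wedge (d_fun (\<Phi> u)) (d_fun (\<Psi> u)) c c' p t" for u p
  obtain a where a: "a \<in> tidx M" "c = Cp \<or> c = Ct a" using c(1) by (rule coords_cases)
  obtain b where b: "b \<in> tidx M" "c' = Cp \<or> c' = Ct b" using c(2) by (rule coords_cases)
  have germ: "\<forall>\<^sub>F p' in nhds p. wedge (d_fun f) (d_fun g) c c' p' t = wedge (d_fun f') (d_fun g') c c' p' t"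
    if "germ_eq a p t f f'" "germ_eq b p t f f'" "germ_eq a p t g g'" "germ_eq b p t g g'" for p f f' g g'
    using germ_eq_pd[OF that(1) a(2)] germ_eq_pd[OF that(2) b(2)]
      germ_eq_pd[OF that(3) a(2)] germ_eq_pd[OF that(4) b(2)]
    by eventually_elim (simp add: wedge_def d_fun_def)
  have "\<forall>\<^sub>F p in at (\<gamma> 1). \<Theta> 1 p = W p"
  proof (rule continuation_along_path[OF path W])
    fix u :: real assume u: "u \<in> {0..1}"
    obtain r1 r2 r3 r4 where r: "r1 > 0" "r2 > 0" "r3 > 0" "r4 > 0"
      "(\<lambda>p. pd c (\<Phi> u) p t) holomorphic_on ball (\<gamma> u) r1"
      "(\<lambda>p. pd c' (\<Phi> u) p t) holomorphic_on ball (\<gamma> u) r2"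
      "(\<lambda>p. pd c (\<Psi> u) p t) holomorphic_on ball (\<gamma> u) r3"
      "(\<lambda>p. pd c' (\<Psi> u) p t) holomorphic_on ball (\<gamma> u) r4"
      using germ_hol_pd[OF \<Phi>(3)[OF a(1) u] a(2)] germ_hol_pd[OF \<Phi>(3)[OF b(1) u] b(2)]
        germ_hol_pd[OF \<Psi>(3)[OF a(1) u] a(2)] germ_hol_pd[OF \<Psi>(3)[OF b(1) u] b(2)] by blast
    define r where "r = min (min r1 r2) (min r3 r4)"
    have "\<Theta> u holomorphic_on ball (\<gamma> u) r"
      unfolding \<Theta>_def wedge_def d_fun_def
      by (intro holomorphic_intros holomorphic_on_subset[OF r(5)] holomorphic_on_subset[OF r(6)]
          holomorphic_on_subset[OF r(7)] holomorphic_on_subset[OF r(8)] subset_ball) (auto simp: r_def)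
    thus "\<exists>r>0. \<Theta> u holomorphic_on ball (\<gamma> u) r" using r(1-4) by (intro exI[of _ r]) (auto simp: r_def)
    show "\<forall>\<^sub>F u' in at u within {0..1}. \<forall>\<^sub>F p in nhds (\<gamma> u'). \<Theta> u' p = \<Theta> u p"
      using \<Phi>(4)[OF a(1) u] \<Phi>(4)[OF b(1) u] \<Psi>(4)[OF a(1) u] \<Psi>(4)[OF b(1) u]
      unfolding \<Theta>_def by eventually_elim (rule germ)
  next
    have "\<forall>\<^sub>F p in nhds (\<gamma> 0). \<Theta> 0 p = wedge (d_fun f0) (d_fun g0) c c' p t"
      unfolding \<Theta>_def by (intro germ \<Phi> \<Psi> a b)
    with start have "\<forall>\<^sub>F p in nhds (\<gamma> 0). \<Theta> 0 p = W p"
      unfolding pathstart_def by eventually_elim simp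
    thus "\<forall>\<^sub>F p in at (\<gamma> 0). \<Theta> 0 p = W p"
      by (simp add: eventually_at_filter eventually_mono)
  qed
  moreover have "\<forall>\<^sub>F p in nhds (\<gamma> 1). \<Theta> 1 p = wedge (d_fun f1) (d_fun g1) c c' p t"
    unfolding \<Theta>_def by (intro germ \<Phi> \<Psi> a b)
  hence "\<forall>\<^sub>F p in at (\<gamma> 1). \<Theta> 1 p = wedge (d_fun f1) (d_fun g1) c c' p t"
    by (simp add: eventually_at_filter eventually_mono)
  ultimately show ?thesis unfolding pathfinish_def by eventually_elim simp
qed

context whitham
begin

lemma pd_has_derivative:
  assumes "\<alpha> \<le> M" "t \<in> T" "p \<in> U \<alpha> t" "a \<in> tidx M"
  shows "((\<lambda>p. z \<alpha> p t) has_field_derivative pd Cp (z \<alpha>) p t) (at p)"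
    and "((\<lambda>p. m \<alpha> p t) has_field_derivative pd Cp (m \<alpha>) p t) (at p)"
    and "((\<lambda>s. z \<alpha> p (t(a := s))) has_field_derivative pd (Ct a) (z \<alpha>) p t) (at (t a))"
    and "((\<lambda>s. m \<alpha> p (t(a := s))) has_field_derivative pd (Ct a) (m \<alpha>) p t) (at (t a))"
  using cdiff2_fst_deriv[OF zm_cdiff2(1)[OF assms(1,4), of p t "t a"]]
    cdiff2_fst_deriv[OF zm_cdiff2(2)[OF assms(1,4), of p t "t a"]]
    cdiff2_snd_deriv[OF zm_cdiff2(1)[OF assms(1,4), of p t "t a"]]
    cdiff2_snd_deriv[OF zm_cdiff2(2)[OF assms(1,4), of p t "t a"]] assms(2,3) by simp_all

lemma pd_compose:
  assumes "\<alpha> \<le> M" "t \<in> T" "p \<in> U \<alpha> t" "c \<in> coords M"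
    "cdiff2 (\<lambda>x. P (fst x) (snd x)) (z \<alpha> p t, m \<alpha> p t)"
  shows "pd c (\<lambda>p t. P (z \<alpha> p t) (m \<alpha> p t)) p t =
    deriv (\<lambda>x. P x (m \<alpha> p t)) (z \<alpha> p t) * pd c (z \<alpha>) p t
    + deriv (\<lambda>y. P (z \<alpha> p t) y) (m \<alpha> p t) * pd c (m \<alpha>) p t"
proof -
  obtain a where a: "a \<in> tidx M" "c = Cp \<or> c = Ct a" using assms(4) by (rule coords_cases)
  note D = pd_has_derivative[OF assms(1-3) a(1)]
  from a(2) show ?thesis
  proof
    assume "c = Cp"
    with DERIV_imp_deriv[OF cdiff2_curve[of "\<lambda>x. P (fst x) (snd x)" "\<lambda>p. z \<alpha> p t" p "\<lambda>p. m \<alpha> p t", OF _ D(1,2)]]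
      assms(5) show ?thesis by simp
  next
    assume "c = Ct a"
    with DERIV_imp_deriv[OF cdiff2_curve[of "\<lambda>x. P (fst x) (snd x)" "\<lambda>s. z \<alpha> p (t(a := s))" "t a"
          "\<lambda>s. m \<alpha> p (t(a := s))", OF _ D(3,4)]] assms(5) show ?thesis by simp
  qed
qed

text \<open>By the chain rule the two-form is multiplied by the Jacobian determinant of
  \<open>(P, Q)\<close>, and that determinant is the bracket.\<close>

lemma wedge_compose:
  assumes "\<alpha> \<le> M" "t \<in> T" "p \<in> U \<alpha> t" "c \<in> coords M" "c' \<in> coords M"
    and G: "open G" "hol2_on (\<lambda>(x, y). P x y) G" "hol2_on (\<lambda>(x, y). Q x y) G"
    and br: "\<And>x y. (x, y) \<in> G \<Longrightarrow> poisson P Q x y = 1"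
    and mem: "(z \<alpha> p t, m \<alpha> p t) \<in> G"
  shows "\<forall>\<^sub>F p in nhds p. wedge (d_fun (\<lambda>p t. P (z \<alpha> p t) (m \<alpha> p t)))
    (d_fun (\<lambda>p t. Q (z \<alpha> p t) (m \<alpha> p t))) c c' p t = zm_form \<alpha> c c' p t"
proof -
  have "isCont (\<lambda>p. (z \<alpha> p t, m \<alpha> p t)) p"
    using pd_has_derivative(1,2)[OF assms(1-3) zero_one_in_tidx] by (intro continuous_Pair) (auto dest: DERIV_isCont)
  hence "((\<lambda>p. (z \<alpha> p t, m \<alpha> p t)) \<longlongrightarrow> (z \<alpha> p t, m \<alpha> p t)) (nhds p)"
    unfolding isCont_def by (rule tendsto_at_iff_tendsto_nhds[THEN iffD1])
  hence "\<forall>\<^sub>F p in nhds p. (z \<alpha> p t, m \<alpha> p t) \<in> G"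
    using G(1) mem by (rule topological_tendstoD)
  moreover have "\<forall>\<^sub>F p in nhds p. p \<in> U \<alpha> t"
    using eventually_nhds_slice[OF eventually_U[OF assms(1-3) zero_one_in_tidx]] by eventually_elim simp
  ultimately show ?thesis
  proof eventually_elim
    case (elim p)
    have "cdiff2 (\<lambda>x. P (fst x) (snd x)) (z \<alpha> p t, m \<alpha> p t)" "cdiff2 (\<lambda>x. Q (fst x) (snd x)) (z \<alpha> p t, m \<alpha> p t)"
      using G elim by (auto simp: hol2_on_open case_prod_unfold)
    note pdc = pd_compose[OF assms(1,2) elim(2) _ this(1)] pd_compose[OF assms(1,2) elim(2) _ this(2)]
    have "wedge (d_fun (\<lambda>p t. P (z \<alpha> p t) (m \<alpha> p t))) (d_fun (\<lambda>p t. Q (z \<alpha> p t) (m \<alpha> p t))) c c' p t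
        = poisson P Q (z \<alpha> p t) (m \<alpha> p t) * zm_form \<alpha> c c' p t"
      unfolding wedge_def d_fun_def poisson_def pdc[OF assms(4)] pdc[OF assms(5)]
      by (simp add: algebra_simps)
    thus ?case using br[OF elim(1)] by simp
  qed
qed

text \<open>For a logarithm the relation \<open>exp L = p - q\<close> is differentiated rather than
  \<open>L\<close> itself, so the result is independent of the branch. For the other Hamiltonians
  the explicit form holds at all nearby times, so the derivatives agree too.\<close>

lemma pd_Omega:
  assumes L: "\<And>i. i \<in> {1..M} \<Longrightarrow>
      open_pt M (over T (\<lambda>t. - K i t)) \<and> hol_pt M (over T (\<lambda>t. - K i t)) (L i)"
    "\<And>i t p. i \<in> {1..M} \<Longrightarrow> t \<in> T \<Longrightarrow> p \<notin> K i t \<Longrightarrow> exp (L i p t) = p - q i t"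
    and t: "t \<in> T" and b: "b \<in> tidx M" and c: "c \<in> coords M"
    and p: "p \<notin> (\<Union>i\<in>{1..M}. K i t)"
  shows "pd c (Omega q L z b) p t = dOmega c b p t"
proof -
  obtain a where a: "a \<in> tidx M" "c = Cp \<or> c = Ct a" using c by (rule coords_cases)
  show ?thesis
  proof (cases "snd b = 0")
    case False
    have eq: "Omega q L z b p' t' = Omega_expl (fst b) (snd b) p' t'" if "t' \<in> T" for p' t'
      using Omega_eq_expl[of "fst b" t' "snd b" L p'] False b that by (auto simp: tidx_def)
    have "\<forall>\<^sub>F s in nhds (t a). Omega q L z b p (t(a := s)) = Omega_expl (fst b) (snd b) p (t(a := s))"
      using eventually_T[OF t a(1)] by eventually_elim (rule eq)
    hence "deriv (\<lambda>s. Omega q L z b p (t(a := s))) (t a)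
        = deriv (\<lambda>s. Omega_expl (fst b) (snd b) p (t(a := s))) (t a)"
      by (intro deriv_cong_ev) auto
    thus ?thesis using a(2) False eq[OF t] by (auto simp: dOmega_def)
  next
    case True
    then obtain i where bi: "b = (i, 0)" and i: "i \<in> {1..M}" using b by (cases b) (auto simp: tidx_def)
    define D where "D = over T (\<lambda>t. - K i t)"
    have pD: "(p, t) \<in> D" using t p i by (auto simp: D_def over_def)
    define Lf where "Lf = (\<lambda>x. L i (fst x) (t(a := snd x)))"
    have cd: "cdiff2 Lf (p, t a)"
      unfolding Lf_def using L(1)[OF i] pD a(1) by (intro hol_pt_cdiff2[of M D]) (auto simp: D_def)
    have "open (slice D t a)" using L(1)[OF i] pD a(1) unfolding open_pt_def D_def by fastforce
    moreover have "(p, t a) \<in> slice D t a" using pD by (simp add: slice_def)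
    ultimately have "\<forall>\<^sub>F x in nhds (p, t a). x \<in> slice D t a" by (rule eventually_nhds_in_open)
    hence ev: "\<forall>\<^sub>F x in nhds (p, t a). exp (Lf x) = fst x - q i (t(a := snd x))"
      by eventually_elim (auto simp: slice_def D_def over_def Lf_def L(2)[OF i])
    have e: "exp (Lf (p, t a)) = p - q i t" using eventually_nhds_x_imp_x[OF ev] by simp
    \<comment> \<open>\<open>exp\<close> has no zeros, so off the cut the point \<open>p\<close>
      differs from the puncture.\<close>
    hence nz: "p - q i t \<noteq> 0" by (metis exp_not_eq_zero)
    have Lp: "((\<lambda>p. Lf (p, t a)) has_field_derivative deriv (\<lambda>p. Lf (p, t a)) p) (at p)"
      by (rule cdiff2_fst_deriv[OF cd])
    have Ls: "((\<lambda>s. Lf (p, s)) has_field_derivative deriv (\<lambda>s. Lf (p, s)) (t a)) (at (t a))"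
      by (rule cdiff2_snd_deriv[OF cd])
    have "((\<lambda>p. exp (Lf (p, t a))) has_field_derivative
        exp (Lf (p, t a)) * deriv (\<lambda>p. Lf (p, t a)) p) (at p)"
      by (rule DERIV_chain2[OF DERIV_exp Lp])
    moreover have "deriv (\<lambda>p. exp (Lf (p, t a))) p = deriv (\<lambda>p. p - q i t) p"
      using eventually_nhds_slice[OF ev] by (intro deriv_cong_ev) auto
    moreover have "((\<lambda>p. p - q i t) has_field_derivative 1) (at p)"
      by (auto intro!: derivative_eq_intros)
    ultimately have "(p - q i t) * deriv (\<lambda>p. Lf (p, t a)) p = 1"
      using e by (metis DERIV_imp_deriv)
    hence 1: "deriv (\<lambda>p. - L i p t) p = - inverse (p - q i t)"
      using DERIV_imp_deriv[OF DERIV_minus[OF Lp]] nz by (simp add: Lf_def field_simps)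
    have "((\<lambda>s. exp (Lf (p, s))) has_field_derivative
        exp (Lf (p, t a)) * deriv (\<lambda>s. Lf (p, s)) (t a)) (at (t a))"
      by (rule DERIV_chain2[OF DERIV_exp Ls])
    moreover have "deriv (\<lambda>s. exp (Lf (p, s))) (t a) = deriv (\<lambda>s. p - q i (t(a := s))) (t a)"
      using eventually_nhds_slice2[OF ev] by (intro deriv_cong_ev) auto
    moreover have "((\<lambda>s. p - q i (t(a := s))) has_field_derivative
        (0 - deriv (\<lambda>s. q i (t(a := s))) (t a))) (at (t a))"
      using i t a(1) by (intro DERIV_diff DERIV_const hol_t_deriv q_hol) auto
    ultimately have "(p - q i t) * deriv (\<lambda>s. Lf (p, s)) (t a) = - deriv (\<lambda>s. q i (t(a := s))) (t a)"
      using e by (metis DERIV_imp_deriv diff_0)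
    hence 2: "deriv (\<lambda>s. - L i p (t(a := s))) (t a)
        = deriv (\<lambda>s. q i (t(a := s))) (t a) * inverse (p - q i t)"
      using DERIV_imp_deriv[OF DERIV_minus[OF Ls]] nz
      by (simp add: Lf_def field_simps minus_equation_iff)
    from a(2) show ?thesis using 1 2 by (auto simp: dOmega_def bi Omega_def)
  qed
qed

end

text \<open>Off the cuts both sides equal the same combination of \<open>dOmega\<close>: the left
  one by gluing the coefficients and Liouville's theorem, the right one by differentiating the
  Hamiltonians.\<close>

theorem theorem1:
  fixes M :: nat
    and P Q :: "nat \<Rightarrow> complex \<Rightarrow> complex \<Rightarrow> complex" and G :: "nat \<Rightarrow> (complex \<times> complex) set"
    and T :: "times set" and \<rho> :: "nat \<Rightarrow> times \<Rightarrow> real"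
    and z m :: "nat \<Rightarrow> pt_fun"
    and q d :: "nat \<Rightarrow> times \<Rightarrow> complex" and dd v :: "nat \<Rightarrow> nat \<Rightarrow> times \<Rightarrow> complex"
    and K :: "nat \<Rightarrow> times \<Rightarrow> complex set" and L :: "nat \<Rightarrow> pt_fun"
  defines "U \<equiv> pnbhd q \<rho>"
  assumes PQ_hol: "\<And>\<alpha>. \<alpha> \<le> M \<Longrightarrow> open (G \<alpha>) \<and>
      hol2_on (\<lambda>(x, y). P \<alpha> x y) (G \<alpha>) \<and> hol2_on (\<lambda>(x, y). Q \<alpha> x y) (G \<alpha>)"
    and PQ_bracket: "\<And>\<alpha> x y. \<alpha> \<le> M \<Longrightarrow> (x, y) \<in> G \<alpha> \<Longrightarrow> poisson (P \<alpha>) (Q \<alpha>) x y = 1"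
    and T_open: "open_t M T"
    and rho_pos: "\<And>\<alpha> t. \<alpha> \<le> M \<Longrightarrow> t \<in> T \<Longrightarrow> \<rho> \<alpha> t > 0"
    and q_distinct: "\<And>t. t \<in> T \<Longrightarrow> inj_on (\<lambda>i. q i t) {1..M}"
    and d_nonzero: "\<And>i t. i \<in> {1..M} \<Longrightarrow> t \<in> T \<Longrightarrow> d i t \<noteq> 0"
    and qd_hol: "\<And>i. i \<in> {1..M} \<Longrightarrow> hol_t M T (q i) \<and> hol_t M T (d i)"
    and coeff_hol: "\<And>\<alpha> n. \<alpha> \<le> M \<Longrightarrow> hol_t M T (dd \<alpha> n) \<and> hol_t M T (v \<alpha> n)"
    and zm_hol: "\<And>\<alpha>. \<alpha> \<le> M \<Longrightarrow> open_pt M (over T (U \<alpha>)) \<and>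
      hol_pt M (over T (U \<alpha>)) (z \<alpha>) \<and> hol_pt M (over T (U \<alpha>)) (m \<alpha>)"
    and z0_expansion: "\<And>t p. t \<in> T \<Longrightarrow> p \<in> U 0 t \<Longrightarrow>
      (\<lambda>n. dd 0 (Suc n) t / p ^ Suc n) sums (z 0 p t - p)"
    and zi_expansion: "\<And>i t p. i \<in> {1..M} \<Longrightarrow> t \<in> T \<Longrightarrow> p \<in> U i t \<Longrightarrow>
      (\<lambda>n. dd i n t * (p - q i t) ^ n) sums (z i p t - d i t / (p - q i t))"
    and z_nonzero: "\<And>\<alpha> t p. \<alpha> \<le> M \<Longrightarrow> t \<in> T \<Longrightarrow> p \<in> U \<alpha> t \<Longrightarrow> z \<alpha> p t \<noteq> 0"
    and m_summable: "\<And>\<alpha> t p. \<alpha> \<le> M \<Longrightarrow> t \<in> T \<Longrightarrow> p \<in> U \<alpha> t \<Longrightarrow>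
      summable (\<lambda>n. of_nat (Suc n) * t (\<alpha>, Suc n) * z \<alpha> p t ^ n) \<and>
      summable (\<lambda>n. v \<alpha> (n + 2) t / z \<alpha> p t ^ (n + 2))"
    and m_expansion: "\<And>\<alpha> t p. \<alpha> \<le> M \<Longrightarrow> t \<in> T \<Longrightarrow> p \<in> U \<alpha> t \<Longrightarrow>
      m \<alpha> p t = (\<Sum>n. of_nat (Suc n) * t (\<alpha>, Suc n) * z \<alpha> p t ^ n)
        + tzero M \<alpha> t / z \<alpha> p t + (\<Sum>n. v \<alpha> (n + 2) t / z \<alpha> p t ^ (n + 2))"
    and string_eqs: "\<And>i t. i \<in> {1..M} \<Longrightarrow> t \<in> T \<Longrightarrow>
      \<exists>\<gamma>. pathstart \<gamma> \<in> U 0 t \<and> (z 0 (pathstart \<gamma>) t, m 0 (pathstart \<gamma>) t) \<in> G 0 \<and>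
          pathfinish \<gamma> \<in> U i t \<and> (z i (pathfinish \<gamma>) t, m i (pathfinish \<gamma>) t) \<in> G i \<and>
          continues_to M t \<gamma> (\<lambda>p t. P 0 (z 0 p t) (m 0 p t)) (\<lambda>p t. P i (z i p t) (m i p t)) \<and>
          continues_to M t \<gamma> (\<lambda>p t. Q 0 (z 0 p t) (m 0 p t)) (\<lambda>p t. Q i (z i p t) (m i p t))"
    and meromorphic: "\<And>\<alpha> t c c'. \<alpha> \<le> M \<Longrightarrow> t \<in> T \<Longrightarrow> c \<in> coords M \<Longrightarrow> c' \<in> coords M \<Longrightarrow>
      \<exists>W. W meromorphic_on UNIV \<and> W holomorphic_on (- ((\<lambda>i. q i t) ` {1..M})) \<and>
          (\<forall>p\<in>U \<alpha> t. wedge (d_fun (z \<alpha>)) (d_fun (m \<alpha>)) c c' p t = W p)"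
    and cuts: "\<And>i t. i \<in> {1..M} \<Longrightarrow> t \<in> T \<Longrightarrow> is_cut (q i t) (K i t)"
    and cuts_disjoint: "\<And>i j t. i \<in> {1..M} \<Longrightarrow> j \<in> {1..M} \<Longrightarrow> i \<noteq> j \<Longrightarrow> t \<in> T \<Longrightarrow>
      K i t \<inter> K j t = {}"
    and log_hol: "\<And>i. i \<in> {1..M} \<Longrightarrow>
      open_pt M (over T (\<lambda>t. - K i t)) \<and> hol_pt M (over T (\<lambda>t. - K i t)) (L i)"
    and log_branch: "\<And>i t p. i \<in> {1..M} \<Longrightarrow> t \<in> T \<Longrightarrow> p \<notin> K i t \<Longrightarrow> exp (L i p t) = p - q i t"
  shows "\<forall>\<alpha>\<le>M. \<forall>t\<in>T. \<forall>p\<in>U \<alpha> t - (\<Union>i\<in>{1..M}. K i t). \<forall>c\<in>coords M. \<forall>c'\<in>coords M.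
      wedge (d_fun (z \<alpha>)) (d_fun (m \<alpha>)) c c' p t = d_form (omega q L z) c c' p t"
proof -
  interpret whitham M T \<rho> z m q d dd v
    by unfold_locales (use assms in \<open>auto simp: U_def\<close>)
  \<comment> \<open>The meromorphy hypothesis gives each \<open>\<alpha>\<close> a function of its
    own; one function serving all punctures is obtained here.\<close>
  have W: "\<exists>W. W holomorphic_on - punctures t \<and> (\<forall>\<alpha>\<le>M. \<forall>p\<in>pnbhd q \<rho> \<alpha> t - punctures t. zm_form \<alpha> c c' p t = W p)"
    if t: "t \<in> T" and c: "c \<in> coords M" "c' \<in> coords M" for t c c'
  proof -
    have "\<exists>W. W holomorphic_on - punctures t \<and> (\<forall>p\<in>pnbhd q \<rho> \<alpha> t. zm_form \<alpha> c c' p t = W p)" if "\<alpha> \<le> M" for \<alpha>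
      using meromorphic[OF that t c] unfolding punctures_def U_def by blast
    then obtain W where W: "\<And>\<alpha>. \<alpha> \<le> M \<Longrightarrow> W \<alpha> holomorphic_on - punctures t"
      "\<And>\<alpha> p. \<alpha> \<le> M \<Longrightarrow> p \<in> pnbhd q \<rho> \<alpha> t \<Longrightarrow> zm_form \<alpha> c c' p t = W \<alpha> p" by metis
    have eq: "W \<alpha> p = W 0 p" if \<alpha>: "\<alpha> \<le> M" and p: "p \<notin> punctures t" for \<alpha> p
    proof (cases "\<alpha> = 0")
      case False
      hence "\<alpha> \<in> {1..M}" using \<alpha> by simp
      from string_eqs[OF this t, unfolded U_def] obtain \<gamma> where \<gamma>:
        "pathstart \<gamma> \<in> pnbhd q \<rho> 0 t" "(z 0 (pathstart \<gamma>) t, m 0 (pathstart \<gamma>) t) \<in> G 0"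
        "pathfinish \<gamma> \<in> pnbhd q \<rho> \<alpha> t" "(z \<alpha> (pathfinish \<gamma>) t, m \<alpha> (pathfinish \<gamma>) t) \<in> G \<alpha>"
        "continues_to M t \<gamma> (\<lambda>p t. P 0 (z 0 p t) (m 0 p t)) (\<lambda>p t. P \<alpha> (z \<alpha> p t) (m \<alpha> p t))"
        "continues_to M t \<gamma> (\<lambda>p t. Q 0 (z 0 p t) (m 0 p t)) (\<lambda>p t. Q \<alpha> (z \<alpha> p t) (m \<alpha> p t))"
        by blast
      have wc: "\<forall>\<^sub>F p in nhds p. wedge (d_fun (\<lambda>p t. P \<beta> (z \<beta> p t) (m \<beta> p t)))
          (d_fun (\<lambda>p t. Q \<beta> (z \<beta> p t) (m \<beta> p t))) c c' p t = W \<beta> p"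
        if \<beta>: "\<beta> \<le> M" and p: "p \<in> pnbhd q \<rho> \<beta> t" "(z \<beta> p t, m \<beta> p t) \<in> G \<beta>" for \<beta> p
      proof -
        have "\<forall>\<^sub>F p in nhds p. p \<in> pnbhd q \<rho> \<beta> t"
          using eventually_nhds_slice[OF eventually_U[OF \<beta> t p(1) zero_one_in_tidx]] by eventually_elim simp
        moreover have "\<forall>\<^sub>F p in nhds p. wedge (d_fun (\<lambda>p t. P \<beta> (z \<beta> p t) (m \<beta> p t)))
            (d_fun (\<lambda>p t. Q \<beta> (z \<beta> p t) (m \<beta> p t))) c c' p t = zm_form \<beta> c c' p t"
          using wedge_compose[OF \<beta> t p(1) c, of "G \<beta>" "P \<beta>" "Q \<beta>"] PQ_hol[OF \<beta>] PQ_bracket[OF \<beta>] p(2)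
          by blast
        ultimately show ?thesis by eventually_elim (simp add: W(2)[OF \<beta>])
      qed
      have "\<forall>\<^sub>F p in at (pathfinish \<gamma>). wedge (d_fun (\<lambda>p t. P \<alpha> (z \<alpha> p t) (m \<alpha> p t)))
          (d_fun (\<lambda>p t. Q \<alpha> (z \<alpha> p t) (m \<alpha> p t))) c c' p t = W 0 p"
        by (rule wedge_continuation[OF \<gamma>(5,6) c punctures_finite W(1) wc[OF _ \<gamma>(1,2)]]) auto
      moreover have "\<forall>\<^sub>F p in at (pathfinish \<gamma>). wedge (d_fun (\<lambda>p t. P \<alpha> (z \<alpha> p t) (m \<alpha> p t)))
          (d_fun (\<lambda>p t. Q \<alpha> (z \<alpha> p t) (m \<alpha> p t))) c c' p t = W \<alpha> p"
        using wc[OF \<alpha> \<gamma>(3,4)] by (simp add: eventually_at_filter eventually_mono)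
      \<comment> \<open>Near the endpoint the continued coefficient equals \<open>W \<alpha>\<close>
        because the bracket is 1, and \<open>W 0\<close> by continuation from infinity; the identity
        theorem spreads this over the complement of the punctures.\<close>
      ultimately have "\<forall>\<^sub>F p in at (pathfinish \<gamma>). W \<alpha> p = W 0 p" by eventually_elim simp
      from identity_off_finite[OF punctures_finite W(1)[OF \<alpha>] W(1)[OF le0] this p] show ?thesis .
    qed simp
    have "zm_form \<alpha> c c' p t = W 0 p" if "\<alpha> \<le> M" "p \<in> pnbhd q \<rho> \<alpha> t - punctures t" for \<alpha> p
      using trans[OF W(2)[OF that(1)] eq[OF that(1)]] that(2) by blast
    with W(1)[OF le0] show ?thesis by blast
  qed
  have pt: "zm_form \<alpha> Cp (Ct a) p t = dOmega Cp a p t"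
    if A: "\<alpha> \<le> M" "t \<in> T" "p \<in> pnbhd q \<rho> \<alpha> t - punctures t" "a \<in> tidx M" for \<alpha> t p a
  proof -
    obtain W where "W holomorphic_on - punctures t"
      "\<And>\<alpha> p. \<alpha> \<le> M \<Longrightarrow> p \<in> pnbhd q \<rho> \<alpha> t - punctures t \<Longrightarrow> zm_form \<alpha> Cp (Ct a) p t = W p"
      using W[OF A(2), of Cp "Ct a"] A(4) by (auto simp: coords_def)
    thus ?thesis using wedge_pt_eq[OF A(2,4), of W p] A by simp
  qed
  have tt: "zm_form \<alpha> (Ct a) (Ct b) p t = dOmega (Ct a) b p t - dOmega (Ct b) a p t"
    if A: "\<alpha> \<le> M" "t \<in> T" "p \<in> pnbhd q \<rho> \<alpha> t - punctures t" "a \<in> tidx M" "b \<in> tidx M" for \<alpha> t p a b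
  proof -
    obtain W where "W holomorphic_on - punctures t"
      "\<And>\<alpha> p. \<alpha> \<le> M \<Longrightarrow> p \<in> pnbhd q \<rho> \<alpha> t - punctures t \<Longrightarrow> zm_form \<alpha> (Ct a) (Ct b) p t = W p"
      using W[OF A(2), of "Ct a" "Ct b"] A(4,5) by (auto simp: coords_def)
    thus ?thesis using wedge_tt_eq[OF A(2,4,5), of W p] pt A by simp
  qed
  show ?thesis
  proof (intro allI impI ballI)
    fix \<alpha> t p c c' assume \<alpha>: "\<alpha> \<le> M" and t: "t \<in> T" and p: "p \<in> U \<alpha> t - (\<Union>i\<in>{1..M}. K i t)"
      and c: "c \<in> coords M" "c' \<in> coords M"
    \<comment> \<open>A cut starts at its puncture, so a point off the cuts is also off the
      punctures.\<close>
    have "q i t \<in> K i t" if "i \<in> {1..M}" for i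
      using cuts[OF that t] unfolding is_cut_def by force
    hence pF: "p \<in> pnbhd q \<rho> \<alpha> t - punctures t" using p by (auto simp: punctures_def U_def)
    have Om: "pd c (Omega q L z b) p t = dOmega c b p t" if "b \<in> tidx M" "c \<in> coords M" for b c
      using that p by (intro pd_Omega[OF log_hol log_branch t]) auto
    have Om': "b \<in> tidx M \<Longrightarrow> pd Cp (Omega q L z b) p t = dOmega Cp b p t"
       "b \<in> tidx M \<Longrightarrow> a \<in> tidx M \<Longrightarrow> pd (Ct a) (Omega q L z b) p t = dOmega (Ct a) b p t" for a b
      by (auto simp: coords_def intro!: Om simp del: pd.simps)
    \<comment> \<open>Antisymmetry leaves the pairs \<open>Cp\<close>, \<open>Ct\<close> and
      \<open>Ct\<close>, \<open>Ct\<close>. The \<open>Cp\<close> coefficient of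
      \<open>omega\<close> is 0, so its time derivative contributes nothing.\<close>
    have anti: "zm_form \<alpha> c c' p t = - zm_form \<alpha> c' c p t" for c c' by (simp add: wedge_def)
    have zero: "pd (Ct a) (\<lambda>p t. 0) p t = 0" "pd Cp (\<lambda>p t. 0) p t = 0" for a by simp_all
    show "zm_form \<alpha> c c' p t = d_form (omega q L z) c c' p t"
      using c unfolding d_form_def coords_def
      by (auto simp del: pd.simps simp: zero Om' pt[OF \<alpha> t pF] tt[OF \<alpha> t pF] anti[of "Ct _" Cp])
        (simp add: wedge_def)
  qed
qed

end
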